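(* Let $\ell, s \in \mathbb{N}_0$, and let $\lambda$ be a partition with at most $\ell+1$ parts and first part at most $s$. Let $\lambda^\circ$ denote the complement of $\lambda$ in the $(\ell+1) \times s$ rectangle. Let $K$ be a field and let $E$ be the natural $2$-dimensional representation of $\mathrm{SL}_2(K)$. Then there is an isomorphism of representations of $\mathrm{SL}_2(K)$ $$\nabla^\lambda \mathrm{Sym}^{\ell} E \cong \nabla^{\lambda^\circ} \mathrm{Sym}_{\ell} E.$$
   Context: A partition is a weakly decreasing finite sequence of natural numbers (its parts); $\ell(\lambda)$ is the number of parts. The complement of $\lambda$ in the $d\times s$ rectangle ($d$ rows, $s$ columns) is the partition $\lambda^\circ$ whose parts are the non-zero entries of $(s-\lambda_d,\ldots,s-\lambda_1)$, where $\lambda_i=0$ for $i>\ell(\lambda)$. For a $K$-vector space $V$, $S_r$ acts on $V^{\otimes r}$ by place permutation. $\mathrm{Sym}_r V=(V^{\otimes r})^{S_r}$ is the space of invariants (lower symmetric power), and $\mathrm{Sym}^r V$ is the space of coinvariants, i.e. the usual symmetric power, the quotient of $V^{\otimes r}$ by the span of all $w\cdot\sigma-w$. Schur functor $\nabla^\lambda$: let $V$ be a $KG$-module with basis $\{v_i : i\in\mathcal{B}\}$, $\mathcal{B}\subseteq \mathbb{N}_0$. The Young diagram is $[\lambda]=\{(i,j): 1\le i\le \ell(\lambda), 1\le j\le\lambda_i\}$; a $\lambda$-tableau is a function $t:[\lambda]\to\mathcal{B}$. Permutations $\sigma$ of $[\lambda]$ act on the right on tableaux by $(t\cdot\sigma)(i,j)=t((i,j)\sigma^{-1})$.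 Let $\mathrm{CPP}(\lambda)$ be the group of permutations of $[\lambda]$ preserving each column setwise. Let $\mathrm{Sym}^\lambda V=\mathrm{Sym}^{\lambda_1}V\otimes\cdots\otimes\mathrm{Sym}^{\lambda_{\ell(\lambda)}}V$, let $\mathbf{s}(t)=\bigotimes_{i=1}^{\ell(\lambda)}\prod_{j=1}^{\lambda_i}v_{t(i,j)}\in\mathrm{Sym}^\lambda V$, and let $\mathbf{e}(t)=\sum_{\sigma\in\mathrm{CPP}(\lambda)}\mathrm{sgn}(\sigma)\,\mathbf{s}(t\cdot\sigma)$. Then $\nabla^\lambda V$ is the subspace of $\mathrm{Sym}^\lambda V$ spanned by all $\mathbf{e}(t)$, $t$ a $\lambda$-tableau with entries in $\mathcal{B}$; it is a $KG$-submodule of $\mathrm{Sym}^\lambda V$. *)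

theory Defs
  imports
    "Jordan_Normal_Form.VS_Connect"
    "HOL-Algebra.AbelCoset"
    "HOL-Library.Poly_Mapping"
    "HOL-Combinatorics.Permutations"
begin

text \<open>
  The ground field is a type \<open>'k :: field\<close>, regarded as the ring record \<open>class_ring\<close>.
  A representation is a vector space record together with a left action.
\<close>

record ('k, 'v, 'g) rep = "('k, 'v) module" +
  act :: "'g \<Rightarrow> 'v \<Rightarrow> 'v"

definition representation ::
  "('g, 'm) monoid_scheme \<Rightarrow> ('k::field, 'v, 'g) rep \<Rightarrow> bool" where
  "representation G V \<longleftrightarrow>
     group G \<and> vectorspace class_ring V \<and>
     (\<forall>g\<in>carrier G. linear_map class_ring V V (act V g)) \<and>
     (\<forall>x\<in>carrier V. act V \<one>\<^bsub>G\<^esub> x = x) \<and>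
     (\<forall>g\<in>carrier G. \<forall>h\<in>carrier G. \<forall>x\<in>carrier V.
        act V (g \<otimes>\<^bsub>G\<^esub> h) x = act V g (act V h x))"

definition rep_isomorphic ::
  "('g, 'm) monoid_scheme \<Rightarrow> ('k::field, 'v, 'g) rep \<Rightarrow> ('k, 'w, 'g) rep \<Rightarrow> bool" where
  "rep_isomorphic G V W \<longleftrightarrow>
     representation G V \<and> representation G W \<and>
     (\<exists>\<phi>. linear_map class_ring V W \<phi> \<and> bij_betw \<phi> (carrier V) (carrier W) \<and>
        (\<forall>g\<in>carrier G. \<forall>x\<in>carrier V. \<phi> (act V g x) = act W g (\<phi> x)))"

abbreviation lspan :: "('k::field, 'v, 'm) module_scheme \<Rightarrow> 'v set \<Rightarrow> 'v set" where
  "lspan V S \<equiv> LinearCombinations.module.span class_ring V S"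

definition indexed_basis ::
  "('k::field, 'v, 'm) module_scheme \<Rightarrow> 'i set \<Rightarrow> ('i \<Rightarrow> 'v) \<Rightarrow> bool" where
  "indexed_basis V B v \<longleftrightarrow> inj_on v B \<and> vectorspace.basis class_ring V (v ` B)"

text \<open>
  Quotients by a subspace \<open>N\<close>: the elements are the cosets of \<open>N\<close>, and
  \<open>quot_map V N h\<close> is the map induced on cosets by a map \<open>h\<close> that preserves \<open>N\<close>.
  (The fields \<open>mult\<close> and \<open>one\<close>, which module records inherit from ring records,
  carry no meaning for modules.)
\<close>

definition quot_map ::
  "('k, 'v, 'm) module_scheme \<Rightarrow> 'v set \<Rightarrow> ('v \<Rightarrow> 'v) \<Rightarrow> 'v set \<Rightarrow> 'v set" where
  "quot_map V N h X = (\<Union>x\<in>X. N +>\<^bsub>V\<^esub> h x)"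

definition quot_rep :: "('k, 'v, 'g) rep \<Rightarrow> 'v set \<Rightarrow> ('k, 'v set, 'g) rep" where
  "quot_rep V N =
     \<lparr>carrier = a_rcosets\<^bsub>V\<^esub> N, mult = undefined, one = undefined,
      zero = N, add = (<+>\<^bsub>V\<^esub>),
      smult = (\<lambda>c. quot_map V N (\<lambda>x. c \<odot>\<^bsub>V\<^esub> x)),
      act = (\<lambda>g. quot_map V N (act V g))\<rparr>"

text \<open>
  The free vector space on a set \<open>X\<close> consists of the finitely supported functions with
  support in \<open>X\<close>; \<open>pushforward h\<close> is the linear map that extends a map \<open>h\<close> of basis elements.
\<close>

definition pushforward :: "('x \<Rightarrow> 'y) \<Rightarrow> ('x \<Rightarrow>\<^sub>0 'k::field) \<Rightarrow> ('y \<Rightarrow>\<^sub>0 'k)" where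
  "pushforward h f =
     (\<Sum>x\<in>Poly_Mapping.keys f. Poly_Mapping.single (h x) (Poly_Mapping.lookup f x))"

definition free_rep :: "'x set \<Rightarrow> ('g \<Rightarrow> 'x \<Rightarrow> 'x) \<Rightarrow> ('k::field, 'x \<Rightarrow>\<^sub>0 'k, 'g) rep" where
  "free_rep X \<alpha> =
     \<lparr>carrier = {f. Poly_Mapping.keys f \<subseteq> X}, mult = undefined, one = undefined,
      zero = 0, add = (+),
      smult = (\<lambda>c. Poly_Mapping.map (\<lambda>a. c * a)),
      act = (\<lambda>g. pushforward (\<alpha> g))\<rparr>"

text \<open>
  The tensor product of a list \<open>[V\<^sub>1, \<dots>, V\<^sub>n]\<close> of representations is the free vector space on
  the tuples in \<open>V\<^sub>1 \<times> \<dots> \<times> V\<^sub>n\<close> modulo the multilinearity relations, with the diagonal action.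
\<close>

definition tensor_free ::
  "('k::field, 'v, 'g) rep list \<Rightarrow> ('k, 'v list \<Rightarrow>\<^sub>0 'k, 'g) rep" where
  "tensor_free Vs =
     free_rep (listset (map carrier Vs)) (\<lambda>g. map2 (\<lambda>V x. act V g x) Vs)"

definition tensor_relations :: "('k::field, 'v, 'g) rep list \<Rightarrow> ('v list \<Rightarrow>\<^sub>0 'k) set" where
  "tensor_relations Vs =
     {Poly_Mapping.single (xs[i := x \<oplus>\<^bsub>Vs ! i\<^esub> y]) 1
        - Poly_Mapping.single (xs[i := x]) 1 - Poly_Mapping.single (xs[i := y]) 1 |
        xs i x y. xs \<in> listset (map carrier Vs) \<and> i < length Vs \<and>
          x \<in> carrier (Vs ! i) \<and> y \<in> carrier (Vs ! i)} \<union>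
     {Poly_Mapping.single (xs[i := c \<odot>\<^bsub>Vs ! i\<^esub> x]) 1 - Poly_Mapping.single (xs[i := x]) c |
        xs i c x. xs \<in> listset (map carrier Vs) \<and> i < length Vs \<and> x \<in> carrier (Vs ! i)}"

definition tensor_kernel :: "('k::field, 'v, 'g) rep list \<Rightarrow> ('v list \<Rightarrow>\<^sub>0 'k) set" where
  "tensor_kernel Vs = lspan (tensor_free Vs) (tensor_relations Vs)"

definition tensor ::
  "('k::field, 'v, 'g) rep list \<Rightarrow> ('k, ('v list \<Rightarrow>\<^sub>0 'k) set, 'g) rep" where
  "tensor Vs = quot_rep (tensor_free Vs) (tensor_kernel Vs)"

definition pure_tensor ::
  "('k::field, 'v, 'g) rep list \<Rightarrow> 'v list \<Rightarrow> ('v list \<Rightarrow>\<^sub>0 'k) set" where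
  "pure_tensor Vs xs = tensor_kernel Vs +>\<^bsub>tensor_free Vs\<^esub> Poly_Mapping.single xs 1"

abbreviation tensor_power ::
  "nat \<Rightarrow> ('k::field, 'v, 'g) rep \<Rightarrow> ('k, ('v list \<Rightarrow>\<^sub>0 'k) set, 'g) rep" where
  "tensor_power r V \<equiv> tensor (replicate r V)"

text \<open>
  The place permutation of \<open>V\<^sup>\<otimes>\<^sup>r\<close> induced by \<open>x\<^sub>0 \<otimes> \<dots> \<otimes> x\<^bsub>r-1\<^esub> \<mapsto> x\<^bsub>\<sigma> 0\<^esub> \<otimes> \<dots> \<otimes> x\<^bsub>\<sigma> (r-1)\<^esub>\<close>. Whether one
  permutes the places by \<open>\<sigma>\<close> or by its inverse is immaterial below, where \<open>\<sigma>\<close> ranges over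
  the whole symmetric group.
\<close>

definition place_perm ::
  "nat \<Rightarrow> ('k::field, 'v, 'g) rep \<Rightarrow> (nat \<Rightarrow> nat) \<Rightarrow>
   ('v list \<Rightarrow>\<^sub>0 'k) set \<Rightarrow> ('v list \<Rightarrow>\<^sub>0 'k) set" where
  "place_perm r V \<sigma> =
     quot_map (tensor_free (replicate r V)) (tensor_kernel (replicate r V))
       (pushforward (permute_list \<sigma>))"

definition sym_lower ::
  "nat \<Rightarrow> ('k::field, 'v, 'g) rep \<Rightarrow> ('k, ('v list \<Rightarrow>\<^sub>0 'k) set, 'g) rep" where
  "sym_lower r V =
     (tensor_power r V)
       \<lparr>carrier := {w \<in> carrier (tensor_power r V).
                      \<forall>\<sigma>. \<sigma> permutes {..<r} \<longrightarrow> place_perm r V \<sigma> w = w}\<rparr>"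

definition sym_kernel ::
  "nat \<Rightarrow> ('k::field, 'v, 'g) rep \<Rightarrow> ('v list \<Rightarrow>\<^sub>0 'k) set set" where
  "sym_kernel r V =
     lspan (tensor_power r V)
       {place_perm r V \<sigma> w \<ominus>\<^bsub>tensor_power r V\<^esub> w | \<sigma> w.
          \<sigma> permutes {..<r} \<and> w \<in> carrier (tensor_power r V)}"

definition sym_upper ::
  "nat \<Rightarrow> ('k::field, 'v, 'g) rep \<Rightarrow> ('k, ('v list \<Rightarrow>\<^sub>0 'k) set set, 'g) rep" where
  "sym_upper r V = quot_rep (tensor_power r V) (sym_kernel r V)"

definition sym_prod ::
  "('k::field, 'v, 'g) rep \<Rightarrow> 'v list \<Rightarrow> ('v list \<Rightarrow>\<^sub>0 'k) set set" where
  "sym_prod V xs =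
     sym_kernel (length xs) V +>\<^bsub>tensor_power (length xs) V\<^esub>
       pure_tensor (replicate (length xs) V) xs"

definition is_partition :: "nat list \<Rightarrow> bool" where
  "is_partition lam \<longleftrightarrow> sorted_wrt (\<ge>) lam \<and> (\<forall>p\<in>set lam. p > 0)"

text \<open>Lists are indexed from 0, so that \<open>nth_default 0 lam i\<close> is the part \<open>\<lambda>\<^bsub>i+1\<^esub>\<close>.\<close>

definition rect_complement :: "nat \<Rightarrow> nat \<Rightarrow> nat list \<Rightarrow> nat list" where
  "rect_complement d s lam =
     filter (\<lambda>p. p \<noteq> 0) (rev (map (\<lambda>i. s - nth_default 0 lam i) [0..<d]))"

text \<open>Rows and columns of Young diagrams are likewise indexed from 0.\<close>

definition diagram :: "nat list \<Rightarrow> (nat \<times> nat) set" where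
  "diagram lam = {(i, j). i < length lam \<and> j < lam ! i}"

definition tableaux :: "nat list \<Rightarrow> nat set \<Rightarrow> (nat \<times> nat \<Rightarrow> nat) set" where
  "tableaux lam B = diagram lam \<rightarrow>\<^sub>E B"

definition CPP :: "nat list \<Rightarrow> (nat \<times> nat \<Rightarrow> nat \<times> nat) set" where
  "CPP lam = {\<sigma>. \<sigma> permutes diagram lam \<and> (\<forall>b\<in>diagram lam. snd (\<sigma> b) = snd b)}"

definition tableau_perm ::
  "(nat \<times> nat \<Rightarrow> nat) \<Rightarrow> (nat \<times> nat \<Rightarrow> nat \<times> nat) \<Rightarrow> (nat \<times> nat \<Rightarrow> nat)" where
  "tableau_perm t \<sigma> = (\<lambda>b. t (inv_into UNIV \<sigma> b))"

definition sym_multi ::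
  "nat list \<Rightarrow> ('k::field, 'v, 'g) rep \<Rightarrow>
   ('k, (('v list \<Rightarrow>\<^sub>0 'k) set set list \<Rightarrow>\<^sub>0 'k) set, 'g) rep" where
  "sym_multi lam V = tensor (map (\<lambda>r. sym_upper r V) lam)"

definition row_tensor ::
  "nat list \<Rightarrow> ('k::field, 'v, 'g) rep \<Rightarrow> (nat \<Rightarrow> 'v) \<Rightarrow> (nat \<times> nat \<Rightarrow> nat) \<Rightarrow>
   (('v list \<Rightarrow>\<^sub>0 'k) set set list \<Rightarrow>\<^sub>0 'k) set" where
  "row_tensor lam V v t =
     pure_tensor (map (\<lambda>r. sym_upper r V) lam)
       (map (\<lambda>i. sym_prod V (map (\<lambda>j. v (t (i, j))) [0..<lam ! i])) [0..<length lam])"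

definition polytabloid ::
  "nat list \<Rightarrow> ('k::field, 'v, 'g) rep \<Rightarrow> (nat \<Rightarrow> 'v) \<Rightarrow> (nat \<times> nat \<Rightarrow> nat) \<Rightarrow>
   (('v list \<Rightarrow>\<^sub>0 'k) set set list \<Rightarrow>\<^sub>0 'k) set" where
  "polytabloid lam V v t =
     (\<Oplus>\<^bsub>sym_multi lam V\<^esub> \<sigma>\<in>CPP lam.
        of_int (sign \<sigma>) \<odot>\<^bsub>sym_multi lam V\<^esub> row_tensor lam V v (tableau_perm t \<sigma>))"

text \<open>
  As a subspace, \<open>\<nabla>\<^sup>\<lambda> V\<close> is defined through a basis \<open>(v\<^sub>b)\<close>, \<open>b \<in> B \<subseteq> \<nat>\<close>, of \<open>V\<close>, which is therefore a
  parameter; it is meaningful only when \<open>indexed_basis V B v\<close> holds.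
\<close>

definition schur ::
  "nat list \<Rightarrow> ('k::field, 'v, 'g) rep \<Rightarrow> nat set \<Rightarrow> (nat \<Rightarrow> 'v) \<Rightarrow>
   ('k, (('v list \<Rightarrow>\<^sub>0 'k) set set list \<Rightarrow>\<^sub>0 'k) set, 'g) rep" where
  "schur lam V B v =
     (sym_multi lam V)
       \<lparr>carrier := lspan (sym_multi lam V) (polytabloid lam V v ` tableaux lam B)\<rparr>"

definition SL :: "'k::field itself \<Rightarrow> nat \<Rightarrow> 'k mat monoid" where
  "SL ty n = \<lparr>carrier = {A \<in> carrier_mat n n. det A = 1}, mult = (*), one = 1\<^sub>m n\<rparr>"

definition natural_rep :: "'k::field itself \<Rightarrow> nat \<Rightarrow> ('k, 'k vec, 'k mat) rep" where
  "natural_rep ty n = module.extend (module_vec ty n) (rep.fields (*\<^sub>v))"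

end

theory Submission
  imports Defs
begin

text \<open>
  Let \<open>n = l + 1\<close>. Reading a basis vector \<open>v\<^sub>k\<close> in row \<open>i\<close> as the matrix entry \<open>X\<^sub>i\<^sub>k\<close> turns an element of
  the multi-symmetric power of an \<open>n\<close>-dimensional representation into a polynomial function \<open>f\<close> of an
  \<open>n \<times> n\<close> matrix \<open>X\<close>, and \<open>e(t)\<close> into the product over the columns of \<open>\<lambda>\<close> of minors on the top rows of
  \<open>X\<close>. If \<open>X Y\<^sup>T\<close> is the antidiagonal permutation matrix, then Jacobi's identity expresses a minor on the
  top \<open>k\<close> rows of \<open>X\<close> as \<open>\<plusminus> det X\<close> times the complementary minor on the top \<open>n - k\<close> rows of \<open>Y\<close>. Hence
  \<open>f(X) = (det X)\<^sup>s f'(Y)\<close> defines a correspondence \<open>f \<mapsto> f'\<close> that takes the spanning elements \<open>e(t)\<close> for \<open>\<lambda>\<close> to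
  zero or, up to sign, to those for \<open>\<lambda>\<^sup>\<circ>\<close>, and no basis of semistandard elements is needed. It is
  equivariant when the second representation is dual to the first and the group acts with determinant
  \<open>1\<close>; for \<open>Sym\<^sup>l E\<close> and \<open>Sym\<^sub>l E\<close> the duality comes from the determinant form on \<open>E\<close>. Since \<open>K\<close> may be finite,
  \<open>X\<close> and \<open>Y\<close> range over matrices with entries in \<open>K(T)\<close>.
\<close>

text \<open>The exponent s counts columns, empty ones included: every column contributes one factor
  det X, and a column of length 0 is traded for one of length n. The antidiagonal matrix, where the
  identity might be expected, turns the bottom rows that Jacobi's identity produces into top rows.
  It is symmetric, so the relation between X and Y is symmetric too; the correspondence can be run
  backwards and is surjective without any count of dimensions. The correspondence is given by an
  equation between functions, so the crux is that elements are determined by their values. One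
  matrix X with nonzero determinant achieves this: Kronecker substitution separates the elements,
  and the determinant being nonzero provides the partner Y. Linearity and equivariance then only
  require the defining equation to be checked. That the group acts on the upper symmetric power with
  determinant 1 is read off from shears, which act by unitriangular matrices. This is uniform in the
  field and covers those with two or three elements, over which SL_2 is not perfect.\<close>

hide_const (open) Module.submodule

section \<open>Spans, quotients and linear forms\<close>

lemma class_moduleD:
  fixes V :: "('k::field, 'v, 'm) module_scheme"
  assumes "Module.module class_ring V"
  shows "\<And>c x. x \<in> carrier V \<Longrightarrow> c \<odot>\<^bsub>V\<^esub> x \<in> carrier V"
    and "\<And>a b x. x \<in> carrier V \<Longrightarrow> (a + b) \<odot>\<^bsub>V\<^esub> x = a \<odot>\<^bsub>V\<^esub> x \<oplus>\<^bsub>V\<^esub> b \<odot>\<^bsub>V\<^esub> x"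
    and "\<And>a x y. x \<in> carrier V \<Longrightarrow> y \<in> carrier V \<Longrightarrow>
      a \<odot>\<^bsub>V\<^esub> (x \<oplus>\<^bsub>V\<^esub> y) = a \<odot>\<^bsub>V\<^esub> x \<oplus>\<^bsub>V\<^esub> a \<odot>\<^bsub>V\<^esub> y"
    and "\<And>a b x. x \<in> carrier V \<Longrightarrow> (a * b) \<odot>\<^bsub>V\<^esub> x = a \<odot>\<^bsub>V\<^esub> (b \<odot>\<^bsub>V\<^esub> x)"
    and "\<And>x. x \<in> carrier V \<Longrightarrow> 1 \<odot>\<^bsub>V\<^esub> x = x"
    and "\<And>x. x \<in> carrier V \<Longrightarrow> 0 \<odot>\<^bsub>V\<^esub> x = \<zero>\<^bsub>V\<^esub>"
    and "\<And>c. c \<odot>\<^bsub>V\<^esub> \<zero>\<^bsub>V\<^esub> = \<zero>\<^bsub>V\<^esub>"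
    and "\<And>x. x \<in> carrier V \<Longrightarrow> \<ominus>\<^bsub>V\<^esub> x = (- 1) \<odot>\<^bsub>V\<^esub> x"
proof -
  interpret V: Module.module class_ring V by fact
  show *: "c \<odot>\<^bsub>V\<^esub> x \<in> carrier V" if "x \<in> carrier V" for c x
    using V.smult_closed[of c x] that by simp
  show add: "(a + b) \<odot>\<^bsub>V\<^esub> x = a \<odot>\<^bsub>V\<^esub> x \<oplus>\<^bsub>V\<^esub> b \<odot>\<^bsub>V\<^esub> x" if "x \<in> carrier V" for a b x
    using V.smult_l_distr[of a b x] that by simp
  show "a \<odot>\<^bsub>V\<^esub> (x \<oplus>\<^bsub>V\<^esub> y) = a \<odot>\<^bsub>V\<^esub> x \<oplus>\<^bsub>V\<^esub> a \<odot>\<^bsub>V\<^esub> y" if "x \<in> carrier V" "y \<in> carrier V" for a x y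
    using V.smult_r_distr[of a x y] that by simp
  show "(a * b) \<odot>\<^bsub>V\<^esub> x = a \<odot>\<^bsub>V\<^esub> (b \<odot>\<^bsub>V\<^esub> x)" if "x \<in> carrier V" for a b x
    using V.smult_assoc1[of a b x] that by simp
  show one: "1 \<odot>\<^bsub>V\<^esub> x = x" if "x \<in> carrier V" for x
    using V.smult_one[of x] that by simp
  show zero: "0 \<odot>\<^bsub>V\<^esub> x = \<zero>\<^bsub>V\<^esub>" if "x \<in> carrier V" for x
    using V.smult_l_null[of x] that by simp
  show "c \<odot>\<^bsub>V\<^esub> \<zero>\<^bsub>V\<^esub> = \<zero>\<^bsub>V\<^esub>" for c
    using V.smult_r_null[of c] by simp
  show "\<ominus>\<^bsub>V\<^esub> x = (- 1) \<odot>\<^bsub>V\<^esub> x" if x: "x \<in> carrier V" for x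
    by (rule V.minus_equality) (use add[OF x, of "- 1" 1] x one zero * in auto)
qed

lemma submoduleI:
  assumes "Module.module class_ring V" "W \<subseteq> carrier V" "W \<noteq> {}"
    "\<And>c x. x \<in> W \<Longrightarrow> c \<odot>\<^bsub>V\<^esub> x \<in> W" "\<And>x y. x \<in> W \<Longrightarrow> y \<in> W \<Longrightarrow> x \<oplus>\<^bsub>V\<^esub> y \<in> W"
  shows "LinearCombinations.submodule class_ring W V"
proof -
  interpret V: Module.module class_ring V by fact
  obtain x where x: "x \<in> W" using assms by auto
  have "\<zero>\<^bsub>V\<^esub> = 0 \<odot>\<^bsub>V\<^esub> x" using x assms V.smult_l_null[of x] by auto
  then show ?thesis using assms x by unfold_locales auto
qed

lemma span_submodule:
  assumes "Module.module class_ring V" "S \<subseteq> carrier V"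
  shows "LinearCombinations.submodule class_ring (lspan V S) V"
  using LinearCombinations.module.span_is_submodule[OF assms] .

lemma span_mem:
  assumes "Module.module class_ring V" "S \<subseteq> carrier V" "x \<in> S"
  shows "x \<in> lspan V S"
  using LinearCombinations.module.in_own_span[OF assms(1,2)] assms(3) by blast

lemma span_least:
  assumes "Module.module class_ring V" "S \<subseteq> Q" "LinearCombinations.submodule class_ring Q V"
  shows "lspan V S \<subseteq> Q"
  using LinearCombinations.module.span_is_subset[OF assms] .

lemma span_induct:
  assumes V: "Module.module class_ring V" and S: "S \<subseteq> carrier V" and x: "x \<in> lspan V S"
    and zero: "P \<zero>\<^bsub>V\<^esub>"
    and add: "\<And>x y. x \<in> carrier V \<Longrightarrow> y \<in> carrier V \<Longrightarrow> P x \<Longrightarrow> P y \<Longrightarrow> P (x \<oplus>\<^bsub>V\<^esub> y)"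
    and smult: "\<And>c x. x \<in> carrier V \<Longrightarrow> P x \<Longrightarrow> P (c \<odot>\<^bsub>V\<^esub> x)"
    and base: "\<And>s. s \<in> S \<Longrightarrow> P s"
  shows "P x"
proof -
  interpret V: Module.module class_ring V by fact
  have "LinearCombinations.submodule class_ring {x \<in> carrier V. P x} V"
    by (rule submoduleI) (use V zero add smult in auto)
  from span_least[OF V _ this, of S] S base x show ?thesis by auto
qed

lemma submoduleD:
  assumes "LinearCombinations.submodule class_ring Q V"
  shows "Q \<subseteq> carrier V" "\<zero>\<^bsub>V\<^esub> \<in> Q" "\<And>x y. x \<in> Q \<Longrightarrow> y \<in> Q \<Longrightarrow> x \<oplus>\<^bsub>V\<^esub> y \<in> Q"
    "\<And>c x. x \<in> Q \<Longrightarrow> c \<odot>\<^bsub>V\<^esub> x \<in> Q"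
  using assms unfolding LinearCombinations.submodule_def by auto

lemma representationI:
  fixes V :: "('k::field, 'v, 'g) rep"
  assumes "group G" "Module.module class_ring V"
    and "\<And>g x. g \<in> carrier G \<Longrightarrow> x \<in> carrier V \<Longrightarrow> act V g x \<in> carrier V"
    and "\<And>g x y. g \<in> carrier G \<Longrightarrow> x \<in> carrier V \<Longrightarrow> y \<in> carrier V \<Longrightarrow>
      act V g (x \<oplus>\<^bsub>V\<^esub> y) = act V g x \<oplus>\<^bsub>V\<^esub> act V g y"
    and "\<And>g c x. g \<in> carrier G \<Longrightarrow> x \<in> carrier V \<Longrightarrow> act V g (c \<odot>\<^bsub>V\<^esub> x) = c \<odot>\<^bsub>V\<^esub> act V g x"
    and "\<And>x. x \<in> carrier V \<Longrightarrow> act V \<one>\<^bsub>G\<^esub> x = x"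
    and "\<And>g h x. g \<in> carrier G \<Longrightarrow> h \<in> carrier G \<Longrightarrow> x \<in> carrier V \<Longrightarrow>
      act V (g \<otimes>\<^bsub>G\<^esub> h) x = act V g (act V h x)"
  shows "representation G V"
proof -
  have vs: "vectorspace class_ring V"
    unfolding vectorspace_def using assms(2) class_field by auto
  show ?thesis
    unfolding representation_def linear_map_def mod_hom_def mod_hom_axioms_def
      LinearCombinations.module_hom_def
    using assms vs by auto
qed

lemma representationD:
  fixes V :: "('k::field, 'v, 'g) rep"
  assumes "representation G V"
  shows "group G" "Module.module class_ring V" "vectorspace class_ring V"
    and "\<And>g x. g \<in> carrier G \<Longrightarrow> x \<in> carrier V \<Longrightarrow> act V g x \<in> carrier V"
    and "\<And>g x y. g \<in> carrier G \<Longrightarrow> x \<in> carrier V \<Longrightarrow> y \<in> carrier V \<Longrightarrow>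
      act V g (x \<oplus>\<^bsub>V\<^esub> y) = act V g x \<oplus>\<^bsub>V\<^esub> act V g y"
    and "\<And>g c x. g \<in> carrier G \<Longrightarrow> x \<in> carrier V \<Longrightarrow> act V g (c \<odot>\<^bsub>V\<^esub> x) = c \<odot>\<^bsub>V\<^esub> act V g x"
    and "\<And>x. x \<in> carrier V \<Longrightarrow> act V \<one>\<^bsub>G\<^esub> x = x"
    and "\<And>g h x. g \<in> carrier G \<Longrightarrow> h \<in> carrier G \<Longrightarrow> x \<in> carrier V \<Longrightarrow>
      act V (g \<otimes>\<^bsub>G\<^esub> h) x = act V g (act V h x)"
  using assms
  unfolding representation_def linear_map_def mod_hom_def mod_hom_axioms_def vectorspace_def
      LinearCombinations.module_hom_def by auto

lemma representation_submodule:
  fixes V :: "('k::field, 'v, 'g) rep"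
  assumes V: "representation G V" and W: "LinearCombinations.submodule class_ring W V"
    and inv: "\<And>g x. g \<in> carrier G \<Longrightarrow> x \<in> W \<Longrightarrow> act V g x \<in> W"
  shows "representation G (V\<lparr>carrier := W\<rparr>)"
proof -
  note [simp] = representationD[OF V] subsetD[OF submoduleD(1)[OF W]]
  have "Module.module class_ring (V\<lparr>carrier := W\<rparr>)"
    using LinearCombinations.module.submodule_is_module[OF representationD(2)[OF V] W] .
  then show ?thesis
    by (intro representationI) (use inv in auto)
qed

lemma span_invariant:
  fixes V :: "('k::field, 'v, 'g) rep"
  assumes V: "representation G V" and S: "S \<subseteq> carrier V" and g: "g \<in> carrier G"
    and inv: "\<And>x. x \<in> S \<Longrightarrow> act V g x \<in> lspan V S" and x: "x \<in> lspan V S"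
  shows "act V g x \<in> lspan V S"
proof -
  note r = representationD[OF V]
  note sub = span_submodule[OF r(2) S]
  interpret V: Module.module class_ring V by (rule r(2))
  have z: "act V g \<zero>\<^bsub>V\<^esub> = \<zero>\<^bsub>V\<^esub>"
    using r(6)[OF g V.zero_closed, of 0] r(4)[OF g V.zero_closed] V.smult_l_null by auto
  show ?thesis
    by (rule span_induct[OF r(2) S x])
      (use submoduleD[OF sub] r(5,6)[OF g] inv z in auto)
qed

section \<open>Quotients by a subspace\<close>

locale quot_space =
  fixes V :: "('k::field, 'v, 'g) rep" and N
  assumes V: "Module.module class_ring V" and N: "LinearCombinations.submodule class_ring N V"
begin

interpretation V: Module.module class_ring V by (rule V)

lemma abelian_sub: "abelian_subgroup N V"
proof -
  have "\<And>x. x \<in> N \<Longrightarrow> \<ominus>\<^bsub>V\<^esub> x \<in> N"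
    using submoduleD[OF N] class_moduleD(8)[OF V] by auto
  then have "subgroup N (add_monoid V)"
    using submoduleD[OF N] by (intro subgroup.intro) (auto simp: a_inv_def)
  then show ?thesis
    by (intro abelian_subgroupI3 additive_subgroup.intro) (auto simp: V.abelian_group_axioms)
qed

interpretation N: abelian_subgroup N V by (rule abelian_sub)

lemma coset_eq:
  assumes "x \<in> carrier V" "y \<in> carrier V" "n \<in> N" "y = n \<oplus>\<^bsub>V\<^esub> x"
  shows "N +>\<^bsub>V\<^esub> y = N +>\<^bsub>V\<^esub> x"
proof -
  have "y \<in> N +>\<^bsub>V\<^esub> x" using assms by (auto simp: a_r_coset_def')
  then show ?thesis using V.a_repr_independence[of y N x] assms N.a_subgroup by metis
qed

lemma coset_mem: "x \<in> carrier V \<Longrightarrow> x \<in> N +>\<^bsub>V\<^esub> x"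
  using N.a_rcos_self by blast

lemma coset_memD: "y \<in> N +>\<^bsub>V\<^esub> x \<Longrightarrow> \<exists>n\<in>N. y = n \<oplus>\<^bsub>V\<^esub> x"
  by (auto simp: a_r_coset_def')

lemma quot_cases:
  assumes "X \<in> carrier (quot_rep V N)"
  obtains x where "x \<in> carrier V" "X = N +>\<^bsub>V\<^esub> x"
  using assms by (auto simp: quot_rep_def A_RCOSETS_def')

lemma quot_carrier: "x \<in> carrier V \<Longrightarrow> N +>\<^bsub>V\<^esub> x \<in> carrier (quot_rep V N)"
  by (auto simp: quot_rep_def A_RCOSETS_def')

lemma quot_add:
  assumes "x \<in> carrier V" "y \<in> carrier V"
  shows "(N +>\<^bsub>V\<^esub> x) \<oplus>\<^bsub>quot_rep V N\<^esub> (N +>\<^bsub>V\<^esub> y) = N +>\<^bsub>V\<^esub> (x \<oplus>\<^bsub>V\<^esub> y)"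
  using N.a_rcos_sum[OF assms] by (simp add: quot_rep_def)

text \<open>The union in \<open>quot_map\<close> runs over all representatives of the coset. As
  \<open>h\<close> is additive and preserves \<open>N\<close>, all of them yield the same coset, so
  the union collapses to one term.\<close>

lemma quot_map_coset:
  assumes x: "x \<in> carrier V"
    and h: "\<And>x. x \<in> carrier V \<Longrightarrow> h x \<in> carrier V" "\<And>x. x \<in> N \<Longrightarrow> h x \<in> N"
      "\<And>x y. x \<in> carrier V \<Longrightarrow> y \<in> carrier V \<Longrightarrow> h (x \<oplus>\<^bsub>V\<^esub> y) = h x \<oplus>\<^bsub>V\<^esub> h y"
  shows "quot_map V N h (N +>\<^bsub>V\<^esub> x) = N +>\<^bsub>V\<^esub> h x"
proof -
  have "N +>\<^bsub>V\<^esub> h y = N +>\<^bsub>V\<^esub> h x" if y: "y \<in> N +>\<^bsub>V\<^esub> x" for y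
  proof -
    obtain n where n: "n \<in> N" "y = n \<oplus>\<^bsub>V\<^esub> x" using coset_memD[OF y] by auto
    have nV: "n \<in> carrier V" using n(1) submoduleD(1)[OF N] by blast
    have "h y = h n \<oplus>\<^bsub>V\<^esub> h x" unfolding n(2) by (rule h(3)[OF nV x])
    moreover have "y \<in> carrier V" unfolding n(2) by (rule V.a_closed[OF nV x])
    ultimately show ?thesis using coset_eq[OF h(1)[OF x] h(1) h(2)[OF n(1)]] by blast
  qed
  then have "(\<Union>y\<in>N +>\<^bsub>V\<^esub> x. N +>\<^bsub>V\<^esub> h y) = (\<Union>y\<in>N +>\<^bsub>V\<^esub> x. N +>\<^bsub>V\<^esub> h x)"
    by (intro SUP_cong) auto
  then show ?thesis unfolding quot_map_def using coset_mem[OF x] by auto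
qed

lemma quot_smult:
  assumes "x \<in> carrier V"
  shows "c \<odot>\<^bsub>quot_rep V N\<^esub> (N +>\<^bsub>V\<^esub> x) = N +>\<^bsub>V\<^esub> (c \<odot>\<^bsub>V\<^esub> x)"
  using quot_map_coset[OF assms, of "\<lambda>x. c \<odot>\<^bsub>V\<^esub> x"] submoduleD(4)[OF N, of _ c] class_moduleD(1,3)[OF V]
  by (simp add: quot_rep_def)

lemma quot_zero: "\<zero>\<^bsub>quot_rep V N\<^esub> = N +>\<^bsub>V\<^esub> \<zero>\<^bsub>V\<^esub>"
  using V.a_coset_add_zero[OF submoduleD(1)[OF N]] by (simp add: quot_rep_def)

lemma quot_module: "Module.module class_ring (quot_rep V N)"
proof (rule moduleI)
  show "cring (class_ring :: 'k ring)" by (rule class_cring.cring_axioms)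
  show "abelian_group (quot_rep V N)"
  proof (rule abelian_groupI)
    fix X assume "X \<in> carrier (quot_rep V N)"
    then obtain x where x: "x \<in> carrier V" "X = N +>\<^bsub>V\<^esub> x" by (rule quot_cases)
    show "\<exists>Y\<in>carrier (quot_rep V N). Y \<oplus>\<^bsub>quot_rep V N\<^esub> X = \<zero>\<^bsub>quot_rep V N\<^esub>"
      by (rule bexI[of _ "N +>\<^bsub>V\<^esub> (\<ominus>\<^bsub>V\<^esub> x)"])
        (use x in \<open>auto simp: quot_add quot_zero quot_carrier V.l_neg\<close>)
  qed (auto elim!: quot_cases simp: quot_add quot_carrier quot_zero V.a_ac)
qed (erule quot_cases, simp add: quot_smult quot_add quot_carrier class_moduleD(1-5)[OF V] | (erule quot_cases)+, simp add: quot_smult quot_add quot_carrier class_moduleD(1-5)[OF V])+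

lemma quot_act:
  assumes "x \<in> carrier V"
    and h: "\<And>x. x \<in> carrier V \<Longrightarrow> act V g x \<in> carrier V" "\<And>x. x \<in> N \<Longrightarrow> act V g x \<in> N"
      "\<And>x y. x \<in> carrier V \<Longrightarrow> y \<in> carrier V \<Longrightarrow> act V g (x \<oplus>\<^bsub>V\<^esub> y) = act V g x \<oplus>\<^bsub>V\<^esub> act V g y"
  shows "act (quot_rep V N) g (N +>\<^bsub>V\<^esub> x) = N +>\<^bsub>V\<^esub> act V g x"
  using quot_map_coset[OF assms(1), of "act V g"] h by (simp add: quot_rep_def)

lemma quot_representation:
  assumes G: "representation G V" and inv: "\<And>g x. g \<in> carrier G \<Longrightarrow> x \<in> N \<Longrightarrow> act V g x \<in> N"
  shows "representation G (quot_rep V N)"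
proof -
  note r = representationD[OF G]
  interpret G: group G by (rule r)
  have *: "act (quot_rep V N) g (N +>\<^bsub>V\<^esub> x) = N +>\<^bsub>V\<^esub> act V g x"
    if "g \<in> carrier G" "x \<in> carrier V" for g x
    by (rule quot_act[OF that(2) r(4)[OF that(1)] inv[OF that(1)] r(5)[OF that(1)]])
  show ?thesis
    apply (rule representationI)
          apply (fact r(1))
         apply (fact quot_module)
        apply (erule quot_cases, simp add: quot_carrier * r)
       apply ((erule quot_cases)+, simp add: quot_carrier quot_add * r)
      apply (erule quot_cases, simp add: quot_carrier quot_smult * class_moduleD(1)[OF V] r)
     apply (erule quot_cases, simp add: quot_carrier * r)
    apply (erule quot_cases, simp add: quot_carrier * r)
    done
qed

end

section \<open>Free vector spaces and linear extension of maps\<close>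

lemma lookup_scale [simp]:
  "Poly_Mapping.lookup (Poly_Mapping.map (\<lambda>a. c * a) f) x = c * Poly_Mapping.lookup (f :: _ \<Rightarrow>\<^sub>0 'k::field) x"
  by (simp add: Poly_Mapping.map.rep_eq when_def)

lemma scale_add_left:
  "Poly_Mapping.map (\<lambda>a. (c + d) * a) f = Poly_Mapping.map (\<lambda>a. c * a) f + Poly_Mapping.map (\<lambda>a. d * a) (f :: _ \<Rightarrow>\<^sub>0 'k::field)"
  by (rule poly_mapping_eqI, simp only: lookup_scale lookup_add, rule distrib_right)

lemma scale_add_right:
  "Poly_Mapping.map (\<lambda>a. c * a) (f + g) = Poly_Mapping.map (\<lambda>a. c * a) f + Poly_Mapping.map (\<lambda>a. c * a) (g :: _ \<Rightarrow>\<^sub>0 'k::field)"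
  by (rule poly_mapping_eqI, simp only: lookup_scale lookup_add, rule distrib_left)

lemma scale_mult:
  "Poly_Mapping.map (\<lambda>a. c * d * a) f = Poly_Mapping.map (\<lambda>a. c * a) (Poly_Mapping.map (\<lambda>a. d * a) (f :: _ \<Rightarrow>\<^sub>0 'k::field))"
  by (rule poly_mapping_eqI, simp only: lookup_scale, rule mult.assoc)

lemma scale_single:
  "Poly_Mapping.map (\<lambda>a. c * a) (Poly_Mapping.single x d) = Poly_Mapping.single x (c * d :: 'k::field)"
  by (rule poly_mapping_eqI) (auto simp: lookup_single when_def)

lemma keys_scale: "Poly_Mapping.keys (Poly_Mapping.map (\<lambda>a. c * a) f) \<subseteq> Poly_Mapping.keys (f :: _ \<Rightarrow>\<^sub>0 'k::field)"
  by (auto simp: in_keys_iff)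

lemma poly_mapping_single_sum:
  fixes f :: "'x \<Rightarrow>\<^sub>0 'k::field"
  shows "f = (\<Sum>x\<in>Poly_Mapping.keys f. Poly_Mapping.single x (Poly_Mapping.lookup f x))"
  by (rule poly_mapping_eqI) (auto simp: lookup_sum lookup_single when_def in_keys_iff sum.delta)

text \<open>Additivity reduces the claim to functions with one term. Since these are compared for
  every coefficient \<open>a\<close>, additivity alone suffices and homogeneity never has to be
  checked.\<close>

lemma additive_poly_mapping_eqI:
  fixes F H :: "('x \<Rightarrow>\<^sub>0 'k::field) \<Rightarrow> 'b::ab_group_add"
  assumes F: "\<And>f g. F (f + g) = F f + F g" and H: "\<And>f g. H (f + g) = H f + H g"
    and s: "\<And>x a. x \<in> Poly_Mapping.keys f \<Longrightarrow> F (Poly_Mapping.single x a) = H (Poly_Mapping.single x a)"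
  shows "F f = H f"
proof -
  have z: "F 0 = 0" "H 0 = 0" using F[of 0 0] H[of 0 0] by auto
  have "F (\<Sum>x\<in>A. Poly_Mapping.single x (Poly_Mapping.lookup f x)) =
      H (\<Sum>x\<in>A. Poly_Mapping.single x (Poly_Mapping.lookup f x))"
    if "finite A" "A \<subseteq> Poly_Mapping.keys f" for A
    using that by (induction A) (auto simp: z F H s)
  from this[of "Poly_Mapping.keys f"] show ?thesis
    using poly_mapping_single_sum[of f] by simp
qed

text \<open>The linear extension of \<open>h\<close>, with scalars carried along \<iota>. The target
  is kept general because forms are later taken with values in the field itself, in polynomials and
  in rational functions.\<close>

definition ext_form :: "('k::field \<Rightarrow> 'l::comm_ring_1) \<Rightarrow> ('x \<Rightarrow> 'l) \<Rightarrow> ('x \<Rightarrow>\<^sub>0 'k) \<Rightarrow> 'l" where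
  "ext_form \<iota> h f = (\<Sum>x\<in>Poly_Mapping.keys f. \<iota> (Poly_Mapping.lookup f x) * h x)"

lemma pushforward_single [simp]: "pushforward h (Poly_Mapping.single x a) = Poly_Mapping.single (h x) a"
  by (cases "a = 0") (auto simp: pushforward_def)

lemma pushforward_superset:
  assumes "finite S" "Poly_Mapping.keys f \<subseteq> S"
  shows "pushforward h f = (\<Sum>x\<in>S. Poly_Mapping.single (h x) (Poly_Mapping.lookup f x))"
  unfolding pushforward_def by (rule sum.mono_neutral_left) (use assms in \<open>auto simp: in_keys_iff\<close>)

lemma pushforward_add: "pushforward h (f + g) = pushforward h f + pushforward h g"
proof -
  let ?S = "Poly_Mapping.keys f \<union> Poly_Mapping.keys g"
  have "Poly_Mapping.keys (f + g) \<subseteq> ?S" by (rule Poly_Mapping.keys_add)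
  then show ?thesis
    by (simp add: pushforward_superset[of ?S] lookup_add single_add sum.distrib)
qed

lemma pushforward_scale:
  "pushforward h (Poly_Mapping.map (\<lambda>a. c * a) f) = Poly_Mapping.map (\<lambda>a. c * a) (pushforward h f)"
proof (rule poly_mapping_eqI)
  fix y
  show "Poly_Mapping.lookup (pushforward h (Poly_Mapping.map ((*) c) f)) y
    = Poly_Mapping.lookup (Poly_Mapping.map ((*) c) (pushforward h f)) y"
    unfolding pushforward_superset[OF finite_keys keys_scale]
    by (simp add: pushforward_def lookup_sum lookup_single sum_distrib_left when_def if_distrib cong: if_cong)
qed

lemma pushforward_comp: "pushforward h (pushforward k f) = pushforward (h \<circ> k) f"
  by (rule additive_poly_mapping_eqI) (auto simp: pushforward_add)

lemma pushforward_cong: "(\<And>x. x \<in> Poly_Mapping.keys f \<Longrightarrow> h x = k x) \<Longrightarrow> pushforward h f = pushforward k f"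
  by (rule additive_poly_mapping_eqI) (auto simp: pushforward_add)

lemma pushforward_ident: "pushforward (\<lambda>x. x) f = f"
  by (rule additive_poly_mapping_eqI) (auto simp: pushforward_add)

lemma pushforward_diff: "pushforward h (f - g) = pushforward h f - pushforward h g"
  using pushforward_add[of h "f - g" g] by simp

lemma keys_pushforward: "Poly_Mapping.keys (pushforward h f) \<subseteq> h ` Poly_Mapping.keys f"
  unfolding pushforward_def
  by (rule order_trans[OF Poly_Mapping.keys_sum]) (auto split: if_splits)

context
  fixes \<iota> :: "'k::field \<Rightarrow> 'l::comm_ring_1"
  assumes \<iota>: "comm_ring_hom \<iota>"
begin

interpretation \<iota>: comm_ring_hom \<iota> by (rule \<iota>)

lemma ext_form_superset:
  assumes "finite S" "Poly_Mapping.keys f \<subseteq> S"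
  shows "ext_form \<iota> h f = (\<Sum>x\<in>S. \<iota> (Poly_Mapping.lookup f x) * h x)"
  unfolding ext_form_def by (rule sum.mono_neutral_left) (use assms in \<open>auto simp: in_keys_iff\<close>)

lemma ext_form_add: "ext_form \<iota> h (f + g) = ext_form \<iota> h f + ext_form \<iota> h g"
proof -
  let ?S = "Poly_Mapping.keys f \<union> Poly_Mapping.keys g"
  have "Poly_Mapping.keys (f + g) \<subseteq> ?S" by (rule Poly_Mapping.keys_add)
  then show ?thesis
    by (simp add: ext_form_superset[of ?S] lookup_add \<iota>.hom_add distrib_right sum.distrib)
qed

lemma ext_form_diff: "ext_form \<iota> h (f - g) = ext_form \<iota> h f - ext_form \<iota> h g"
  using ext_form_add[of h "f - g" g] by simp

lemma ext_form_scale: "ext_form \<iota> h (Poly_Mapping.map (\<lambda>a. c * a) f) = \<iota> c * ext_form \<iota> h f"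
  unfolding ext_form_superset[OF finite_keys keys_scale]
  by (simp add: ext_form_def sum_distrib_left \<iota>.hom_mult mult.assoc)

lemma ext_form_single [simp]: "ext_form \<iota> h (Poly_Mapping.single x a) = \<iota> a * h x"
  by (cases "a = 0") (auto simp: ext_form_def)

end

definition lin_form :: "('k::field \<Rightarrow> 'l::comm_ring_1) \<Rightarrow> ('k, 'v, 'm) module_scheme \<Rightarrow> ('v \<Rightarrow> 'l) \<Rightarrow> bool" where
  "lin_form \<iota> V f \<longleftrightarrow>
     (\<forall>x\<in>carrier V. \<forall>y\<in>carrier V. f (x \<oplus>\<^bsub>V\<^esub> y) = f x + f y) \<and>
     (\<forall>c. \<forall>x\<in>carrier V. f (c \<odot>\<^bsub>V\<^esub> x) = \<iota> c * f x)"

lemma lin_formD: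
  assumes "lin_form \<iota> V f"
  shows "\<And>x y. x \<in> carrier V \<Longrightarrow> y \<in> carrier V \<Longrightarrow> f (x \<oplus>\<^bsub>V\<^esub> y) = f x + f y"
    and "\<And>c x. x \<in> carrier V \<Longrightarrow> f (c \<odot>\<^bsub>V\<^esub> x) = \<iota> c * f x"
  using assms by (auto simp: lin_form_def)

lemma lin_form_zero:
  assumes V: "Module.module class_ring V" and f: "lin_form \<iota> V f"
  shows "f \<zero>\<^bsub>V\<^esub> = 0"
proof -
  interpret V: Module.module class_ring V by fact
  show ?thesis using lin_formD(1)[OF f V.zero_closed V.zero_closed] by simp
qed

lemma lin_form_minus:
  fixes V :: "('k::field, 'v, 'm) module_scheme"
  assumes V: "Module.module class_ring V" and f: "lin_form \<iota> V f" and x: "x \<in> carrier V" "y \<in> carrier V"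
  shows "f (x \<ominus>\<^bsub>V\<^esub> y) = f x - f y"
proof -
  interpret V: Module.module class_ring V by fact
  have "f (\<ominus>\<^bsub>V\<^esub> y) + f y = 0"
    using lin_formD(1)[OF f V.a_inv_closed[OF x(2)] x(2)] lin_form_zero[OF V f] V.l_neg[OF x(2)] by simp
  then show ?thesis
    unfolding a_minus_def using lin_formD(1)[OF f x(1) V.a_inv_closed[OF x(2)]]
    by (simp add: eq_neg_iff_add_eq_0)
qed

lemma lin_form_finsum:
  assumes V: "Module.module class_ring V" and f: "lin_form \<iota> V f" and "finite A" "\<And>a. a \<in> A \<Longrightarrow> z a \<in> carrier V"
  shows "f (\<Oplus>\<^bsub>V\<^esub>a\<in>A. z a) = (\<Sum>a\<in>A. f (z a))"
  using assms(3,4)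
proof (induction A)
  case (insert a A)
  interpret V: Module.module class_ring V by fact
  show ?case using insert
    by (subst V.finsum_insert) (auto simp: lin_formD(1)[OF f] Pi_def V.finsum_closed)
next
  case empty
  interpret V: Module.module class_ring V by fact
  show ?case using lin_form_zero[OF V f] by simp
qed

lemma lin_form_eq_on_span:
  assumes V: "Module.module class_ring V" and S: "S \<subseteq> carrier V"
    and f: "lin_form \<iota> V f" and g: "lin_form \<iota> V g" and eq: "\<And>s. s \<in> S \<Longrightarrow> f s = g s"
    and x: "x \<in> lspan V S"
  shows "f x = g x"
  by (rule span_induct[OF V S x])
    (auto simp: lin_form_zero[OF V f] lin_form_zero[OF V g] eq lin_formD[OF f] lin_formD[OF g])

lemma lin_form_sum:
  assumes "\<And>i. i \<in> I \<Longrightarrow> lin_form \<iota> V (f i)"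
  shows "lin_form \<iota> V (\<lambda>x. \<Sum>i\<in>I. a i * f i x)"
  unfolding lin_form_def
  by (simp add: lin_formD[OF assms] distrib_left sum.distrib sum_distrib_left mult.left_commute)

lemma lin_form_sub: "lin_form \<iota> V f \<Longrightarrow> W \<subseteq> carrier V \<Longrightarrow> lin_form \<iota> (V\<lparr>carrier := W\<rparr>) f"
  by (auto simp: lin_form_def subset_iff)

text \<open>The form induced on the quotient, read off from an arbitrary representative; it is
  meaningful when \<open>F\<close> is additive and vanishes on the subspace.\<close>

definition coset_form :: "('v \<Rightarrow> 'l) \<Rightarrow> 'v set \<Rightarrow> 'l" where
  "coset_form F X = F (SOME x. x \<in> X)"

context quot_space
begin

lemma coset_form_coset:
  assumes F: "lin_form \<iota> V F" "\<And>n. n \<in> N \<Longrightarrow> F n = 0" and x: "x \<in> carrier V"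
  shows "coset_form F (N +>\<^bsub>V\<^esub> x) = F x"
proof -
  have "(SOME y. y \<in> N +>\<^bsub>V\<^esub> x) \<in> N +>\<^bsub>V\<^esub> x" using coset_mem[OF x] by (rule someI)
  then obtain n where n: "n \<in> N" "(SOME y. y \<in> N +>\<^bsub>V\<^esub> x) = n \<oplus>\<^bsub>V\<^esub> x" using coset_memD by blast
  moreover have "n \<in> carrier V" using n(1) submoduleD(1)[OF N] by blast
  ultimately show ?thesis unfolding coset_form_def using lin_formD(1)[OF F(1) _ x] F(2) by simp
qed

lemma coset_form_lin:
  assumes F: "lin_form \<iota> V F" "\<And>n. n \<in> N \<Longrightarrow> F n = 0"
  shows "lin_form \<iota> (quot_rep V N) (coset_form F)"
proof -
  interpret V: Module.module class_ring V by (rule V)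
  show ?thesis unfolding lin_form_def
  proof (intro conjI ballI allI)
    fix X Y assume "X \<in> carrier (quot_rep V N)" "Y \<in> carrier (quot_rep V N)"
    then show "coset_form F (X \<oplus>\<^bsub>quot_rep V N\<^esub> Y) = coset_form F X + coset_form F Y"
      by (elim quot_cases)
        (simp add: quot_add coset_form_coset[OF F] lin_formD[OF F(1)])
  next
    fix c X assume "X \<in> carrier (quot_rep V N)"
    then show "coset_form F (c \<odot>\<^bsub>quot_rep V N\<^esub> X) = \<iota> c * coset_form F X"
      by (elim quot_cases)
        (simp add: quot_smult coset_form_coset[OF F] lin_formD[OF F(1)] class_moduleD(1)[OF V])
  qed
qed

lemma quot_span:
  assumes S: "S \<subseteq> carrier V" and V_span: "lspan V S = carrier V"
  shows "lspan (quot_rep V N) ((\<lambda>x. N +>\<^bsub>V\<^esub> x) ` S) = carrier (quot_rep V N)"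
proof -
  interpret V: Module.module class_ring V by (rule V)
  interpret Q: Module.module class_ring "quot_rep V N" by (rule quot_module)
  have S': "(\<lambda>x. N +>\<^bsub>V\<^esub> x) ` S \<subseteq> carrier (quot_rep V N)" using S quot_carrier by auto
  note sub = submoduleD[OF span_submodule[OF quot_module S']]
  have "N +>\<^bsub>V\<^esub> x \<in> lspan (quot_rep V N) ((\<lambda>x. N +>\<^bsub>V\<^esub> x) ` S)" if x: "x \<in> carrier V" for x
    by (rule span_induct[OF V S])
      (use x V_span sub span_mem[OF quot_module S'] in
        \<open>auto simp: quot_add[symmetric] quot_smult[symmetric] quot_zero[symmetric]\<close>)
  then show ?thesis using sub(1) by (auto elim: quot_cases)
qed

end

lemma free_rep_simps [simp]:
  "carrier (free_rep X \<alpha>) = {f. Poly_Mapping.keys f \<subseteq> X}"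
  "zero (free_rep X \<alpha>) = 0" "add (free_rep X \<alpha>) = (+)"
  "module.smult (free_rep X \<alpha>) = (\<lambda>c. Poly_Mapping.map (\<lambda>a. c * a))"
  "act (free_rep X \<alpha>) g = pushforward (\<alpha> g)"
  by (auto simp: free_rep_def)

lemma free_rep_module: "Module.module class_ring (free_rep X \<alpha> :: ('k::field, 'x \<Rightarrow>\<^sub>0 'k, 'g) rep)"
proof (rule moduleI)
  show "cring (class_ring :: 'k ring)" by (rule class_cring.cring_axioms)
  show "abelian_group (free_rep X \<alpha> :: ('k, 'x \<Rightarrow>\<^sub>0 'k, 'g) rep)"
  proof (rule abelian_groupI)
    fix f :: "'x \<Rightarrow>\<^sub>0 'k" assume "f \<in> carrier (free_rep X \<alpha>)"
    then show "\<exists>g\<in>carrier (free_rep X \<alpha> :: ('k, 'x \<Rightarrow>\<^sub>0 'k, 'g) rep). g \<oplus>\<^bsub>free_rep X \<alpha> :: ('k, 'x \<Rightarrow>\<^sub>0 'k, 'g) rep\<^esub> f = \<zero>\<^bsub>free_rep X \<alpha> :: ('k, 'x \<Rightarrow>\<^sub>0 'k, 'g) rep\<^esub>"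
      by (intro bexI[of _ "- f"]) (auto simp: in_keys_iff)
  next
    fix f g :: "'x \<Rightarrow>\<^sub>0 'k"
    assume "f \<in> carrier (free_rep X \<alpha>)" "g \<in> carrier (free_rep X \<alpha>)"
    then show "f \<oplus>\<^bsub>free_rep X \<alpha> :: ('k, 'x \<Rightarrow>\<^sub>0 'k, 'g) rep\<^esub> g \<in> carrier (free_rep X \<alpha>)"
      using Poly_Mapping.keys_add[of f g] by auto
  qed (simp_all add: add_ac)
next
  fix c :: 'k and f :: "'x \<Rightarrow>\<^sub>0 'k"
  assume "f \<in> carrier (free_rep X \<alpha>)"
  then show "c \<odot>\<^bsub>free_rep X \<alpha> :: ('k, 'x \<Rightarrow>\<^sub>0 'k, 'g) rep\<^esub> f \<in> carrier (free_rep X \<alpha>)"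
    using keys_scale[of c f] by auto
next
  fix f :: "'x \<Rightarrow>\<^sub>0 'k"
  have "Poly_Mapping.map ((*) 1) f = f" by (rule poly_mapping_eqI) (simp only: lookup_scale mult_1)
  then show "\<one>\<^bsub>class_ring :: 'k ring\<^esub> \<odot>\<^bsub>free_rep X \<alpha> :: ('k, 'x \<Rightarrow>\<^sub>0 'k, 'g) rep\<^esub> f = f" by (simp only: free_rep_simps monoid.select_convs)
qed (simp_all only: free_rep_simps scale_add_left scale_add_right scale_mult partial_object.select_convs monoid.select_convs ring.select_convs)

lemma free_rep_representation:
  assumes G: "group G"
    and "\<And>g x. g \<in> carrier G \<Longrightarrow> x \<in> X \<Longrightarrow> \<alpha> g x \<in> X"
    and "\<And>x. x \<in> X \<Longrightarrow> \<alpha> \<one>\<^bsub>G\<^esub> x = x"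
    and "\<And>g h x. g \<in> carrier G \<Longrightarrow> h \<in> carrier G \<Longrightarrow> x \<in> X \<Longrightarrow> \<alpha> (g \<otimes>\<^bsub>G\<^esub> h) x = \<alpha> g (\<alpha> h x)"
  shows "representation G (free_rep X \<alpha> :: ('k::field, 'x \<Rightarrow>\<^sub>0 'k, 'g) rep)"
proof (rule representationI[OF G free_rep_module], goal_cases)
  case (1 g f)
  then show ?case using keys_pushforward[of "\<alpha> g" f] assms(2) by fastforce
next
  case (4 f)
  then show ?case using pushforward_cong[of f "\<alpha> \<one>\<^bsub>G\<^esub>" "\<lambda>x. x"] assms(3) by (auto simp: pushforward_ident)
next
  case (5 g h f)
  then show ?case using assms(4) by (auto simp: pushforward_comp intro!: pushforward_cong)
qed (auto simp: pushforward_add pushforward_scale)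

section \<open>Tensor products and symmetric powers\<close>

lemma in_listset: "xs \<in> listset As \<longleftrightarrow> length xs = length As \<and> (\<forall>i<length As. xs ! i \<in> As ! i)"
proof (induction As arbitrary: xs)
  case (Cons A As)
  show ?case
    by (cases xs) (auto simp: set_Cons_def Cons.IH nth_Cons less_Suc_eq_0_disj split: nat.split)
qed simp

lemma in_tensor_list:
  "xs \<in> listset (map carrier Vs) \<longleftrightarrow> length xs = length Vs \<and> (\<forall>i<length Vs. xs ! i \<in> carrier (Vs ! i))"
  by (auto simp: in_listset)

lemma in_tensor_list_update:
  assumes "xs \<in> listset (map carrier Vs)" "i < length Vs" "x \<in> carrier (Vs ! i)"
  shows "xs[i := x] \<in> listset (map carrier Vs)"
  using assms by (auto simp: in_tensor_list nth_list_update)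

lemma map2_update:
  assumes "length xs = length Vs" "i < length Vs"
  shows "map2 f Vs (xs[i := x]) = (map2 f Vs xs)[i := f (Vs ! i) x]"
  using assms by (intro nth_equalityI) (auto simp: nth_list_update)

lemma tensor_free_module: "Module.module class_ring (tensor_free Vs)"
  unfolding tensor_free_def by (rule free_rep_module)

lemma tensor_free_simps:
  "carrier (tensor_free Vs) = {f. Poly_Mapping.keys f \<subseteq> listset (map carrier Vs)}"
  "zero (tensor_free Vs) = 0" "add (tensor_free Vs) = (+)"
  "module.smult (tensor_free Vs) = (\<lambda>c. Poly_Mapping.map (\<lambda>a. c * a))"
  "act (tensor_free Vs) g = pushforward (map2 (\<lambda>V x. act V g x) Vs)"
  by (auto simp: tensor_free_def)

lemma single_in_tensor_free:
  "xs \<in> listset (map carrier Vs) \<Longrightarrow> Poly_Mapping.single xs a \<in> carrier (tensor_free Vs)"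
  by (auto simp: tensor_free_simps)

lemma minus_in_tensor_free:
  assumes "f \<in> carrier (tensor_free Vs)" "g \<in> carrier (tensor_free Vs)"
  shows "f - g \<in> carrier (tensor_free Vs)"
  using assms keys_diff[of f g] by (auto simp: tensor_free_simps)

lemma tensor_relations_carrier:
  assumes "\<And>V. V \<in> set Vs \<Longrightarrow> Module.module class_ring V"
  shows "tensor_relations Vs \<subseteq> carrier (tensor_free Vs)"
proof -
  have "x \<oplus>\<^bsub>Vs ! i\<^esub> y \<in> carrier (Vs ! i)" "c \<odot>\<^bsub>Vs ! i\<^esub> x \<in> carrier (Vs ! i)"
    if "i < length Vs" "x \<in> carrier (Vs ! i)" "y \<in> carrier (Vs ! i)" for i x y c
  proof -
    have V: "Module.module class_ring (Vs ! i)" using assms that(1) by simp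
    interpret V: Module.module class_ring "Vs ! i" by (rule V)
    show "x \<oplus>\<^bsub>Vs ! i\<^esub> y \<in> carrier (Vs ! i)" "c \<odot>\<^bsub>Vs ! i\<^esub> x \<in> carrier (Vs ! i)"
      using that class_moduleD(1)[OF V] by auto
  qed
  then show ?thesis unfolding tensor_relations_def
    by (auto intro!: minus_in_tensor_free single_in_tensor_free in_tensor_list_update)
qed

locale tensor_space =
  fixes Vs :: "('k::field, 'v, 'g) rep list"
  assumes modules: "\<And>V. V \<in> set Vs \<Longrightarrow> Module.module class_ring V"
begin

lemma relations_carrier: "tensor_relations Vs \<subseteq> carrier (tensor_free Vs)"
  by (rule tensor_relations_carrier[OF modules])

sublocale quot_space "tensor_free Vs" "tensor_kernel Vs"
  unfolding tensor_kernel_def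
  by (rule quot_space.intro[OF tensor_free_module span_submodule[OF tensor_free_module relations_carrier]])

lemma tensor_module: "Module.module class_ring (tensor Vs)"
  unfolding tensor_def by (rule quot_module)

lemma nth_module: "i < length Vs \<Longrightarrow> Module.module class_ring (Vs ! i)"
  using modules by simp

lemma pure_tensor_carrier: "xs \<in> listset (map carrier Vs) \<Longrightarrow> pure_tensor Vs xs \<in> carrier (tensor Vs)"
  unfolding pure_tensor_def tensor_def by (intro quot_carrier single_in_tensor_free)

lemma pure_tensor_add:
  assumes xs: "xs \<in> listset (map carrier Vs)" and i: "i < length Vs"
    and x: "x \<in> carrier (Vs ! i)" and y: "y \<in> carrier (Vs ! i)"
  shows "pure_tensor Vs (xs[i := x \<oplus>\<^bsub>Vs ! i\<^esub> y]) =
    pure_tensor Vs (xs[i := x]) \<oplus>\<^bsub>tensor Vs\<^esub> pure_tensor Vs (xs[i := y])"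
proof -
  interpret V: Module.module class_ring "Vs ! i" by (rule nth_module[OF i])
  let ?s = "\<lambda>x. Poly_Mapping.single (xs[i := x]) (1::'k)"
  have c: "?s x \<in> carrier (tensor_free Vs)" "?s y \<in> carrier (tensor_free Vs)"
    "?s (x \<oplus>\<^bsub>Vs ! i\<^esub> y) \<in> carrier (tensor_free Vs)"
    using assms by (auto intro!: single_in_tensor_free in_tensor_list_update)
  have "?s (x \<oplus>\<^bsub>Vs ! i\<^esub> y) - ?s x - ?s y \<in> tensor_kernel Vs"
    unfolding tensor_kernel_def
    by (rule span_mem[OF tensor_free_module relations_carrier])
      (use assms in \<open>auto simp: tensor_relations_def\<close>)
  moreover have "?s x + ?s y \<in> carrier (tensor_free Vs)"
    using c by (metis tensor_free_simps(3) abelian_monoid.a_closed abelian_group.axioms(1)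
        tensor_free_module Module.module.axioms(2))
  ultimately show ?thesis
    unfolding pure_tensor_def tensor_def quot_add[OF c(1,2)]
    by (intro coset_eq) (use c in \<open>auto simp: tensor_free_simps(3)\<close>)
qed

lemma pure_tensor_smult:
  assumes xs: "xs \<in> listset (map carrier Vs)" and i: "i < length Vs" and x: "x \<in> carrier (Vs ! i)"
  shows "pure_tensor Vs (xs[i := c \<odot>\<^bsub>Vs ! i\<^esub> x]) = c \<odot>\<^bsub>tensor Vs\<^esub> pure_tensor Vs (xs[i := x])"
proof -
  note m = nth_module[OF i]
  let ?s = "\<lambda>x. Poly_Mapping.single (xs[i := x]) (1::'k)"
  have c: "?s x \<in> carrier (tensor_free Vs)" "?s (c \<odot>\<^bsub>Vs ! i\<^esub> x) \<in> carrier (tensor_free Vs)"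
    "Poly_Mapping.single (xs[i := x]) c \<in> carrier (tensor_free Vs)"
    using assms class_moduleD(1)[OF m] by (auto intro!: single_in_tensor_free in_tensor_list_update)
  have "?s (c \<odot>\<^bsub>Vs ! i\<^esub> x) - Poly_Mapping.single (xs[i := x]) c \<in> tensor_kernel Vs"
    unfolding tensor_kernel_def
    by (rule span_mem[OF tensor_free_module relations_carrier])
      (use assms in \<open>auto simp: tensor_relations_def\<close>)
  then show ?thesis
    unfolding pure_tensor_def tensor_def quot_smult[OF c(1)]
    by (intro coset_eq) (use c in \<open>auto simp: tensor_free_simps(3,4) scale_single\<close>)
qed

lemma tensor_free_span:
  "lspan (tensor_free Vs) ((\<lambda>xs. Poly_Mapping.single xs 1) ` listset (map carrier Vs)) = carrier (tensor_free Vs)"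
    (is "lspan _ ?S = _")
proof
  have S: "?S \<subseteq> carrier (tensor_free Vs)" using single_in_tensor_free by auto
  note sub = submoduleD[OF span_submodule[OF tensor_free_module S]]
  show "lspan (tensor_free Vs) ?S \<subseteq> carrier (tensor_free Vs)" by (rule sub)
  show "carrier (tensor_free Vs) \<subseteq> lspan (tensor_free Vs) ?S"
  proof
    fix f assume f: "f \<in> carrier (tensor_free Vs)"
    have "(\<Sum>x\<in>A. Poly_Mapping.single x (Poly_Mapping.lookup f x)) \<in> lspan (tensor_free Vs) ?S"
      if "finite A" "A \<subseteq> Poly_Mapping.keys f" for A
      using that
    proof (induction A)
      case empty then show ?case using sub(2) by (simp add: tensor_free_simps)
    next
      case (insert x A)
      have "Poly_Mapping.single x 1 \<in> ?S" using insert f by (auto simp: tensor_free_simps)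
      then have "Poly_Mapping.single x (Poly_Mapping.lookup f x) \<in> lspan (tensor_free Vs) ?S"
        using sub(4)[OF span_mem[OF tensor_free_module S], of "Poly_Mapping.single x 1" "Poly_Mapping.lookup f x"]
        by (simp add: tensor_free_simps scale_single)
      then show ?case using insert sub(3) by (simp add: tensor_free_simps)
    qed
    from this[of "Poly_Mapping.keys f"] show "f \<in> lspan (tensor_free Vs) ?S"
      using poly_mapping_single_sum[of f] by simp
  qed
qed

lemma tensor_span:
  "lspan (tensor Vs) (pure_tensor Vs ` listset (map carrier Vs)) = carrier (tensor Vs)"
proof -
  have "(\<lambda>xs. Poly_Mapping.single xs 1) ` listset (map carrier Vs) \<subseteq> carrier (tensor_free Vs)"
    using single_in_tensor_free by auto
  from quot_span[OF this tensor_free_span] show ?thesis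
    by (simp add: image_image pure_tensor_def[abs_def] tensor_def)
qed

text \<open>The kernel is spanned by the relations and \<open>pushforward h\<close> is linear, so
  only relations need to be followed. The group action and the place permutations both descend to
  tensor products in this way.\<close>

lemma pushforward_kernel:
  assumes f: "f \<in> tensor_kernel Vs"
    and h: "\<And>r. r \<in> tensor_relations Vs \<Longrightarrow> pushforward h r \<in> tensor_kernel Ws"
    and W: "tensor_space Ws"
  shows "pushforward h f \<in> tensor_kernel Ws"
proof -
  interpret W: tensor_space Ws by (rule W)
  note sub = submoduleD[OF W.N]
  show ?thesis
    by (rule span_induct[OF tensor_free_module relations_carrier f[unfolded tensor_kernel_def]])
      (use sub in \<open>auto simp: tensor_free_simps pushforward_add pushforward_scale h pushforward_def[of _ 0]\<close>)
qed

end

text \<open>A linear action in each slot turns a multilinearity relation into another one, so the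
  kernel is stable and the free representation passes to the quotient.\<close>

lemma tensor_representation:
  fixes Vs :: "('k::field, 'v, 'g) rep list"
  assumes G: "group G" and Vs: "\<And>V. V \<in> set Vs \<Longrightarrow> representation G V"
  shows "representation G (tensor Vs)"
    and "\<And>g xs. g \<in> carrier G \<Longrightarrow> xs \<in> listset (map carrier Vs) \<Longrightarrow>
      act (tensor Vs) g (pure_tensor Vs xs) = pure_tensor Vs (map2 (\<lambda>V x. act V g x) Vs xs)"
    and "\<And>g f. g \<in> carrier G \<Longrightarrow> f \<in> tensor_kernel Vs \<Longrightarrow> act (tensor_free Vs) g f \<in> tensor_kernel Vs"
    and "representation G (tensor_free Vs)"
proof -
  interpret tensor_space Vs by (rule tensor_space.intro) (rule representationD(2)[OF Vs])
  let ?\<alpha> = "\<lambda>g. map2 (\<lambda>V x. act V g x) Vs"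
  have r': "i < length Vs \<Longrightarrow> representation G (Vs ! i)" for i using Vs by simp
  note r = representationD[OF r']
  have closed: "?\<alpha> g xs \<in> listset (map carrier Vs)"
    if "g \<in> carrier G" "xs \<in> listset (map carrier Vs)" for g xs
    using that r(4) by (auto simp: in_tensor_list)
  show free: "representation G (tensor_free Vs)"
    unfolding tensor_free_def
    by (rule free_rep_representation[OF G closed])
      (auto simp: in_tensor_list r intro!: nth_equalityI)
  show kernel: "act (tensor_free Vs) g f \<in> tensor_kernel Vs" if g: "g \<in> carrier G" and f: "f \<in> tensor_kernel Vs" for g f
    unfolding tensor_free_simps
  proof (rule pushforward_kernel[OF f])
    show "tensor_space Vs" by unfold_locales
    fix k assume "k \<in> tensor_relations Vs"
    then have "pushforward (?\<alpha> g) k \<in> tensor_relations Vs"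
      unfolding tensor_relations_def
    proof (elim UnE CollectE exE conjE, goal_cases)
      case (1 xs i x y)
      then show ?case using r(4,5)[OF _ g] closed[OF g]
        by (intro UnI1 CollectI exI[of _ "?\<alpha> g xs"] exI[of _ i] exI[of _ "act (Vs ! i) g x"]
            exI[of _ "act (Vs ! i) g y"])
          (auto simp: pushforward_diff map2_update in_tensor_list)
    next
      case (2 xs i c x)
      then show ?case using r(4,6)[OF _ g] closed[OF g]
        by (intro UnI2 CollectI exI[of _ "?\<alpha> g xs"] exI[of _ i] exI[of _ c] exI[of _ "act (Vs ! i) g x"])
          (auto simp: pushforward_diff map2_update in_tensor_list)
    qed
    then show "pushforward (?\<alpha> g) k \<in> tensor_kernel Vs"
      unfolding tensor_kernel_def
      by (rule span_mem[OF tensor_free_module relations_carrier])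
  qed
  show "representation G (tensor Vs)"
    unfolding tensor_def by (rule quot_representation[OF free kernel])
  show "act (tensor Vs) g (pure_tensor Vs xs) = pure_tensor Vs (?\<alpha> g xs)"
    if g: "g \<in> carrier G" and xs: "xs \<in> listset (map carrier Vs)" for g xs
    unfolding tensor_def pure_tensor_def
    using quot_act[OF single_in_tensor_free[OF xs, of 1] representationD(4)[OF free g] kernel[OF g] representationD(5)[OF free g]]
    by (simp add: tensor_free_simps)
qed

section \<open>Multilinear forms and multilinear spanning\<close>

definition multi_form :: "('k::field \<Rightarrow> 'l::comm_ring_1) \<Rightarrow> ('k, 'v, 'g) rep list \<Rightarrow> ('v list \<Rightarrow> 'l) \<Rightarrow> bool" where
  "multi_form \<iota> Vs h \<longleftrightarrow>
    (\<forall>xs\<in>listset (map carrier Vs). \<forall>i<length Vs. lin_form \<iota> (Vs ! i) (\<lambda>x. h (xs[i := x])))"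

lemma multi_form_prod:
  assumes "\<And>i. i < length Vs \<Longrightarrow> lin_form \<iota> (Vs ! i) (f i)"
  shows "multi_form \<iota> Vs (\<lambda>xs. \<Prod>i<length Vs. f i (xs ! i))"
proof -
  have *: "(\<Prod>j<length Vs. f j (xs[i := x] ! j)) = f i x * (\<Prod>j\<in>{..<length Vs} - {i}. f j (xs ! j))"
    if "length xs = length Vs" "i < length Vs" for xs i x
    using that by (subst prod.remove[of _ i]) (auto intro!: prod.cong)
  show ?thesis unfolding multi_form_def
    using assms by (auto simp: in_tensor_list * lin_form_def distrib_right mult.assoc)
qed

definition tensor_form :: "('k::field \<Rightarrow> 'l::comm_ring_1) \<Rightarrow> ('v list \<Rightarrow> 'l) \<Rightarrow> ('v list \<Rightarrow>\<^sub>0 'k) set \<Rightarrow> 'l" where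
  "tensor_form \<iota> h = coset_form (ext_form \<iota> h)"

text \<open>The universal property of the tensor product for ring-valued forms: the linear extension
  of a multilinear \<open>h\<close> kills both kinds of relations, hence the kernel, and descends to
  cosets.\<close>

lemma (in tensor_space)
  fixes \<iota> :: "'k \<Rightarrow> 'l::comm_ring_1"
  assumes \<iota>: "comm_ring_hom \<iota>" and h: "multi_form \<iota> Vs h"
  shows tensor_form_lin: "lin_form \<iota> (tensor Vs) (tensor_form \<iota> h)"
    and tensor_form_pure: "\<And>xs. xs \<in> listset (map carrier Vs) \<Longrightarrow> tensor_form \<iota> h (pure_tensor Vs xs) = h xs"
proof -
  interpret \<iota>: comm_ring_hom \<iota> by (rule \<iota>)
  have lin: "lin_form \<iota> (tensor_free Vs) (ext_form \<iota> h)"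
    by (auto simp: lin_form_def tensor_free_simps ext_form_add[OF \<iota>] ext_form_scale[OF \<iota>])
  have zero: "ext_form \<iota> h f = 0" if f: "f \<in> tensor_kernel Vs" for f
  proof (rule span_induct[OF tensor_free_module relations_carrier f[unfolded tensor_kernel_def]])
    fix f assume "f \<in> tensor_relations Vs"
    then show "ext_form \<iota> h f = 0" unfolding tensor_relations_def
    proof (elim UnE CollectE exE conjE, goal_cases)
      case (1 xs i x y)
      with h have "lin_form \<iota> (Vs ! i) (\<lambda>x. h (xs[i := x]))" by (auto simp: multi_form_def)
      with 1 show ?case by (simp add: ext_form_diff[OF \<iota>] ext_form_single[OF \<iota>] lin_form_def)
    next
      case (2 xs i c x)
      with h have "lin_form \<iota> (Vs ! i) (\<lambda>x. h (xs[i := x]))" by (auto simp: multi_form_def)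
      with 2 show ?case by (simp add: ext_form_diff[OF \<iota>] ext_form_single[OF \<iota>] lin_form_def)
    qed
  qed (auto simp: tensor_free_simps ext_form_add[OF \<iota>] ext_form_scale[OF \<iota>] ext_form_def[of _ _ 0])
  show "lin_form \<iota> (tensor Vs) (tensor_form \<iota> h)"
    unfolding tensor_def tensor_form_def by (rule coset_form_lin[OF lin zero])
  show "tensor_form \<iota> h (pure_tensor Vs xs) = h xs" if "xs \<in> listset (map carrier Vs)" for xs
    unfolding tensor_form_def pure_tensor_def
    by (subst coset_form_coset[OF lin zero single_in_tensor_free[OF that]]) (auto simp: ext_form_single[OF \<iota>])
qed

text \<open>A multilinear map that sends tuples of generators into a subspace sends all tuples
  there. Slots are indexed by an arbitrary finite set, so that one lemma serves for the places of a
  tensor, the rows of a diagram and its boxes.\<close>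

lemma multilinear_span:
  fixes V :: "'i \<Rightarrow> ('k::field, 'v, 'm) module_scheme" and M :: "('k, 'w, 'n) module_scheme"
  assumes I: "finite I" and V: "\<And>i. i \<in> I \<Longrightarrow> Module.module class_ring (V i)"
    and Q: "LinearCombinations.submodule class_ring Q M"
    and S: "\<And>i. i \<in> I \<Longrightarrow> S i \<subseteq> carrier (V i)"
    and add: "\<And>u i x y. (\<And>j. j \<in> I \<Longrightarrow> u j \<in> carrier (V j)) \<Longrightarrow> i \<in> I \<Longrightarrow> x \<in> carrier (V i) \<Longrightarrow> y \<in> carrier (V i) \<Longrightarrow>
      T (u(i := x \<oplus>\<^bsub>V i\<^esub> y)) = T (u(i := x)) \<oplus>\<^bsub>M\<^esub> T (u(i := y))"
    and smult: "\<And>u i c x. (\<And>j. j \<in> I \<Longrightarrow> u j \<in> carrier (V j)) \<Longrightarrow> i \<in> I \<Longrightarrow> x \<in> carrier (V i) \<Longrightarrow>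
      T (u(i := c \<odot>\<^bsub>V i\<^esub> x)) = c \<odot>\<^bsub>M\<^esub> T (u(i := x))"
    and base: "\<And>u. (\<And>j. j \<in> I \<Longrightarrow> u j \<in> S j) \<Longrightarrow> T u \<in> Q"
    and zero: "\<And>u. (\<And>j. j \<in> I \<Longrightarrow> u j \<in> carrier (V j)) \<Longrightarrow> T u \<in> carrier M"
    and M: "Module.module class_ring M"
    and u: "\<And>j. j \<in> I \<Longrightarrow> u j \<in> lspan (V j) (S j)"
  shows "T u \<in> Q"
proof -
  \<comment> \<open>Slots in \<open>J\<close> hold arbitrary elements of the spans, the others still
    hold generators; the induction frees one slot at a time.\<close>
  have "T u \<in> Q" if "finite J" "J \<subseteq> I" "\<And>j. j \<in> J \<Longrightarrow> u j \<in> lspan (V j) (S j)" "\<And>j. j \<in> I - J \<Longrightarrow> u j \<in> S j" for J u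
    using that
  proof (induction J arbitrary: u)
    case empty
    then show ?case using base by auto
  next
    case (insert i J)
    have i: "i \<in> I" using insert by auto
    note sub = submoduleD[OF Q]
    have sp: "lspan (V j) (S j) \<subseteq> carrier (V j)" if "j \<in> I" for j
      using submoduleD(1)[OF span_submodule[OF V[OF that] S[OF that]]] .
    have uc: "u j \<in> carrier (V j)" if "j \<in> I" for j
      using that insert.prems sp[OF that] S[OF that] by (cases "j \<in> insert i J") blast+
    interpret Vi: Module.module class_ring "V i" by (rule V[OF i])
    have "T (u(i := x)) \<in> Q" if x: "x \<in> lspan (V i) (S i)" for x
    proof (rule span_induct[OF V[OF i] S[OF i] x])
      \<comment> \<open>A zero entry is written as 0 times itself, so homogeneity makes the value
        zero; this is where the values of \<open>T\<close> must be known to lie in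
        \<open>M\<close>.\<close>
      have "T (u(i := 0 \<odot>\<^bsub>V i\<^esub> \<zero>\<^bsub>V i\<^esub>)) = 0 \<odot>\<^bsub>M\<^esub> T (u(i := \<zero>\<^bsub>V i\<^esub>))"
        using smult[OF uc i Vi.zero_closed] .
      moreover have "T (u(i := \<zero>\<^bsub>V i\<^esub>)) \<in> carrier M" using zero[of "u(i := \<zero>\<^bsub>V i\<^esub>)"] uc by auto
      ultimately show "T (u(i := \<zero>\<^bsub>V i\<^esub>)) \<in> Q"
        using class_moduleD(7)[OF V[OF i]] class_moduleD(6)[OF M] sub(2) by simp
    next
      fix s assume "s \<in> S i"
      then show "T (u(i := s)) \<in> Q"
        using insert by (intro insert.IH) auto
    next
      fix x y assume xy: "x \<in> carrier (V i)" "y \<in> carrier (V i)" "T (u(i := x)) \<in> Q" "T (u(i := y)) \<in> Q"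
      show "T (u(i := x \<oplus>\<^bsub>V i\<^esub> y)) \<in> Q"
        by (subst add[OF uc i xy(1,2)]) (assumption | rule sub(3) xy)+
    next
      fix c x assume x: "x \<in> carrier (V i)" "T (u(i := x)) \<in> Q"
      show "T (u(i := c \<odot>\<^bsub>V i\<^esub> x)) \<in> Q"
        by (subst smult[OF uc i x(1)]) (assumption | rule sub(4) x)+
    qed
    from this[of "u i"] show ?case using insert by auto
  qed
  from this[of I u] show ?thesis using I u by auto
qed

text \<open>Place \<open>j\<close> of the permuted list holds entry \<open>p j\<close>, so entry
  \<open>i\<close> turns up at the place that \<open>p\<close> sends to \<open>i\<close>; hence the
  inverse.\<close>

lemma permute_list_update:
  assumes p: "p permutes {..<length xs}" and i: "i < length xs"
  shows "permute_list p (xs[i := x]) = (permute_list p xs)[inv_into UNIV p i := x]"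
proof (rule nth_equalityI)
  have ip: "inv_into UNIV p i < length xs"
    using permutes_in_image[OF permutes_inv[OF p], of i] i by simp
  fix j assume "j < length (permute_list p (xs[i := x]))"
  then have j: "j < length xs" by simp
  have "p j = i \<longleftrightarrow> j = inv_into UNIV p i" using permutes_inverses[OF p] by metis
  moreover have "p j < length xs" using permutes_in_image[OF p, of j] j by simp
  ultimately show "permute_list p (xs[i := x]) ! j = (permute_list p xs)[inv_into UNIV p i := x] ! j"
    using p j i by (auto simp: permute_list_nth nth_list_update)
qed simp

lemma in_listset_replicate: "xs \<in> listset (replicate r A) \<longleftrightarrow> length xs = r \<and> set xs \<subseteq> A"
  unfolding in_listset by (auto simp: set_conv_nth subset_iff)

definition sym_form :: "('k::field \<Rightarrow> 'l::comm_ring_1) \<Rightarrow> ('v list \<Rightarrow> 'l) \<Rightarrow> ('v list \<Rightarrow>\<^sub>0 'k) set set \<Rightarrow> 'l" where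
  "sym_form \<iota> h = coset_form (tensor_form \<iota> h)"

section \<open>Symmetric powers as coinvariants and as invariants\<close>

locale rep_space =
  fixes G :: "('g, 'c) monoid_scheme" and V :: "('k::field, 'v, 'g) rep"
  assumes rep: "representation G V"
begin

lemma rep_module: "Module.module class_ring V"
  by (rule representationD(2)[OF rep])

sublocale power: tensor_space "replicate r V" for r
  by (rule tensor_space.intro) (auto simp: rep_module)

lemma power_rep: "representation G (tensor_power r V)"
  by (rule tensor_representation(1)) (use rep representationD(1) in auto)

lemma act_pure:
  assumes "g \<in> carrier G" "length xs = r" "set xs \<subseteq> carrier V"
  shows "act (tensor_power r V) g (pure_tensor (replicate r V) xs) = pure_tensor (replicate r V) (map (act V g) xs)"
proof -
  have "map2 (\<lambda>V x. act V g x) (replicate r V) xs = map (act V g) xs"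
    using assms by (intro nth_equalityI) auto
  then show ?thesis
    using tensor_representation(2)[of G "replicate r V" g xs] assms rep representationD(1)[OF rep]
    by (auto simp: in_listset_replicate)
qed

context
  fixes r :: nat and \<sigma> :: "nat \<Rightarrow> nat"
  assumes \<sigma>: "\<sigma> permutes {..<r}"
begin

lemma permute_tensor_list:
  "xs \<in> listset (map carrier (replicate r V)) \<Longrightarrow> permute_list \<sigma> xs \<in> listset (map carrier (replicate r V))"
  using \<sigma> by (auto simp: in_listset_replicate)

lemma pushforward_permute_carrier:
  "f \<in> carrier (tensor_free (replicate r V)) \<Longrightarrow>
    pushforward (permute_list \<sigma>) f \<in> carrier (tensor_free (replicate r V))"
  using keys_pushforward[of "permute_list \<sigma>" f] permute_tensor_list
  by (fastforce simp: tensor_free_simps)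

lemma pushforward_permute_kernel:
  assumes "f \<in> tensor_kernel (replicate r V)"
  shows "pushforward (permute_list \<sigma>) f \<in> tensor_kernel (replicate r V)"
proof (rule power.pushforward_kernel[OF assms _ power.tensor_space_axioms])
  fix k :: "'v list \<Rightarrow>\<^sub>0 'k" assume k: "k \<in> tensor_relations (replicate r V)"
  have inv: "inv_into UNIV \<sigma> i < r" if "i < r" for i
    using permutes_in_image[OF permutes_inv[OF \<sigma>], of i] that by simp
  have "pushforward (permute_list \<sigma>) k \<in> tensor_relations (replicate r V)"
    using k unfolding tensor_relations_def
  proof (elim UnE CollectE exE conjE, goal_cases)
    case (1 xs i x y)
    then show ?case using permute_tensor_list[of xs] \<sigma> inv
      by (intro UnI1 CollectI exI[of _ "permute_list \<sigma> xs"] exI[of _ "inv_into UNIV \<sigma> i"] exI[of _ x] exI[of _ y])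
        (auto simp: pushforward_diff permute_list_update in_listset_replicate)
  next
    case (2 xs i c x)
    then show ?case using permute_tensor_list[of xs] \<sigma> inv
      by (intro UnI2 CollectI exI[of _ "permute_list \<sigma> xs"] exI[of _ "inv_into UNIV \<sigma> i"] exI[of _ c] exI[of _ x])
        (auto simp: pushforward_diff permute_list_update in_listset_replicate)
  qed
  then show "pushforward (permute_list \<sigma>) k \<in> tensor_kernel (replicate r V)"
    unfolding tensor_kernel_def by (rule span_mem[OF tensor_free_module power.relations_carrier])
qed

lemma place_perm_coset:
  assumes "f \<in> carrier (tensor_free (replicate r V))"
  shows "place_perm r V \<sigma> (tensor_kernel (replicate r V) +>\<^bsub>tensor_free (replicate r V)\<^esub> f)
    = tensor_kernel (replicate r V) +>\<^bsub>tensor_free (replicate r V)\<^esub> pushforward (permute_list \<sigma>) f"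
  unfolding place_perm_def
  by (rule power.quot_map_coset[OF assms])
    (use pushforward_permute_carrier pushforward_permute_kernel in \<open>auto simp: tensor_free_simps(3) pushforward_add\<close>)

lemma place_perm_closed: "w \<in> carrier (tensor_power r V) \<Longrightarrow> place_perm r V \<sigma> w \<in> carrier (tensor_power r V)"
  unfolding tensor_def
  by (elim power.quot_cases) (simp add: place_perm_coset power.quot_carrier pushforward_permute_carrier)

lemma place_perm_pure:
  assumes "length xs = r" "set xs \<subseteq> carrier V"
  shows "place_perm r V \<sigma> (pure_tensor (replicate r V) xs) = pure_tensor (replicate r V) (permute_list \<sigma> xs)"
  using assms unfolding pure_tensor_def
  by (subst place_perm_coset) (auto intro!: single_in_tensor_free simp: in_listset_replicate)

lemma place_perm_add:
  assumes "w \<in> carrier (tensor_power r V)" "z \<in> carrier (tensor_power r V)"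
  shows "place_perm r V \<sigma> (w \<oplus>\<^bsub>tensor_power r V\<^esub> z) =
    place_perm r V \<sigma> w \<oplus>\<^bsub>tensor_power r V\<^esub> place_perm r V \<sigma> z"
proof -
  have *: "f \<oplus>\<^bsub>tensor_free (replicate r V)\<^esub> g \<in> carrier (tensor_free (replicate r V))"
    if "f \<in> carrier (tensor_free (replicate r V))" "g \<in> carrier (tensor_free (replicate r V))" for f g
    using that by (metis abelian_monoid.a_closed abelian_group.axioms(1) tensor_free_module Module.module.axioms(2))
  show ?thesis using assms unfolding tensor_def
    by (elim power.quot_cases)
      (simp add: power.quot_add place_perm_coset pushforward_permute_carrier * ,
       simp add: tensor_free_simps(3) pushforward_add)
qed

lemma place_perm_smult:
  assumes "w \<in> carrier (tensor_power r V)"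
  shows "place_perm r V \<sigma> (c \<odot>\<^bsub>tensor_power r V\<^esub> w) = c \<odot>\<^bsub>tensor_power r V\<^esub> place_perm r V \<sigma> w"
  using assms unfolding tensor_def
  by (elim power.quot_cases)
    (simp add: power.quot_smult place_perm_coset pushforward_permute_carrier class_moduleD(1)[OF tensor_free_module],
     simp add: tensor_free_simps(4) pushforward_scale)

text \<open>On pure tensors, acting on each entry commutes with rearranging the entries, and pure
  tensors span. Stability of \<open>sym_kernel\<close> and of the invariants under the group both
  rest on this.\<close>

lemma place_perm_act:
  assumes g: "g \<in> carrier G" and w: "w \<in> carrier (tensor_power r V)"
  shows "place_perm r V \<sigma> (act (tensor_power r V) g w) = act (tensor_power r V) g (place_perm r V \<sigma> w)"
proof -
  note r = representationD[OF power_rep]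
  have pc: "pure_tensor (replicate r V) ` listset (map carrier (replicate r V)) \<subseteq> carrier (tensor_power r V)"
    using power.pure_tensor_carrier by auto
  interpret T: Module.module class_ring "tensor_power r V" by (rule power.tensor_module)
  have z: "place_perm r V \<sigma> \<zero>\<^bsub>tensor_power r V\<^esub> = \<zero>\<^bsub>tensor_power r V\<^esub>"
    using place_perm_smult[OF T.zero_closed, of 0] class_moduleD(6)[OF power.tensor_module] place_perm_closed[OF T.zero_closed]
    by simp
  have z': "act (tensor_power r V) g \<zero>\<^bsub>tensor_power r V\<^esub> = \<zero>\<^bsub>tensor_power r V\<^esub>"
    using r(6)[OF g T.zero_closed, of 0] class_moduleD(6)[OF power.tensor_module] r(4)[OF g T.zero_closed]
    by simp
  have w': "w \<in> lspan (tensor_power r V) (pure_tensor (replicate r V) ` listset (map carrier (replicate r V)))"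
    using w power.tensor_span by auto
  show ?thesis
  proof (rule span_induct[OF power.tensor_module pc w'])
    fix s assume "s \<in> pure_tensor (replicate r V) ` listset (map carrier (replicate r V))"
    then obtain xs where xs: "length xs = r" "set xs \<subseteq> carrier V" "s = pure_tensor (replicate r V) xs"
      by (auto simp: in_listset_replicate)
    have "set (map (act V g) xs) \<subseteq> carrier V" using xs representationD(4)[OF rep g] by auto
    moreover have "map (act V g) (permute_list \<sigma> xs) = permute_list \<sigma> (map (act V g) xs)"
      using \<sigma> xs by (simp add: permute_list_map)
    moreover have "set (permute_list \<sigma> xs) \<subseteq> carrier V" using \<sigma> xs by simp
    ultimately show "place_perm r V \<sigma> (act (tensor_power r V) g s) = act (tensor_power r V) g (place_perm r V \<sigma> s)"
      using xs g by (simp add: act_pure place_perm_pure)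
  qed (simp_all add: z z' place_perm_add place_perm_smult r g place_perm_closed)
qed

lemma tensor_form_place_perm:
  fixes \<iota> :: "'k \<Rightarrow> 'l::comm_ring_1"
  assumes \<iota>: "comm_ring_hom \<iota>" and h: "multi_form \<iota> (replicate r V) h"
    and sym: "\<And>xs. length xs = r \<Longrightarrow> set xs \<subseteq> carrier V \<Longrightarrow> h (permute_list \<sigma> xs) = h xs"
    and w: "w \<in> carrier (tensor_power r V)"
  shows "tensor_form \<iota> h (place_perm r V \<sigma> w) = tensor_form \<iota> h w"
proof -
  have pc: "pure_tensor (replicate r V) ` listset (map carrier (replicate r V)) \<subseteq> carrier (tensor_power r V)"
    using power.pure_tensor_carrier by auto
  note lin = power.tensor_form_lin[OF \<iota> h]
  have lin': "lin_form \<iota> (tensor_power r V) (\<lambda>w. tensor_form \<iota> h (place_perm r V \<sigma> w))"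
    by (simp add: lin_form_def place_perm_add place_perm_smult place_perm_closed lin_formD[OF lin])
  have w': "w \<in> lspan (tensor_power r V) (pure_tensor (replicate r V) ` listset (map carrier (replicate r V)))"
    using w power.tensor_span by auto
  show ?thesis
  proof (rule lin_form_eq_on_span[OF power.tensor_module pc lin' lin _ w'])
    fix s assume "s \<in> pure_tensor (replicate r V) ` listset (map carrier (replicate r V))"
    then obtain xs where xs: "length xs = r" "set xs \<subseteq> carrier V" "s = pure_tensor (replicate r V) xs"
      by (auto simp: in_listset_replicate)
    moreover have "set (permute_list \<sigma> xs) \<subseteq> carrier V" using \<sigma> xs by simp
    ultimately show "tensor_form \<iota> h (place_perm r V \<sigma> s) = tensor_form \<iota> h s"
      by (simp add: place_perm_pure power.tensor_form_pure[OF \<iota> h] in_listset_replicate sym)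
  qed
qed

end

lemma sym_generators_carrier:
  "{place_perm r V \<sigma> w \<ominus>\<^bsub>tensor_power r V\<^esub> w | \<sigma> w.
     \<sigma> permutes {..<r} \<and> w \<in> carrier (tensor_power r V)} \<subseteq> carrier (tensor_power r V)"
proof -
  interpret T: Module.module class_ring "tensor_power r V" by (rule power.tensor_module)
  show ?thesis using place_perm_closed by auto
qed

sublocale upper: quot_space "tensor_power r V" "sym_kernel r V" for r
  unfolding sym_kernel_def
  by (rule quot_space.intro[OF power.tensor_module span_submodule[OF power.tensor_module sym_generators_carrier]])

lemma upper_module: "Module.module class_ring (sym_upper r V)"
  unfolding sym_upper_def by (rule upper.quot_module)

lemma sym_kernel_act:
  assumes g: "g \<in> carrier G" and w: "w \<in> sym_kernel r V"
  shows "act (tensor_power r V) g w \<in> sym_kernel r V"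
  unfolding sym_kernel_def
proof (rule span_invariant[OF power_rep sym_generators_carrier g _ w[unfolded sym_kernel_def]])
  interpret T: Module.module class_ring "tensor_power r V" by (rule power.tensor_module)
  note r = representationD[OF power_rep]
  fix x assume "x \<in> {place_perm r V \<sigma> w \<ominus>\<^bsub>tensor_power r V\<^esub> w | \<sigma> w.
     \<sigma> permutes {..<r} \<and> w \<in> carrier (tensor_power r V)}"
  then obtain \<sigma> w where x: "x = place_perm r V \<sigma> w \<ominus>\<^bsub>tensor_power r V\<^esub> w" "\<sigma> permutes {..<r}"
    "w \<in> carrier (tensor_power r V)" by auto
  have "act (tensor_power r V) g x =
    place_perm r V \<sigma> (act (tensor_power r V) g w) \<ominus>\<^bsub>tensor_power r V\<^esub> act (tensor_power r V) g w"
    using x g by (simp add: a_minus_def class_moduleD(1,8)[OF power.tensor_module] r place_perm_act place_perm_closed)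
  moreover have "act (tensor_power r V) g w \<in> carrier (tensor_power r V)" using r(4) g x by simp
  ultimately show "act (tensor_power r V) g x \<in> lspan (tensor_power r V) {place_perm r V \<sigma> w \<ominus>\<^bsub>tensor_power r V\<^esub> w | \<sigma> w.
     \<sigma> permutes {..<r} \<and> w \<in> carrier (tensor_power r V)}"
    using x(2) by (intro span_mem[OF power.tensor_module sym_generators_carrier]) auto
qed

lemma upper_rep: "representation G (sym_upper r V)"
  unfolding sym_upper_def by (rule upper.quot_representation[OF power_rep sym_kernel_act])

lemma sym_prod_eq: "length xs = r \<Longrightarrow>
  sym_prod V xs = sym_kernel r V +>\<^bsub>tensor_power r V\<^esub> pure_tensor (replicate r V) xs"
  by (auto simp: sym_prod_def)

lemma pure_carrier: "length xs = r \<Longrightarrow> set xs \<subseteq> carrier V \<Longrightarrow> pure_tensor (replicate r V) xs \<in> carrier (tensor_power r V)"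
  by (rule power.pure_tensor_carrier) (simp add: in_listset_replicate)

lemma sym_prod_carrier: "length xs = r \<Longrightarrow> set xs \<subseteq> carrier V \<Longrightarrow> sym_prod V xs \<in> carrier (sym_upper r V)"
  by (simp add: sym_prod_eq sym_upper_def upper.quot_carrier pure_carrier)

lemma sym_prod_act:
  assumes g: "g \<in> carrier G" and xs: "length xs = r" "set xs \<subseteq> carrier V"
  shows "act (sym_upper r V) g (sym_prod V xs) = sym_prod V (map (act V g) xs)"
  unfolding sym_upper_def sym_prod_eq[OF xs(1)]
  using upper.quot_act[OF pure_carrier[OF xs] representationD(4)[OF power_rep g] sym_kernel_act[OF g]
      representationD(5)[OF power_rep g]] xs g
  by (simp add: sym_prod_eq act_pure)

lemma sym_prod_add:
  assumes xs: "length xs = r" "set xs \<subseteq> carrier V" "i < r" "x \<in> carrier V" "y \<in> carrier V"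
  shows "sym_prod V (xs[i := x \<oplus>\<^bsub>V\<^esub> y]) = sym_prod V (xs[i := x]) \<oplus>\<^bsub>sym_upper r V\<^esub> sym_prod V (xs[i := y])"
proof -
  have "set (xs[i := x]) \<subseteq> carrier V" "set (xs[i := y]) \<subseteq> carrier V"
    using set_update_subset_insert[of xs i] assms by fast+
  then show ?thesis
    using power.pure_tensor_add[of xs r i x y] assms
    by (simp add: sym_prod_eq sym_upper_def upper.quot_add pure_carrier in_listset_replicate)
qed

lemma sym_prod_smult:
  assumes xs: "length xs = r" "set xs \<subseteq> carrier V" "i < r" "x \<in> carrier V"
  shows "sym_prod V (xs[i := c \<odot>\<^bsub>V\<^esub> x]) = c \<odot>\<^bsub>sym_upper r V\<^esub> sym_prod V (xs[i := x])"
proof -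
  have "set (xs[i := x]) \<subseteq> carrier V"
    using set_update_subset_insert[of xs i] assms by fast
  then show ?thesis
    using power.pure_tensor_smult[of xs r i x c] assms
    by (simp add: sym_prod_eq sym_upper_def upper.quot_smult pure_carrier in_listset_replicate)
qed

text \<open>The two pure tensors differ by a place permutation, and such a difference is one of the
  generators of \<open>sym_kernel\<close>.\<close>

lemma sym_prod_mset:
  assumes "mset xs = mset ys" "set xs \<subseteq> carrier V"
  shows "sym_prod V xs = sym_prod V ys"
proof -
  obtain \<sigma> where s: "\<sigma> permutes {..<length ys}" "permute_list \<sigma> ys = xs"
    using mset_eq_permutation[OF assms(1)] by metis
  have ys: "set ys \<subseteq> carrier V" "length xs = length ys"
    using assms mset_eq_setD mset_eq_length by blast+
  let ?T = "tensor_power (length ys) V" and ?p = "pure_tensor (replicate (length ys) V)"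
  interpret T: Module.module class_ring ?T by (rule power.tensor_module)
  have c: "?p xs \<in> carrier ?T" "?p ys \<in> carrier ?T" using assms(2) ys pure_carrier[of _ "length ys"] by auto
  have "?p xs \<ominus>\<^bsub>?T\<^esub> ?p ys \<in> sym_kernel (length ys) V"
    unfolding sym_kernel_def
  proof (rule span_mem[OF power.tensor_module sym_generators_carrier], rule CollectI, intro exI conjI)
    show "?p xs \<ominus>\<^bsub>?T\<^esub> ?p ys = place_perm (length ys) V \<sigma> (?p ys) \<ominus>\<^bsub>?T\<^esub> ?p ys"
      unfolding place_perm_pure[OF s(1) refl ys(1)] s(2) by (rule refl)
  qed (rule s c)+
  moreover have "?p xs = (?p xs \<ominus>\<^bsub>?T\<^esub> ?p ys) \<oplus>\<^bsub>?T\<^esub> ?p ys"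
    using c by (simp add: a_minus_def T.a_assoc T.l_neg)
  ultimately show ?thesis
    unfolding sym_prod_eq[OF ys(2)] sym_prod_eq[OF refl, of ys] using c by (intro upper.coset_eq)
qed

lemma upper_span_carrier:
  "lspan (sym_upper r V) (sym_prod V ` {xs. length xs = r \<and> set xs \<subseteq> carrier V}) = carrier (sym_upper r V)"
proof -
  have c: "pure_tensor (replicate r V) ` listset (map carrier (replicate r V)) \<subseteq> carrier (tensor_power r V)"
    using power.pure_tensor_carrier by auto
  have "(\<lambda>x. sym_kernel r V +>\<^bsub>tensor_power r V\<^esub> x) ` pure_tensor (replicate r V) ` listset (map carrier (replicate r V))
    = sym_prod V ` {xs. length xs = r \<and> set xs \<subseteq> carrier V}"
    unfolding image_image by (rule image_cong) (auto simp: in_listset_replicate sym_prod_eq)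
  then show ?thesis using upper.quot_span[OF c power.tensor_span] by (simp add: sym_upper_def)
qed

text \<open>An instance of \<open>multilinear_span\<close> with one slot for each tensor place.
  Lists are recoded as functions on \<open>{..<r}\<close>, since that lemma speaks of function
  updates.\<close>

lemma power_span:
  assumes S: "S \<subseteq> carrier V" "lspan V S = carrier V"
  shows "lspan (tensor_power r V) (pure_tensor (replicate r V) ` {xs. length xs = r \<and> set xs \<subseteq> S}) = carrier (tensor_power r V)"
    (is "lspan ?T ?P = _")
proof -
  have P: "?P \<subseteq> carrier ?T" using S(1) by (auto intro!: pure_carrier)
  have mem: "map u [0..<r] \<in> listset (map carrier (replicate r V))" if "\<And>j. j \<in> {..<r} \<Longrightarrow> u j \<in> carrier V" for u
    using that by (auto simp: in_listset_replicate)
  have upd: "map (u(i := z)) [0..<r] = (map u [0..<r])[i := z]" for u :: "nat \<Rightarrow> 'v" and i z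
    by (rule nth_equalityI) (auto simp: nth_list_update)
  have P': "pure_tensor (replicate r V) ` listset (map carrier (replicate r V)) \<subseteq> lspan ?T ?P"
  proof clarify
    fix xs assume "xs \<in> listset (map carrier (replicate r V))"
    then have xs: "length xs = r" "set xs \<subseteq> carrier V" by (auto simp: in_listset_replicate)
    have "pure_tensor (replicate r V) (map (\<lambda>i. xs ! i) [0..<r]) \<in> lspan ?T ?P"
    proof (rule multilinear_span[where T = "\<lambda>u. pure_tensor (replicate r V) (map u [0..<r])" and I = "{..<r}" and V = "\<lambda>_. V" and S = "\<lambda>_. S" and M = ?T])
      show "pure_tensor (replicate r V) (map (u(i := x \<oplus>\<^bsub>V\<^esub> y)) [0..<r]) =
         pure_tensor (replicate r V) (map (u(i := x)) [0..<r]) \<oplus>\<^bsub>?T\<^esub> pure_tensor (replicate r V) (map (u(i := y)) [0..<r])"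
        if "\<And>j. j \<in> {..<r} \<Longrightarrow> u j \<in> carrier V" "i \<in> {..<r}" "x \<in> carrier V" "y \<in> carrier V" for u i x y
      proof -
        have "map u [0..<r] \<in> listset (map carrier (replicate r V))" by (rule mem) (rule that(1))
        then show ?thesis unfolding upd using power.pure_tensor_add[of "map u [0..<r]" r i x y] that(2-4) by simp
      qed
      show "pure_tensor (replicate r V) (map (u(i := c \<odot>\<^bsub>V\<^esub> x)) [0..<r]) = c \<odot>\<^bsub>?T\<^esub> pure_tensor (replicate r V) (map (u(i := x)) [0..<r])"
        if "\<And>j. j \<in> {..<r} \<Longrightarrow> u j \<in> carrier V" "i \<in> {..<r}" "x \<in> carrier V" for u i x c
      proof -
        have "map u [0..<r] \<in> listset (map carrier (replicate r V))" by (rule mem) (rule that(1))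
        then show ?thesis unfolding upd using power.pure_tensor_smult[of "map u [0..<r]" r i x c] that(2,3) by simp
      qed
      show "pure_tensor (replicate r V) (map u [0..<r]) \<in> lspan ?T ?P" if "\<And>j. j \<in> {..<r} \<Longrightarrow> u j \<in> S" for u
        using that by (intro span_mem[OF power.tensor_module P] imageI) auto
      show "pure_tensor (replicate r V) (map u [0..<r]) \<in> carrier ?T" if "\<And>j. j \<in> {..<r} \<Longrightarrow> u j \<in> carrier V" for u
        using that by (intro pure_carrier) auto
      show "xs ! j \<in> lspan V S" if "j \<in> {..<r}" for j
        using S(2) xs that by auto
    qed (auto simp: rep_module power.tensor_module S(1)[THEN subsetD] span_submodule[OF power.tensor_module P])
    moreover have "map (\<lambda>i. xs ! i) [0..<r] = xs" using xs(1) map_nth[of xs] by simp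
    ultimately show "pure_tensor (replicate r V) xs \<in> lspan ?T ?P" by simp
  qed
  have "carrier ?T \<subseteq> lspan ?T ?P"
    using span_least[OF power.tensor_module P' span_submodule[OF power.tensor_module P]] unfolding power.tensor_span .
  then show ?thesis using submoduleD(1)[OF span_submodule[OF power.tensor_module P]] by blast
qed

lemma upper_span:
  assumes S: "S \<subseteq> carrier V" "lspan V S = carrier V"
  shows "lspan (sym_upper r V) (sym_prod V ` {xs. length xs = r \<and> set xs \<subseteq> S}) = carrier (sym_upper r V)"
proof -
  have c: "pure_tensor (replicate r V) ` {xs. length xs = r \<and> set xs \<subseteq> S} \<subseteq> carrier (tensor_power r V)"
    using S(1) by (auto intro!: pure_carrier)
  have "(\<lambda>x. sym_kernel r V +>\<^bsub>tensor_power r V\<^esub> x) ` pure_tensor (replicate r V) ` {xs. length xs = r \<and> set xs \<subseteq> S}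
    = sym_prod V ` {xs. length xs = r \<and> set xs \<subseteq> S}"
    unfolding image_image by (rule image_cong) (auto simp: sym_prod_eq)
  then show ?thesis using upper.quot_span[OF c power_span[OF S]] by (simp add: sym_upper_def)
qed

text \<open>The universal property of the upper symmetric power: the form on tensors induced by a
  symmetric multilinear \<open>h\<close> does not change under place permutations, so it vanishes on
  every generator of \<open>sym_kernel\<close>.\<close>

lemma
  fixes \<iota> :: "'k \<Rightarrow> 'l::comm_ring_1"
  assumes \<iota>: "comm_ring_hom \<iota>" and h: "multi_form \<iota> (replicate r V) h"
    and sym: "\<And>\<sigma> xs. \<sigma> permutes {..<r} \<Longrightarrow> length xs = r \<Longrightarrow> set xs \<subseteq> carrier V \<Longrightarrow> h (permute_list \<sigma> xs) = h xs"
  shows sym_form_lin: "lin_form \<iota> (sym_upper r V) (sym_form \<iota> h)"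
    and sym_form_prod: "\<And>xs. length xs = r \<Longrightarrow> set xs \<subseteq> carrier V \<Longrightarrow> sym_form \<iota> h (sym_prod V xs) = h xs"
proof -
  interpret T: Module.module class_ring "tensor_power r V" by (rule power.tensor_module)
  note lin = power.tensor_form_lin[OF \<iota> h]
  have zero: "tensor_form \<iota> h w = 0" if w: "w \<in> sym_kernel r V" for w
  proof (rule span_induct[OF power.tensor_module sym_generators_carrier w[unfolded sym_kernel_def]])
    fix s assume "s \<in> {place_perm r V \<sigma> w \<ominus>\<^bsub>tensor_power r V\<^esub> w | \<sigma> w.
     \<sigma> permutes {..<r} \<and> w \<in> carrier (tensor_power r V)}"
    then show "tensor_form \<iota> h s = 0"
      using lin_form_minus[OF power.tensor_module lin place_perm_closed] tensor_form_place_perm[OF _ \<iota> h sym]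
      by auto
  qed (simp_all add: lin_formD[OF lin] lin_form_zero[OF power.tensor_module lin])
  show "lin_form \<iota> (sym_upper r V) (sym_form \<iota> h)"
    unfolding sym_upper_def sym_form_def by (rule upper.coset_form_lin[OF lin zero])
  show "sym_form \<iota> h (sym_prod V xs) = h xs" if "length xs = r" "set xs \<subseteq> carrier V" for xs
    unfolding sym_form_def sym_prod_eq[OF that(1)]
    by (subst upper.coset_form_coset[OF lin zero pure_carrier[OF that]])
      (simp_all add: power.tensor_form_pure[OF \<iota> h] in_listset_replicate that)
qed

lemma lower_submodule:
  "LinearCombinations.submodule class_ring {w \<in> carrier (tensor_power r V). \<forall>\<sigma>. \<sigma> permutes {..<r} \<longrightarrow> place_perm r V \<sigma> w = w} (tensor_power r V)"
proof (rule submoduleI[OF power.tensor_module])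
  interpret T: Module.module class_ring "tensor_power r V" by (rule power.tensor_module)
  have "place_perm r V \<sigma> \<zero>\<^bsub>tensor_power r V\<^esub> = \<zero>\<^bsub>tensor_power r V\<^esub>" if "\<sigma> permutes {..<r}" for \<sigma>
    using place_perm_smult[OF that T.zero_closed, of 0] class_moduleD(6)[OF power.tensor_module]
      place_perm_closed[OF that T.zero_closed] by simp
  then show "{w \<in> carrier (tensor_power r V). \<forall>\<sigma>. \<sigma> permutes {..<r} \<longrightarrow> place_perm r V \<sigma> w = w} \<noteq> {}"
    using T.zero_closed by blast
qed (auto simp: place_perm_smult place_perm_add class_moduleD(1)[OF power.tensor_module] abelian_monoid.a_closed
    abelian_group.axioms(1) Module.module.axioms(2)[OF power.tensor_module])

lemma lower_rep: "representation G (sym_lower r V)"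
  unfolding sym_lower_def
  by (rule representation_submodule[OF power_rep lower_submodule])
    (auto simp: place_perm_act representationD(4)[OF power_rep])

end

section \<open>Schur functors\<close>

text \<open>The analogue of \<open>row_tensor\<close> with arbitrary vectors in the boxes. With
  basis vectors alone, multilinearity in the boxes could not be expressed, and the group would not
  preserve the shape of the elements.\<close>

definition row_prod :: "nat list \<Rightarrow> ('k::field, 'v, 'g) rep \<Rightarrow> (nat \<times> nat \<Rightarrow> 'v) \<Rightarrow>
   (('v list \<Rightarrow>\<^sub>0 'k) set set list \<Rightarrow>\<^sub>0 'k) set" where
  "row_prod lam V u =
     pure_tensor (map (\<lambda>r. sym_upper r V) lam)
       (map (\<lambda>i. sym_prod V (map (\<lambda>j. u (i, j)) [0..<lam ! i])) [0..<length lam])"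

definition col_alt :: "nat list \<Rightarrow> ('k::field, 'v, 'g) rep \<Rightarrow> (nat \<times> nat \<Rightarrow> 'v) \<Rightarrow>
   (('v list \<Rightarrow>\<^sub>0 'k) set set list \<Rightarrow>\<^sub>0 'k) set" where
  "col_alt lam V u =
     (\<Oplus>\<^bsub>sym_multi lam V\<^esub> \<sigma>\<in>CPP lam.
        of_int (sign \<sigma>) \<odot>\<^bsub>sym_multi lam V\<^esub> row_prod lam V (\<lambda>b. u (inv_into UNIV \<sigma> b)))"

lemma polytabloid_eq: "polytabloid lam V v t = col_alt lam V (\<lambda>b. v (t b))"
  by (simp add: polytabloid_def col_alt_def row_tensor_def row_prod_def tableau_perm_def)

text \<open>If \<open>F i\<close> is the linear form given by row \<open>i\<close> of a matrix, this
  evaluates an element of the multi-symmetric power, seen as a polynomial, at that matrix. The bound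
  \<open>length xs\<close> lets the same expression serve for rows of every length.\<close>

definition eval_form ::
  "('k::field \<Rightarrow> 'l::comm_ring_1) \<Rightarrow> nat list \<Rightarrow> (nat \<Rightarrow> 'v \<Rightarrow> 'l) \<Rightarrow>
   (('v list \<Rightarrow>\<^sub>0 'k) set set list \<Rightarrow>\<^sub>0 'k) set \<Rightarrow> 'l" where
  "eval_form \<iota> lam F =
     tensor_form \<iota> (\<lambda>zs. \<Prod>i<length lam. sym_form \<iota> (\<lambda>xs. \<Prod>j<length xs. F i (xs ! j)) (zs ! i))"

lemma finite_diagram: "finite (diagram lam)"
proof -
  have "diagram lam = (SIGMA i:{..<length lam}. {..<lam ! i})" by (auto simp: diagram_def)
  then show ?thesis by simp
qed

lemma finite_CPP: "finite (CPP lam)"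
  unfolding CPP_def by (rule finite_subset[OF _ finite_permutations[OF finite_diagram[of lam]]]) auto

lemma CPP_inv: "\<sigma> \<in> CPP lam \<Longrightarrow> inv_into UNIV \<sigma> \<in> CPP lam"
  unfolding CPP_def using permutes_inv permutes_inverses permutes_in_image
  by (smt (verit, ccfv_SIG) mem_Collect_eq)

lemma CPP_permutes: "\<sigma> \<in> CPP lam \<Longrightarrow> \<sigma> permutes diagram lam"
  by (simp add: CPP_def)

lemma prod_diagram: "(\<Prod>i<length lam. \<Prod>j<lam ! i. f (i, j)) = prod f (diagram lam)"
proof -
  have "diagram lam = (SIGMA i:{..<length lam}. {..<lam ! i})" by (auto simp: diagram_def)
  then show ?thesis by (simp add: prod.Sigma)
qed

text \<open>Admissible updates stay inside the product of the carriers, so agreement there is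
  enough. This permits \<open>length xs\<close> to stand for the fixed number of factors.\<close>

lemma multi_form_cong:
  assumes "\<And>xs. xs \<in> listset (map carrier Vs) \<Longrightarrow> h xs = k xs"
    and Vs: "\<And>V. V \<in> set Vs \<Longrightarrow> Module.module class_ring V"
    and k: "multi_form \<iota> Vs k"
  shows "multi_form \<iota> Vs h"
  unfolding multi_form_def
proof (intro ballI allI impI)
  fix xs i assume xs: "xs \<in> listset (map carrier Vs)" and i: "i < length Vs"
  have V: "Module.module class_ring (Vs ! i)" using Vs i by simp
  interpret Vi: Module.module class_ring "Vs ! i" by (rule V)
  have *: "h (xs[i := x]) = k (xs[i := x])" if "x \<in> carrier (Vs ! i)" for x
    by (rule assms(1)[OF in_tensor_list_update[OF xs i that]])
  have "lin_form \<iota> (Vs ! i) (\<lambda>x. k (xs[i := x]))" using k xs i by (auto simp: multi_form_def)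
  then show "lin_form \<iota> (Vs ! i) (\<lambda>x. h (xs[i := x]))"
    by (simp add: lin_form_def * class_moduleD(1)[OF V])
qed

context rep_space
begin

lemma sym_form_power:
  fixes \<iota> :: "'k \<Rightarrow> 'l::comm_ring_1"
  assumes \<iota>: "comm_ring_hom \<iota>" and f: "lin_form \<iota> V f"
  shows "lin_form \<iota> (sym_upper r V) (sym_form \<iota> (\<lambda>xs. \<Prod>j<length xs. f (xs ! j)))"
    and "set xs \<subseteq> carrier V \<Longrightarrow> sym_form \<iota> (\<lambda>xs. \<Prod>j<length xs. f (xs ! j)) (sym_prod V xs) = (\<Prod>j<length xs. f (xs ! j))"
proof -
  have mf: "multi_form \<iota> (replicate r V) (\<lambda>xs. \<Prod>j<length xs. f (xs ! j))" for r
  proof (rule multi_form_cong)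
    show "multi_form \<iota> (replicate r V) (\<lambda>xs. \<Prod>j<length (replicate r V). f (xs ! j))"
      by (rule multi_form_prod) (use f in auto)
  qed (auto simp: in_listset_replicate rep_module)
  have sym: "(\<Prod>j<length (permute_list \<sigma> xs). f (permute_list \<sigma> xs ! j)) = (\<Prod>j<length xs. f (xs ! j))"
    if s: "\<sigma> permutes {..<r}" "length xs = r" "set xs \<subseteq> carrier V" for \<sigma> r and xs :: "'v list"
    using prod.permute[OF s(1), of "\<lambda>j. f (xs ! j)"] s by (simp add: permute_list_nth o_def)
  show "lin_form \<iota> (sym_upper r V) (sym_form \<iota> (\<lambda>xs. \<Prod>j<length xs. f (xs ! j)))"
    by (rule sym_form_lin[OF \<iota> mf sym])
  show "sym_form \<iota> (\<lambda>xs. \<Prod>j<length xs. f (xs ! j)) (sym_prod V xs) = (\<Prod>j<length xs. f (xs ! j))"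
    if "set xs \<subseteq> carrier V"
    by (rule sym_form_prod[OF \<iota> mf sym refl that])
qed

sublocale multi: tensor_space "map (\<lambda>r. sym_upper r V) lam" for lam
  by (rule tensor_space.intro) (auto simp: upper_module)

lemma multi_module: "Module.module class_ring (sym_multi lam V)"
  unfolding sym_multi_def by (rule multi.tensor_module)

lemma multi_rep: "representation G (sym_multi lam V)"
  unfolding sym_multi_def
  by (rule tensor_representation(1)) (use representationD(1)[OF rep] upper_rep in auto)

context
  fixes lam :: "nat list" and u :: "nat \<times> nat \<Rightarrow> 'v"
  assumes u: "\<And>b. b \<in> diagram lam \<Longrightarrow> u b \<in> carrier V"
begin

lemma row_entries: "i < length lam \<Longrightarrow> set (map (\<lambda>j. u (i, j)) [0..<lam ! i]) \<subseteq> carrier V"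
  using u by (auto simp: diagram_def)

lemma rows_carrier:
  "map (\<lambda>i. sym_prod V (map (\<lambda>j. u (i, j)) [0..<lam ! i])) [0..<length lam]
    \<in> listset (map carrier (map (\<lambda>r. sym_upper r V) lam))"
proof -
  have "sym_prod V (map (\<lambda>j. u (i, j)) [0..<lam ! i]) \<in> carrier (sym_upper (lam ! i) V)" if "i < length lam" for i
    by (rule sym_prod_carrier[OF _ row_entries[OF that]]) simp
  then show ?thesis unfolding in_tensor_list by auto
qed

lemma row_prod_carrier: "row_prod lam V u \<in> carrier (sym_multi lam V)"
  unfolding row_prod_def sym_multi_def by (rule multi.pure_tensor_carrier[OF rows_carrier])

lemma rows_update:
  assumes "(i, j) \<in> diagram lam"
  shows "map (\<lambda>i'. sym_prod V (map (\<lambda>j'. (u((i, j) := z)) (i', j')) [0..<lam ! i'])) [0..<length lam] =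
    (map (\<lambda>i. sym_prod V (map (\<lambda>j. u (i, j)) [0..<lam ! i])) [0..<length lam])
      [i := sym_prod V ((map (\<lambda>j. u (i, j)) [0..<lam ! i])[j := z])]"
proof -
  have *: "map (\<lambda>j'. (u((i, j) := z)) (i, j')) [0..<lam ! i] = (map (\<lambda>j. u (i, j)) [0..<lam ! i])[j := z]"
    by (rule nth_equalityI) (auto simp: nth_list_update)
  have "map (\<lambda>i'. sym_prod V (map (\<lambda>j'. (u((i, j) := z)) (i', j')) [0..<lam ! i'])) [0..<length lam] ! k =
    (map (\<lambda>i. sym_prod V (map (\<lambda>j. u (i, j)) [0..<lam ! i])) [0..<length lam])
      [i := sym_prod V ((map (\<lambda>j. u (i, j)) [0..<lam ! i])[j := z])] ! k" if "k < length lam" for k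
    using that * by (cases "k = i") (simp_all cong: if_cong)
  then show ?thesis by (intro nth_equalityI) simp_all
qed

lemma row_prod_add:
  assumes b: "b \<in> diagram lam" and x: "x \<in> carrier V" and y: "y \<in> carrier V"
  shows "row_prod lam V (u(b := x \<oplus>\<^bsub>V\<^esub> y)) =
    row_prod lam V (u(b := x)) \<oplus>\<^bsub>sym_multi lam V\<^esub> row_prod lam V (u(b := y))"
proof -
  obtain i j where ij: "b = (i, j)" "i < length lam" "j < lam ! i" using b by (auto simp: diagram_def)
  let ?r = "map (\<lambda>j. u (i, j)) [0..<lam ! i]"
  have "set (?r[j := x]) \<subseteq> carrier V" "set (?r[j := y]) \<subseteq> carrier V"
    using row_entries[OF ij(2)] set_update_subset_insert[of ?r j] x y by fast+
  then have c: "sym_prod V (?r[j := x]) \<in> carrier (sym_upper (lam ! i) V)"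
      "sym_prod V (?r[j := y]) \<in> carrier (sym_upper (lam ! i) V)"
    by (auto intro!: sym_prod_carrier)
  have s: "sym_prod V (?r[j := x \<oplus>\<^bsub>V\<^esub> y]) =
    sym_prod V (?r[j := x]) \<oplus>\<^bsub>sym_upper (lam ! i) V\<^esub> sym_prod V (?r[j := y])"
    by (rule sym_prod_add) (use row_entries[OF ij(2)] x y ij in auto)
  show ?thesis
    unfolding row_prod_def ij(1) rows_update[OF b[unfolded ij(1)]] s sym_multi_def
    using multi.pure_tensor_add[OF rows_carrier, of i "sym_prod V (?r[j := x])" "sym_prod V (?r[j := y])"] c ij
    by simp
qed

lemma row_prod_smult:
  assumes b: "b \<in> diagram lam" and x: "x \<in> carrier V"
  shows "row_prod lam V (u(b := c \<odot>\<^bsub>V\<^esub> x)) = c \<odot>\<^bsub>sym_multi lam V\<^esub> row_prod lam V (u(b := x))"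
proof -
  obtain i j where ij: "b = (i, j)" "i < length lam" "j < lam ! i" using b by (auto simp: diagram_def)
  let ?r = "map (\<lambda>j. u (i, j)) [0..<lam ! i]"
  have "set (?r[j := x]) \<subseteq> carrier V"
    using row_entries[OF ij(2)] set_update_subset_insert[of ?r j] x by fast
  then have c: "sym_prod V (?r[j := x]) \<in> carrier (sym_upper (lam ! i) V)"
    by (auto intro!: sym_prod_carrier)
  have s: "sym_prod V (?r[j := c \<odot>\<^bsub>V\<^esub> x]) = c \<odot>\<^bsub>sym_upper (lam ! i) V\<^esub> sym_prod V (?r[j := x])"
    by (rule sym_prod_smult) (use row_entries[OF ij(2)] x ij in auto)
  show ?thesis
    unfolding row_prod_def ij(1) rows_update[OF b[unfolded ij(1)]] s sym_multi_def
    using multi.pure_tensor_smult[OF rows_carrier, of i "sym_prod V (?r[j := x])"] c ij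
    by simp
qed

lemma row_prod_act:
  assumes g: "g \<in> carrier G"
  shows "act (sym_multi lam V) g (row_prod lam V u) = row_prod lam V (\<lambda>b. act V g (u b))"
proof -
  have 1: "act (tensor (map (\<lambda>r. sym_upper r V) lam)) g
      (pure_tensor (map (\<lambda>r. sym_upper r V) lam) (map (\<lambda>i. sym_prod V (map (\<lambda>j. u (i, j)) [0..<lam ! i])) [0..<length lam])) =
    pure_tensor (map (\<lambda>r. sym_upper r V) lam) (map2 (\<lambda>V x. act V g x) (map (\<lambda>r. sym_upper r V) lam)
      (map (\<lambda>i. sym_prod V (map (\<lambda>j. u (i, j)) [0..<lam ! i])) [0..<length lam]))"
    by (rule tensor_representation(2)[OF _ _ g rows_carrier]) (use representationD(1)[OF rep] upper_rep in auto)
  have 2: "map2 (\<lambda>V x. act V g x) (map (\<lambda>r. sym_upper r V) lam)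
      (map (\<lambda>i. sym_prod V (map (\<lambda>j. u (i, j)) [0..<lam ! i])) [0..<length lam])
    = map (\<lambda>i. sym_prod V (map (\<lambda>j. act V g (u (i, j))) [0..<lam ! i])) [0..<length lam]"
    using sym_prod_act[OF g _ row_entries] by (intro nth_equalityI) (auto simp: o_def)
  show ?thesis unfolding row_prod_def sym_multi_def 1 2 ..
qed

lemma eval_form_rows:
  fixes \<iota> :: "'k \<Rightarrow> 'l::comm_ring_1"
  assumes \<iota>: "comm_ring_hom \<iota>" and F: "\<And>i. i < length lam \<Longrightarrow> lin_form \<iota> V (F i)"
  shows "lin_form \<iota> (sym_multi lam V) (eval_form \<iota> lam F)"
    and "eval_form \<iota> lam F (row_prod lam V u) = (\<Prod>b\<in>diagram lam. F (fst b) (u b))"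
proof -
  note sl = sym_form_power(1)[OF \<iota> F] and sv = sym_form_power(2)[OF \<iota> F]
  have mm: "multi_form \<iota> (map (\<lambda>r. sym_upper r V) lam)
      (\<lambda>zs. \<Prod>i<length (map (\<lambda>r. sym_upper r V) lam). sym_form \<iota> (\<lambda>xs. \<Prod>j<length xs. F i (xs ! j)) (zs ! i))"
    by (rule multi_form_prod) (use sl in auto)
  then have mm: "multi_form \<iota> (map (\<lambda>r. sym_upper r V) lam)
      (\<lambda>zs. \<Prod>i<length lam. sym_form \<iota> (\<lambda>xs. \<Prod>j<length xs. F i (xs ! j)) (zs ! i))"
    by simp
  show "lin_form \<iota> (sym_multi lam V) (eval_form \<iota> lam F)"
    unfolding sym_multi_def eval_form_def by (rule multi.tensor_form_lin[OF \<iota> mm])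
  have "eval_form \<iota> lam F (row_prod lam V u) = (\<Prod>i<length lam. \<Prod>j<lam ! i. F i (u (i, j)))"
    unfolding row_prod_def eval_form_def multi.tensor_form_pure[OF \<iota> mm rows_carrier]
    by (rule prod.cong) (use sv[OF _ row_entries] in auto)
  also have "\<dots> = (\<Prod>b\<in>diagram lam. F (fst b) (u b))"
    using prod_diagram[of "\<lambda>b. F (fst b) (u b)" lam] by simp
  finally show "eval_form \<iota> lam F (row_prod lam V u) = (\<Prod>b\<in>diagram lam. F (fst b) (u b))" .
qed

end

lemma row_prod_span_carrier:
  "lspan (sym_multi lam V) (row_prod lam V ` {u. \<forall>b\<in>diagram lam. u b \<in> carrier V}) = carrier (sym_multi lam V)"
    (is "lspan _ ?R = _")
proof -
  have R: "?R \<subseteq> carrier (sym_multi lam V)" using row_prod_carrier by auto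
  let ?Vs = "map (\<lambda>r. sym_upper r V) lam"
  have P: "pure_tensor ?Vs ` listset (map carrier ?Vs) \<subseteq> lspan (sym_multi lam V) ?R"
  proof clarify
    fix zs assume zs: "zs \<in> listset (map carrier ?Vs)"
    let ?S = "\<lambda>i. sym_prod V ` {xs. length xs = lam ! i \<and> set xs \<subseteq> carrier V}"
    have "pure_tensor ?Vs (map (\<lambda>i. zs ! i) [0..<length lam]) \<in> lspan (sym_multi lam V) ?R"
    proof (rule multilinear_span[where T = "\<lambda>z. pure_tensor ?Vs (map z [0..<length lam])" and I = "{..<length lam}"
          and V = "\<lambda>i. sym_upper (lam ! i) V" and S = ?S])
      have upd: "map (z(i := x)) [0..<length lam] = (map z [0..<length lam])[i := x]" for z :: "nat \<Rightarrow> ('v list \<Rightarrow>\<^sub>0 'k) set set" and i x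
        by (rule nth_equalityI) (auto simp: nth_list_update)
      have mem: "map z [0..<length lam] \<in> listset (map carrier ?Vs)"
        if "\<And>j. j \<in> {..<length lam} \<Longrightarrow> z j \<in> carrier (sym_upper (lam ! j) V)" for z
        using that unfolding in_tensor_list by auto
      show "pure_tensor ?Vs (map (z(i := x \<oplus>\<^bsub>sym_upper (lam ! i) V\<^esub> y)) [0..<length lam]) =
        pure_tensor ?Vs (map (z(i := x)) [0..<length lam]) \<oplus>\<^bsub>sym_multi lam V\<^esub> pure_tensor ?Vs (map (z(i := y)) [0..<length lam])"
        if "\<And>j. j \<in> {..<length lam} \<Longrightarrow> z j \<in> carrier (sym_upper (lam ! j) V)" "i \<in> {..<length lam}"
          "x \<in> carrier (sym_upper (lam ! i) V)" "y \<in> carrier (sym_upper (lam ! i) V)" for z i x y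
        unfolding upd sym_multi_def using multi.pure_tensor_add[OF mem[OF that(1)], of i x y] that by simp
      show "pure_tensor ?Vs (map (z(i := c \<odot>\<^bsub>sym_upper (lam ! i) V\<^esub> x)) [0..<length lam]) =
        c \<odot>\<^bsub>sym_multi lam V\<^esub> pure_tensor ?Vs (map (z(i := x)) [0..<length lam])"
        if "\<And>j. j \<in> {..<length lam} \<Longrightarrow> z j \<in> carrier (sym_upper (lam ! j) V)" "i \<in> {..<length lam}"
          "x \<in> carrier (sym_upper (lam ! i) V)" for z i x c
        unfolding upd sym_multi_def using multi.pure_tensor_smult[OF mem[OF that(1)], of i x c] that by simp
      show "pure_tensor ?Vs (map z [0..<length lam]) \<in> carrier (sym_multi lam V)"
        if "\<And>j. j \<in> {..<length lam} \<Longrightarrow> z j \<in> carrier (sym_upper (lam ! j) V)" for z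
        unfolding sym_multi_def by (rule multi.pure_tensor_carrier[OF mem[OF that]])
      show "pure_tensor ?Vs (map z [0..<length lam]) \<in> lspan (sym_multi lam V) ?R"
        if z: "\<And>j. j \<in> {..<length lam} \<Longrightarrow> z j \<in> ?S j" for z
      proof -
        have "\<forall>j\<in>{..<length lam}. \<exists>xs. z j = sym_prod V xs \<and> length xs = lam ! j \<and> set xs \<subseteq> carrier V"
          using z by fast
        then obtain f where f: "\<And>j. j < length lam \<Longrightarrow> z j = sym_prod V (f j) \<and> length (f j) = lam ! j \<and> set (f j) \<subseteq> carrier V"
          by (metis lessThan_iff)
        have "map (\<lambda>j. f i ! j) [0..<lam ! i] = f i" if "i < length lam" for i
          using f[OF that] by (metis map_nth)
        then have "pure_tensor ?Vs (map z [0..<length lam]) = row_prod lam V (\<lambda>(i, j). f i ! j)"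
          unfolding row_prod_def using f by (intro arg_cong[where f = "pure_tensor ?Vs"] map_cong) auto
        moreover have "\<forall>b\<in>diagram lam. (\<lambda>(i, j). f i ! j) b \<in> carrier V"
          using f by (fastforce simp: diagram_def)
        ultimately show ?thesis using span_mem[OF multi_module R] by blast
      qed
      show "zs ! j \<in> lspan (sym_upper (lam ! j) V) (?S j)" if "j \<in> {..<length lam}" for j
        unfolding upper_span_carrier using zs that unfolding in_tensor_list by auto
      show "?S i \<subseteq> carrier (sym_upper (lam ! i) V)" for i by (auto intro!: sym_prod_carrier)
    qed (simp_all add: upper_module multi_module span_submodule[OF multi_module R])
    moreover have "map (\<lambda>i. zs ! i) [0..<length lam] = zs"
      using zs by (metis in_tensor_list length_map map_nth)
    ultimately show "pure_tensor ?Vs zs \<in> lspan (sym_multi lam V) ?R" by simp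
  qed
  have "carrier (sym_multi lam V) \<subseteq> lspan (sym_multi lam V) ?R"
    using span_least[OF multi_module P span_submodule[OF multi_module R]]
    unfolding sym_multi_def multi.tensor_span .
  then show ?thesis using submoduleD(1)[OF span_submodule[OF multi_module R]] by blast
qed

text \<open>Multilinearity is used once more, now box by box rather than row by row. With
  \<open>S\<close> the given basis, every element becomes a combination of monomials in basis
  vectors, which is what the separation argument works with.\<close>

lemma row_prod_span:
  assumes S: "S \<subseteq> carrier V" "lspan V S = carrier V"
  shows "lspan (sym_multi lam V) (row_prod lam V ` {u. \<forall>b\<in>diagram lam. u b \<in> S}) = carrier (sym_multi lam V)"
    (is "lspan _ ?R = _")
proof -
  have R: "?R \<subseteq> carrier (sym_multi lam V)" using row_prod_carrier S(1) by blast
  have P: "row_prod lam V ` {u. \<forall>b\<in>diagram lam. u b \<in> carrier V} \<subseteq> lspan (sym_multi lam V) ?R"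
  proof clarify
    fix u assume u: "\<forall>b\<in>diagram lam. u b \<in> carrier V"
    show "row_prod lam V u \<in> lspan (sym_multi lam V) ?R"
      by (rule multilinear_span[where T = "row_prod lam V" and I = "diagram lam" and V = "\<lambda>_. V" and S = "\<lambda>_. S" and M = "sym_multi lam V"])
        (use u S row_prod_add row_prod_smult row_prod_carrier span_mem[OF multi_module R] in
          \<open>auto simp: finite_diagram rep_module multi_module span_submodule[OF multi_module R]\<close>)
  qed
  have "carrier (sym_multi lam V) \<subseteq> lspan (sym_multi lam V) ?R"
    using span_least[OF multi_module P span_submodule[OF multi_module R]]
    unfolding row_prod_span_carrier .
  then show ?thesis using submoduleD(1)[OF span_submodule[OF multi_module R]] by blast
qed

text \<open>On a row product the action moves into the entries, where it is absorbed by the linear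
  forms; row products span.\<close>

lemma eval_form_act:
  fixes \<iota> :: "'k \<Rightarrow> 'l::comm_ring_1"
  assumes \<iota>: "comm_ring_hom \<iota>" and F: "\<And>i. i < length lam \<Longrightarrow> lin_form \<iota> V (F i)"
    and F': "\<And>i. i < length lam \<Longrightarrow> lin_form \<iota> V (F' i)"
    and g: "g \<in> carrier G" and eq: "\<And>i x. i < length lam \<Longrightarrow> x \<in> carrier V \<Longrightarrow> F i (act V g x) = F' i x"
    and z: "z \<in> carrier (sym_multi lam V)"
  shows "eval_form \<iota> lam F (act (sym_multi lam V) g z) = eval_form \<iota> lam F' z"
proof -
  note r = representationD[OF multi_rep[of lam]]
  interpret V: Module.module class_ring V by (rule rep_module)
  note lin = eval_form_rows(1)[OF _ \<iota>, of lam "\<lambda>_. \<zero>\<^bsub>V\<^esub>"]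
  have l: "lin_form \<iota> (sym_multi lam V) (\<lambda>z. eval_form \<iota> lam F (act (sym_multi lam V) g z))"
    using lin_formD[OF lin[OF _ F]] by (simp add: lin_form_def r g)
  have R: "row_prod lam V ` {u. \<forall>b\<in>diagram lam. u b \<in> carrier V} \<subseteq> carrier (sym_multi lam V)"
    using row_prod_carrier by blast
  show ?thesis
  proof (rule lin_form_eq_on_span[OF multi_module R l])
    fix s assume "s \<in> row_prod lam V ` {u. \<forall>b\<in>diagram lam. u b \<in> carrier V}"
    then obtain u where u: "\<And>b. b \<in> diagram lam \<Longrightarrow> u b \<in> carrier V" "s = row_prod lam V u" by blast
    then have "\<And>b. b \<in> diagram lam \<Longrightarrow> act V g (u b) \<in> carrier V" using representationD(4)[OF rep g] by blast
    then show "eval_form \<iota> lam F (act (sym_multi lam V) g s) = eval_form \<iota> lam F' s"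
      using u eq by (simp add: row_prod_act[OF _ g] eval_form_rows(2)[OF _ \<iota>] F F')
        (rule prod.cong, auto simp: diagram_def)
  qed (use lin F' z row_prod_span_carrier in auto)
qed

section \<open>Antisymmetrised row products and the subspace they span\<close>

lemma perm_entries:
  assumes "\<And>b. b \<in> diagram lam \<Longrightarrow> u b \<in> A" "\<sigma> \<in> CPP lam" "b \<in> diagram lam"
  shows "u (inv_into UNIV \<sigma> b) \<in> A"
  using assms permutes_in_image[OF permutes_inv[OF CPP_permutes[OF assms(2)]]] by blast

lemma col_alt_terms:
  assumes "\<And>b. b \<in> diagram lam \<Longrightarrow> u b \<in> carrier V" "\<sigma> \<in> CPP lam"
  shows "row_prod lam V (\<lambda>b. u (inv_into UNIV \<sigma> b)) \<in> carrier (sym_multi lam V)"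
  by (rule row_prod_carrier) (rule perm_entries[OF assms])

lemma col_alt_carrier:
  assumes u: "\<And>b. b \<in> diagram lam \<Longrightarrow> u b \<in> carrier V"
  shows "col_alt lam V u \<in> carrier (sym_multi lam V)"
proof -
  interpret M: Module.module class_ring "sym_multi lam V" by (rule multi_module)
  show ?thesis unfolding col_alt_def
  proof (rule M.finsum_closed, rule funcsetI)
    fix \<sigma> assume "\<sigma> \<in> CPP lam"
    then show "of_int (sign \<sigma>) \<odot>\<^bsub>sym_multi lam V\<^esub> row_prod lam V (\<lambda>b. u (inv_into UNIV \<sigma> b)) \<in> carrier (sym_multi lam V)"
      by (intro class_moduleD(1)[OF multi_module] col_alt_terms[OF u])
  qed
qed

lemma row_prod_cong:
  assumes "\<And>b. b \<in> diagram lam \<Longrightarrow> u b = u' b"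
  shows "row_prod lam V u = row_prod lam V u'"
  unfolding row_prod_def using assms
  by (intro arg_cong[where f = "pure_tensor _"] map_cong arg_cong[where f = "sym_prod V"]) (auto simp: diagram_def)

lemma col_alt_cong:
  assumes uu: "\<And>b. b \<in> diagram lam \<Longrightarrow> u b = u' b" and u: "\<And>b. b \<in> diagram lam \<Longrightarrow> u b \<in> carrier V"
  shows "col_alt lam V u = col_alt lam V u'"
proof -
  interpret M: Module.module class_ring "sym_multi lam V" by (rule multi_module)
  have "row_prod lam V (\<lambda>b. u (inv_into UNIV \<sigma> b)) = row_prod lam V (\<lambda>b. u' (inv_into UNIV \<sigma> b))" if "\<sigma> \<in> CPP lam" for \<sigma>
    using uu permutes_in_image[OF permutes_inv[OF CPP_permutes[OF that]]] by (intro row_prod_cong) blast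
  moreover have "row_prod lam V (\<lambda>b. u (inv_into UNIV \<sigma> b)) \<in> carrier (sym_multi lam V)" if "\<sigma> \<in> CPP lam" for \<sigma>
    by (rule col_alt_terms[OF u that])
  ultimately show ?thesis unfolding col_alt_def
    by (intro M.finsum_cong') (auto simp: class_moduleD(1)[OF multi_module])
qed

text \<open>Changing box \<open>b\<close> before the permutation amounts to changing box
  \<open>\<sigma> b\<close> after it, so multilinearity of \<open>row_prod\<close> passes to each
  summand of \<open>col_alt\<close>.\<close>

lemma fun_upd_perm:
  assumes "\<sigma> \<in> CPP lam"
  shows "(\<lambda>c. (u(b := z)) (inv_into UNIV \<sigma> c)) = (\<lambda>c. u (inv_into UNIV \<sigma> c))(\<sigma> b := z)"
proof
  fix c
  have "inv_into UNIV \<sigma> c = b \<longleftrightarrow> c = \<sigma> b"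
    using permutes_inverses[OF CPP_permutes[OF assms]] by metis
  then show "(u(b := z)) (inv_into UNIV \<sigma> c) = ((\<lambda>c. u (inv_into UNIV \<sigma> c))(\<sigma> b := z)) c" by auto
qed

lemma col_alt_add:
  assumes u: "\<And>b. b \<in> diagram lam \<Longrightarrow> u b \<in> carrier V"
    and b: "b \<in> diagram lam" and x: "x \<in> carrier V" and y: "y \<in> carrier V"
  shows "col_alt lam V (u(b := x \<oplus>\<^bsub>V\<^esub> y)) =
    col_alt lam V (u(b := x)) \<oplus>\<^bsub>sym_multi lam V\<^esub> col_alt lam V (u(b := y))"
proof -
  interpret M: Module.module class_ring "sym_multi lam V" by (rule multi_module)
  interpret V: Module.module class_ring V by (rule rep_module)
  have t: "row_prod lam V (\<lambda>c. (u(b := z)) (inv_into UNIV \<sigma> c)) \<in> carrier (sym_multi lam V)"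
    if "\<sigma> \<in> CPP lam" "z \<in> carrier V" for z \<sigma>
    by (rule col_alt_terms[OF _ that(1)]) (use u that in auto)
  have a: "row_prod lam V (\<lambda>c. (u(b := x \<oplus>\<^bsub>V\<^esub> y)) (inv_into UNIV \<sigma> c)) =
    row_prod lam V (\<lambda>c. (u(b := x)) (inv_into UNIV \<sigma> c)) \<oplus>\<^bsub>sym_multi lam V\<^esub>
    row_prod lam V (\<lambda>c. (u(b := y)) (inv_into UNIV \<sigma> c))" if s: "\<sigma> \<in> CPP lam" for \<sigma>
    unfolding fun_upd_perm[OF s]
    by (rule row_prod_add[OF perm_entries[OF u s] _ x y]) (use permutes_in_image[OF CPP_permutes[OF s]] b in auto)
  let ?t = "\<lambda>z \<sigma>. of_int (sign \<sigma>) \<odot>\<^bsub>sym_multi lam V\<^esub> row_prod lam V (\<lambda>c. (u(b := z)) (inv_into UNIV \<sigma> c))"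
  have tc: "?t z \<in> CPP lam \<rightarrow> carrier (sym_multi lam V)" if "z \<in> carrier V" for z
    using t[OF _ that] class_moduleD(1)[OF multi_module] by blast
  have "finsum (sym_multi lam V) (?t (x \<oplus>\<^bsub>V\<^esub> y)) (CPP lam) =
      finsum (sym_multi lam V) (\<lambda>\<sigma>. ?t x \<sigma> \<oplus>\<^bsub>sym_multi lam V\<^esub> ?t y \<sigma>) (CPP lam)"
    by (rule M.finsum_cong'[OF refl])
      (use tc[OF x] tc[OF y] in blast, simp only: a class_moduleD(3)[OF multi_module t[OF _ x] t[OF _ y]])
  then show ?thesis unfolding col_alt_def using M.finsum_addf[OF tc[OF x] tc[OF y]] by simp
qed

lemma col_alt_smult:
  assumes u: "\<And>b. b \<in> diagram lam \<Longrightarrow> u b \<in> carrier V"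
    and b: "b \<in> diagram lam" and x: "x \<in> carrier V"
  shows "col_alt lam V (u(b := c \<odot>\<^bsub>V\<^esub> x)) = c \<odot>\<^bsub>sym_multi lam V\<^esub> col_alt lam V (u(b := x))"
proof -
  interpret M: Module.module class_ring "sym_multi lam V" by (rule multi_module)
  have t: "row_prod lam V (\<lambda>c. (u(b := z)) (inv_into UNIV \<sigma> c)) \<in> carrier (sym_multi lam V)"
    if "\<sigma> \<in> CPP lam" "z \<in> carrier V" for z \<sigma>
    by (rule col_alt_terms[OF _ that(1)]) (use u that in auto)
  have a: "row_prod lam V (\<lambda>d. (u(b := c \<odot>\<^bsub>V\<^esub> x)) (inv_into UNIV \<sigma> d)) =
    c \<odot>\<^bsub>sym_multi lam V\<^esub> row_prod lam V (\<lambda>d. (u(b := x)) (inv_into UNIV \<sigma> d))" if s: "\<sigma> \<in> CPP lam" for \<sigma>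
    unfolding fun_upd_perm[OF s]
    by (rule row_prod_smult[OF perm_entries[OF u s] _ x]) (use permutes_in_image[OF CPP_permutes[OF s]] b in auto)
  have e: "of_int (sign \<sigma>) \<odot>\<^bsub>sym_multi lam V\<^esub> row_prod lam V (\<lambda>d. (u(b := c \<odot>\<^bsub>V\<^esub> x)) (inv_into UNIV \<sigma> d)) =
    c \<odot>\<^bsub>sym_multi lam V\<^esub> (of_int (sign \<sigma>) \<odot>\<^bsub>sym_multi lam V\<^esub> row_prod lam V (\<lambda>d. (u(b := x)) (inv_into UNIV \<sigma> d)))"
    if s: "\<sigma> \<in> CPP lam" for \<sigma>
    using t[OF s x] by (simp add: a[OF s] class_moduleD(4)[OF multi_module, symmetric] mult.commute del: fun_upd_apply)
  have tt: "(\<lambda>\<sigma>. of_int (sign \<sigma>) \<odot>\<^bsub>sym_multi lam V\<^esub> row_prod lam V (\<lambda>d. (u(b := x)) (inv_into UNIV \<sigma> d))) \<in> CPP lam \<rightarrow> carrier (sym_multi lam V)"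
    using t x class_moduleD(1)[OF multi_module] by auto
  show ?thesis unfolding col_alt_def
    by (subst M.finsum_smult[OF _ tt], simp)
      (rule M.finsum_cong', use t x e in \<open>auto simp: class_moduleD(1)[OF multi_module] simp del: fun_upd_apply\<close>)
qed

lemma col_alt_act:
  assumes u: "\<And>b. b \<in> diagram lam \<Longrightarrow> u b \<in> carrier V" and g: "g \<in> carrier G"
  shows "act (sym_multi lam V) g (col_alt lam V u) = col_alt lam V (\<lambda>b. act V g (u b))"
proof -
  note r = representationD[OF multi_rep[of lam]]
  interpret M: Module.module class_ring "sym_multi lam V" by (rule multi_module)
  have z: "act (sym_multi lam V) g \<zero>\<^bsub>sym_multi lam V\<^esub> = \<zero>\<^bsub>sym_multi lam V\<^esub>"
    using r(6)[OF g M.zero_closed, of 0] class_moduleD(6)[OF multi_module] r(4)[OF g M.zero_closed] by simp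
  have "act (sym_multi lam V) g (\<Oplus>\<^bsub>sym_multi lam V\<^esub> \<sigma>\<in>A.
        of_int (sign \<sigma>) \<odot>\<^bsub>sym_multi lam V\<^esub> row_prod lam V (\<lambda>b. u (inv_into UNIV \<sigma> b))) =
      (\<Oplus>\<^bsub>sym_multi lam V\<^esub> \<sigma>\<in>A.
        of_int (sign \<sigma>) \<odot>\<^bsub>sym_multi lam V\<^esub> row_prod lam V (\<lambda>b. act V g (u (inv_into UNIV \<sigma> b))))"
    if "finite A" "A \<subseteq> CPP lam" for A
    using that
  proof (induction A)
    case empty then show ?case by (simp add: z)
  next
    case (insert \<sigma> A)
    have t: "row_prod lam V (\<lambda>b. u (inv_into UNIV \<tau> b)) \<in> carrier (sym_multi lam V)"
        "row_prod lam V (\<lambda>b. act V g (u (inv_into UNIV \<tau> b))) \<in> carrier (sym_multi lam V)"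
      if "\<tau> \<in> CPP lam" for \<tau>
    proof -
      have gu: "act V g (u b) \<in> carrier V" if "b \<in> diagram lam" for b
        by (rule representationD(4)[OF rep g u[OF that]])
      show "row_prod lam V (\<lambda>b. u (inv_into UNIV \<tau> b)) \<in> carrier (sym_multi lam V)"
        by (rule col_alt_terms[OF u that])
      show "row_prod lam V (\<lambda>b. act V g (u (inv_into UNIV \<tau> b))) \<in> carrier (sym_multi lam V)"
        by (rule col_alt_terms[of lam "\<lambda>b. act V g (u b)", OF gu that])
    qed
    have a: "act (sym_multi lam V) g (row_prod lam V (\<lambda>b. u (inv_into UNIV \<sigma> b))) =
        row_prod lam V (\<lambda>b. act V g (u (inv_into UNIV \<sigma> b)))"
      using insert by (intro row_prod_act[OF _ g] perm_entries[OF u]) auto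
    have c: "(\<Oplus>\<^bsub>sym_multi lam V\<^esub> \<sigma>\<in>A. of_int (sign \<sigma>) \<odot>\<^bsub>sym_multi lam V\<^esub> row_prod lam V (\<lambda>b. u (inv_into UNIV \<sigma> b))) \<in> carrier (sym_multi lam V)"
      by (rule M.finsum_closed) (use t insert class_moduleD(1)[OF multi_module] in auto)
    show ?case
      using insert t c
      by (subst (1 2) M.finsum_insert) (auto simp: r g a class_moduleD(1)[OF multi_module] subset_iff)
  qed
  from this[OF finite_CPP subset_refl] show ?thesis by (simp add: col_alt_def)
qed

text \<open>The antisymmetrised elements are multilinear in the entries of the boxes, so those with
  entries in a spanning family already span all of them. In particular the subspace is independent
  of the chosen basis.\<close>

lemma schur_carrier:
  assumes S: "v ` B \<subseteq> carrier V" "lspan V (v ` B) = carrier V"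
  shows "carrier (schur lam V B v) = lspan (sym_multi lam V) (col_alt lam V ` {u. \<forall>b\<in>diagram lam. u b \<in> carrier V})"
    (is "_ = lspan _ ?R")
proof -
  let ?R' = "polytabloid lam V v ` tableaux lam B"
  have R: "?R \<subseteq> carrier (sym_multi lam V)" using col_alt_carrier by blast
  have "\<forall>b\<in>diagram lam. v (t b) \<in> carrier V" if "t \<in> tableaux lam B" for t
    using that S(1) by (auto simp: tableaux_def PiE_def Pi_def)
  then have sub: "?R' \<subseteq> ?R" unfolding polytabloid_eq by blast
  then have R': "?R' \<subseteq> carrier (sym_multi lam V)" using R by blast
  have "?R \<subseteq> lspan (sym_multi lam V) ?R'"
  proof clarify
    fix u assume u: "\<forall>b\<in>diagram lam. u b \<in> carrier V"
    show "col_alt lam V u \<in> lspan (sym_multi lam V) ?R'"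
    proof (rule multilinear_span[where T = "col_alt lam V" and I = "diagram lam" and V = "\<lambda>_. V" and S = "\<lambda>_. v ` B" and M = "sym_multi lam V"])
      fix u assume "\<And>b. b \<in> diagram lam \<Longrightarrow> u b \<in> v ` B"
      then have "\<forall>b\<in>diagram lam. \<exists>i\<in>B. u b = v i" by blast
      then obtain t where t: "\<And>b. b \<in> diagram lam \<Longrightarrow> t b \<in> B \<and> u b = v (t b)" by metis
      have "col_alt lam V u = col_alt lam V (\<lambda>b. v (restrict t (diagram lam) b))"
        using t S(1) by (intro col_alt_cong) auto
      moreover have "restrict t (diagram lam) \<in> tableaux lam B" using t by (auto simp: tableaux_def)
      ultimately show "col_alt lam V u \<in> lspan (sym_multi lam V) ?R'"
        unfolding polytabloid_eq[symmetric] using span_mem[OF multi_module R'] by auto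
    qed (use u S col_alt_add col_alt_smult col_alt_carrier in
          \<open>auto simp: finite_diagram rep_module multi_module span_submodule[OF multi_module R']\<close>)
  qed
  then have "lspan (sym_multi lam V) ?R \<subseteq> lspan (sym_multi lam V) ?R'"
    by (rule span_least[OF multi_module _ span_submodule[OF multi_module R']])
  moreover have "lspan (sym_multi lam V) ?R' \<subseteq> lspan (sym_multi lam V) ?R"
    using sub span_mem[OF multi_module R] by (intro span_least[OF multi_module _ span_submodule[OF multi_module R]]) blast
  ultimately show ?thesis by (simp add: schur_def)
qed

text \<open>In the basis-free description a group element sends a generator to a generator, by
  acting on each entry; entries from a fixed basis would not be preserved.\<close>

lemma schur_rep:
  assumes S: "v ` B \<subseteq> carrier V" "lspan V (v ` B) = carrier V"
  shows "representation G (schur lam V B v)"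
proof -
  have R: "col_alt lam V ` {u. \<forall>b\<in>diagram lam. u b \<in> carrier V} \<subseteq> carrier (sym_multi lam V)" using col_alt_carrier by blast
  have "schur lam V B v = (sym_multi lam V)\<lparr>carrier := lspan (sym_multi lam V) (col_alt lam V ` {u. \<forall>b\<in>diagram lam. u b \<in> carrier V})\<rparr>"
    using schur_carrier[OF S, of lam] by (simp add: schur_def)
  moreover have "representation G \<dots>"
  proof (rule representation_submodule[OF multi_rep span_submodule[OF multi_module R]])
    fix g x assume g: "g \<in> carrier G"
      and x: "x \<in> lspan (sym_multi lam V) (col_alt lam V ` {u. \<forall>b\<in>diagram lam. u b \<in> carrier V})"
    show "act (sym_multi lam V) g x \<in> lspan (sym_multi lam V) (col_alt lam V ` {u. \<forall>b\<in>diagram lam. u b \<in> carrier V})"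
    proof (rule span_invariant[OF multi_rep R g _ x], elim imageE CollectE)
      fix u x assume u: "x = col_alt lam V u" "\<forall>b\<in>diagram lam. u b \<in> carrier V"
      then have "act (sym_multi lam V) g x = col_alt lam V (\<lambda>b. act V g (u b))"
        using col_alt_act[OF _ g] by auto
      moreover have "\<forall>b\<in>diagram lam. act V g (u b) \<in> carrier V" using u representationD(4)[OF rep g] by blast
      ultimately show "act (sym_multi lam V) g x \<in> lspan (sym_multi lam V) (col_alt lam V ` {u. \<forall>b\<in>diagram lam. u b \<in> carrier V})"
        using span_mem[OF multi_module R] by blast
    qed
  qed
  ultimately show ?thesis by simp
qed

text \<open>The value is a signed sum over all column-preserving permutations, the raw material for
  a product of Leibniz expansions.\<close>

lemma eval_form_col_alt:
  fixes \<iota> :: "'k \<Rightarrow> 'l::comm_ring_1"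
  assumes \<iota>: "comm_ring_hom \<iota>" and F: "\<And>i. i < length lam \<Longrightarrow> lin_form \<iota> V (F i)"
    and u: "\<And>b. b \<in> diagram lam \<Longrightarrow> u b \<in> carrier V"
  shows "eval_form \<iota> lam F (col_alt lam V u) =
    (\<Sum>\<sigma>\<in>CPP lam. of_int (sign \<sigma>) * (\<Prod>b\<in>diagram lam. F (fst b) (u (\<sigma> b))))"
proof -
  interpret \<iota>: comm_ring_hom \<iota> by (rule \<iota>)
  interpret V: Module.module class_ring V by (rule rep_module)
  have lin: "lin_form \<iota> (sym_multi lam V) (eval_form \<iota> lam F)"
    using eval_form_rows(1)[OF _ \<iota> F, of lam "\<lambda>_. \<zero>\<^bsub>V\<^esub>"] by auto
  have t: "row_prod lam V (\<lambda>b. u (inv_into UNIV \<sigma> b)) \<in> carrier (sym_multi lam V)" if "\<sigma> \<in> CPP lam" for \<sigma>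
    by (rule col_alt_terms[OF u that])
  have "eval_form \<iota> lam F (col_alt lam V u) = (\<Sum>\<sigma>\<in>CPP lam. eval_form \<iota> lam F
      (of_int (sign \<sigma>) \<odot>\<^bsub>sym_multi lam V\<^esub> row_prod lam V (\<lambda>b. u (inv_into UNIV \<sigma> b))))"
    unfolding col_alt_def
    by (rule lin_form_finsum[OF multi_module lin finite_CPP]) (use t class_moduleD(1)[OF multi_module] in auto)
  also have "\<dots> = (\<Sum>\<sigma>\<in>CPP lam. of_int (sign \<sigma>) * (\<Prod>b\<in>diagram lam. F (fst b) (u (inv_into UNIV \<sigma> b))))"
  proof (rule sum.cong[OF refl])
    fix \<sigma> assume s: "\<sigma> \<in> CPP lam"
    have 1: "\<iota> (of_int (sign \<sigma>)) = of_int (sign \<sigma>)"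
      by (cases \<sigma> rule: sign_cases) (simp_all add: \<iota>.hom_uminus)
    have 2: "eval_form \<iota> lam F (row_prod lam V (\<lambda>b. u (inv_into UNIV \<sigma> b))) = (\<Prod>b\<in>diagram lam. F (fst b) (u (inv_into UNIV \<sigma> b)))"
      by (rule eval_form_rows(2)[OF perm_entries[OF u s] \<iota> F])
    show "eval_form \<iota> lam F (of_int (sign \<sigma>) \<odot>\<^bsub>sym_multi lam V\<^esub> row_prod lam V (\<lambda>b. u (inv_into UNIV \<sigma> b)))
      = of_int (sign \<sigma>) * (\<Prod>b\<in>diagram lam. F (fst b) (u (inv_into UNIV \<sigma> b)))"
      unfolding lin_formD(2)[OF lin t[OF s]] 1 2 ..
  qed
  \<comment> \<open>Inversion is a sign-preserving bijection of \<open>CPP lam\<close>; it removes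
    the inverse that comes from the right action on tableaux.\<close>
  also have "\<dots> = (\<Sum>\<sigma>\<in>CPP lam. of_int (sign \<sigma>) * (\<Prod>b\<in>diagram lam. F (fst b) (u (\<sigma> b))))"
  proof (rule sum.reindex_bij_witness[of _ "inv_into UNIV" "inv_into UNIV"])
    fix \<sigma> assume s: "\<sigma> \<in> CPP lam"
    note p = CPP_permutes[OF s]
    show "inv_into UNIV (inv_into UNIV \<sigma>) = \<sigma>" using permutes_inv_inv[OF p] .
    show "inv_into UNIV (inv_into UNIV \<sigma>) = \<sigma>" using permutes_inv_inv[OF p] .
    show "inv_into UNIV \<sigma> \<in> CPP lam" by (rule CPP_inv[OF s])
    show "inv_into UNIV \<sigma> \<in> CPP lam" by (rule CPP_inv[OF s])
    have "sign (inv_into UNIV \<sigma>) = sign \<sigma>"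
      by (rule sign_inverse) (use p finite_diagram in \<open>auto simp: permutation_permutes\<close>)
    then show "of_int (sign (inv_into UNIV \<sigma>)) * (\<Prod>b\<in>diagram lam. F (fst b) (u (inv_into UNIV \<sigma> b)))
      = of_int (sign \<sigma>) * (\<Prod>b\<in>diagram lam. F (fst b) (u (inv_into UNIV \<sigma> b)))" by simp
  qed
  finally show ?thesis .
qed

end

section \<open>Sums over column-preserving permutations as products of determinants\<close>

definition col_perms :: "(nat \<times> nat) set \<Rightarrow> (nat \<times> nat \<Rightarrow> nat \<times> nat) set" where
  "col_perms D = {\<sigma>. \<sigma> permutes D \<and> (\<forall>b\<in>D. snd (\<sigma> b) = snd b)}"

text \<open>A column-preserving permutation splits uniquely into one of the old boxes and one of the
  new column. Signs and products are multiplicative under this splitting, and the sum over the new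
  column is the Leibniz formula.\<close>

lemma col_perms_sum_insert_col:
  fixes a :: "nat \<times> nat \<Rightarrow> nat \<times> nat \<Rightarrow> 'l::comm_ring_1"
  assumes D: "finite D" "\<And>b. b \<in> D \<Longrightarrow> snd b \<noteq> s"
  shows "(\<Sum>\<sigma>\<in>col_perms (D \<union> {0..<k} \<times> {s}). of_int (sign \<sigma>) * (\<Prod>b\<in>D \<union> {0..<k} \<times> {s}. a b (\<sigma> b))) =
    (\<Sum>\<sigma>\<in>col_perms D. of_int (sign \<sigma>) * (\<Prod>b\<in>D. a b (\<sigma> b))) *
    det (mat k k (\<lambda>(i, i'). a (i, s) (i', s)))"
proof -
  let ?C = "{0..<k} \<times> {s}" and ?f = "\<lambda>i::nat. (i, s)"
  let ?P = "{p. p permutes {0..<k}}"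
  have Ds: "(i, s) \<notin> D" for i using D(2)[of "(i, s)"] by auto
  then have disj: "D \<inter> ?C = {}" by auto
  \<comment> \<open>\<open>q p\<close> transports a permutation of row indices to the boxes of the
    new column and fixes every other box.\<close>
  define q where "q p = map_permutation {0..<k} ?f p" for p
  have inj: "inj_on ?f {0..<k}" and img: "?f ` {0..<k} = ?C" by (auto simp: inj_on_def)
  have q1: "q p (i, s) = (p i, s)" if "p permutes {0..<k}" "i < k" for p i
    unfolding q_def map_permutation_def restrict_id_def using that img inv_into_f_f[OF inj, of i]
    by auto
  have q2: "q p b = b" if "b \<notin> ?C" for p b
    unfolding q_def map_permutation_def restrict_id_def using that img by auto
  have qp: "q p permutes ?C" if "p permutes {0..<k}" for p
    unfolding q_def by (rule map_permutation_permutes[OF _ that]) (use inj img in \<open>auto simp: bij_betw_def\<close>)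
  have qs: "sign (q p) = sign p" if "p permutes {0..<k}" for p
    unfolding q_def by (rule sign_map_permutation[OF inj that]) simp
  have sum_eq: "(\<Sum>(\<sigma>, p)\<in>col_perms D \<times> ?P. (of_int (sign \<sigma>) * (\<Prod>b\<in>D. a b (\<sigma> b))) * (of_int (sign p) * (\<Prod>i=0..<k. a (i, s) (p i, s))))
    = (\<Sum>\<sigma>\<in>col_perms (D \<union> ?C). of_int (sign \<sigma>) * (\<Prod>b\<in>D \<union> ?C. a b (\<sigma> b)))"
  \<comment> \<open>The pair (\<sigma>, p) corresponds to \<open>\<sigma> \<circ> q p\<close>.
    Backwards, \<tau> is cut down to the old boxes, and \<open>p\<close> records how it moves the
    rows of the new column.\<close>
  proof (rule sum.reindex_bij_witness[of _ "\<lambda>\<tau>. (\<lambda>b. if b \<in> D then \<tau> b else b, \<lambda>i. if i < k then fst (\<tau> (i, s)) else i)" "\<lambda>(\<sigma>, p). \<sigma> \<circ> q p"])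
    fix x assume "x \<in> col_perms D \<times> ?P"
    then obtain \<sigma> p where x: "x = (\<sigma>, p)" "\<sigma> permutes D" "\<And>b. b \<in> D \<Longrightarrow> snd (\<sigma> b) = snd b" "p permutes {0..<k}"
      by (auto simp: col_perms_def)
    have vD: "(\<sigma> \<circ> q p) b = \<sigma> b" if "b \<in> D" for b
    proof -
      have "b \<notin> ?C" using that disj by blast
      then show ?thesis using q2 by simp
    qed
    have vC: "(\<sigma> \<circ> q p) (i, s) = (p i, s)" if "i < k" for i
      using q1[OF x(4) that] permutes_not_in[OF x(2) Ds] by simp
    have pk: "p i < k" if "i < k" for i using permutes_in_image[OF x(4), of i] that by simp
    have "\<sigma> \<circ> q p permutes D \<union> ?C"
      by (rule permutes_compose[OF permutes_subset[OF qp[OF x(4)]] permutes_subset[OF x(2)]]) auto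
    moreover have "snd ((\<sigma> \<circ> q p) b) = snd b" if "b \<in> D \<union> ?C" for b
      using that vD vC x(3) by (cases "b \<in> D") (simp_all del: o_apply, force simp del: o_apply)
    ultimately show "(case x of (\<sigma>, p) \<Rightarrow> \<sigma> \<circ> q p) \<in> col_perms (D \<union> ?C)"
      unfolding x(1) col_perms_def by (simp del: o_apply)
    have e1: "(\<lambda>b. if b \<in> D then (\<sigma> \<circ> q p) b else b) = \<sigma>"
      using vD permutes_not_in[OF x(2)] by (auto simp del: o_apply)
    have e2: "(\<lambda>i. if i < k then fst ((\<sigma> \<circ> q p) (i, s)) else i) = p"
      using vC permutes_not_in[OF x(4)] by (auto simp del: o_apply)
    show "(\<lambda>b. if b \<in> D then (case x of (\<sigma>, p) \<Rightarrow> \<sigma> \<circ> q p) b else b, \<lambda>i. if i < k then fst ((case x of (\<sigma>, p) \<Rightarrow> \<sigma> \<circ> q p) (i, s)) else i) = x"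
      unfolding x(1) prod.case e1 e2 ..
    have "permutation \<sigma>" "permutation (q p)"
      using x(2) qp[OF x(4)] D(1) by (auto intro: permutes_imp_permutation[rotated])
    then have "sign (\<sigma> \<circ> q p) = sign \<sigma> * sign p"
      using sign_compose[of \<sigma> "q p"] qs[OF x(4)] by metis
    moreover have "(\<Prod>b\<in>D \<union> ?C. a b ((\<sigma> \<circ> q p) b)) = (\<Prod>b\<in>D. a b (\<sigma> b)) * (\<Prod>i=0..<k. a (i, s) (p i, s))"
    proof -
      have "(\<Prod>b\<in>?C. a b ((\<sigma> \<circ> q p) b)) = (\<Prod>i=0..<k. a (i, s) (p i, s))"
        unfolding img[symmetric] by (subst prod.reindex[OF inj]) (auto simp del: o_apply simp: vC o_def[of _ ?f])
      then show ?thesis using D(1) disj vD by (subst prod.union_disjoint) (auto simp del: o_apply)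
    qed
    ultimately show "of_int (sign (case x of (\<sigma>, p) \<Rightarrow> \<sigma> \<circ> q p)) * (\<Prod>b\<in>D \<union> ?C. a b ((case x of (\<sigma>, p) \<Rightarrow> \<sigma> \<circ> q p) b)) =
      (case x of (\<sigma>, p) \<Rightarrow> (of_int (sign \<sigma>) * (\<Prod>b\<in>D. a b (\<sigma> b))) * (of_int (sign p) * (\<Prod>i=0..<k. a (i, s) (p i, s))))"
      unfolding x(1) prod.case by (simp add: mult_ac del: o_apply)
  next
    fix \<tau> assume "\<tau> \<in> col_perms (D \<union> ?C)"
    then have t: "\<tau> permutes D \<union> ?C" "\<And>b. b \<in> D \<union> ?C \<Longrightarrow> snd (\<tau> b) = snd b" by (auto simp: col_perms_def)
    define \<sigma> where "\<sigma> = (\<lambda>b. if b \<in> D then \<tau> b else b)"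
    define p where "p = (\<lambda>i. if i < k then fst (\<tau> (i, s)) else i)"
    have inj_t: "inj \<tau>" using permutes_inj[OF t(1)] .
    \<comment> \<open>No old box lies in column \<open>s\<close>, so preservation of
      \<open>snd\<close> keeps the two sets apart. Each is then mapped injectively into itself, and
      being finite, onto itself.\<close>
    have D1: "\<tau> b \<in> D" if "b \<in> D" for b
    proof -
      have "\<tau> b \<in> D \<union> ?C" using permutes_in_image[OF t(1), of b] that by blast
      moreover have "snd (\<tau> b) \<noteq> s" using t(2)[of b] that D(2) by auto
      ultimately show ?thesis by auto
    qed
    have C1: "\<tau> (i, s) = (p i, s)" "p i < k" if "i < k" for i
    proof -
      have "\<tau> (i, s) \<in> D \<union> ?C" using permutes_in_image[OF t(1), of "(i, s)"] that by auto
      moreover have s: "snd (\<tau> (i, s)) = s" using t(2)[of "(i, s)"] that by auto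
      ultimately have "\<tau> (i, s) \<in> ?C" using D(2) by blast
      then show "\<tau> (i, s) = (p i, s)" "p i < k" using that s by (auto simp: p_def)
    qed
    have "inj_on \<sigma> D" using inj_t by (auto simp: inj_on_def \<sigma>_def)
    moreover have "\<sigma> ` D \<subseteq> D" using D1 by (auto simp: \<sigma>_def)
    ultimately have "bij_betw \<sigma> D D"
      using endo_inj_surj[OF D(1), of \<sigma>] by (auto simp: bij_betw_def)
    then have sp: "\<sigma> permutes D" by (rule bij_imp_permutes) (simp add: \<sigma>_def)
    have "inj_on p {0..<k}"
    proof (rule inj_onI)
      fix i j assume ij: "i \<in> {0..<k}" "j \<in> {0..<k}" "p i = p j"
      then have "\<tau> (i, s) = \<tau> (j, s)" using C1[of i] C1[of j] by simp
      then show "i = j" using inj_t by (auto simp: inj_eq)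
    qed
    moreover have "p ` {0..<k} \<subseteq> {0..<k}" using C1 by auto
    ultimately have "bij_betw p {0..<k} {0..<k}"
      using endo_inj_surj[of "{0..<k}" p] by (auto simp: bij_betw_def)
    then have pp: "p permutes {0..<k}" by (rule bij_imp_permutes) (simp add: p_def)
    have "\<forall>b\<in>D. snd (\<sigma> b) = snd b" using t(2) by (auto simp: \<sigma>_def)
    then show "(\<lambda>b. if b \<in> D then \<tau> b else b, \<lambda>i. if i < k then fst (\<tau> (i, s)) else i) \<in> col_perms D \<times> ?P"
      using sp pp unfolding \<sigma>_def p_def by (simp add: col_perms_def)
    have "(\<sigma> \<circ> q p) b = \<tau> b" for b
    proof (cases "b \<in> D")
      case True
      then have "b \<notin> ?C" using disj by blast
      then show ?thesis using q2[of b p] True by (simp add: \<sigma>_def)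
    next
      case False
      show ?thesis
      proof (cases "b \<in> ?C")
        case True
        then obtain i where i: "b = (i, s)" "i < k" by auto
        then show ?thesis using i q1[OF pp i(2)] C1[OF i(2)] Ds by (simp add: \<sigma>_def)
      next
        case F: False
        then show ?thesis using q2[OF F] False permutes_not_in[OF t(1), of b] by (simp add: \<sigma>_def)
      qed
    qed
    then show "(case (\<lambda>b. if b \<in> D then \<tau> b else b, \<lambda>i. if i < k then fst (\<tau> (i, s)) else i) of (\<sigma>, p) \<Rightarrow> \<sigma> \<circ> q p) = \<tau>"
      unfolding prod.case \<sigma>_def[symmetric] p_def[symmetric] by blast
  qed
  have "det (mat k k (\<lambda>(i, i'). a (i, s) (i', s))) = (\<Sum>p\<in>?P. of_int (sign p) * (\<Prod>i=0..<k. a (i, s) (p i, s)))"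
    by (subst det_def'[of _ k]) (auto intro!: sum.cong prod.cong dest: permutes_in_image)
  then show ?thesis
    unfolding sum_eq[symmetric] by (simp add: sum_product sum.cartesian_product)
qed

text \<open>Columns are split off one at a time, the last one first. The column lengths
  \<open>h\<close> are arbitrary, so that the shape need not be a partition during the
  induction.\<close>

lemma col_perms_sum:
  fixes a :: "nat \<times> nat \<Rightarrow> nat \<times> nat \<Rightarrow> 'l::comm_ring_1"
  shows "(\<Sum>\<sigma>\<in>col_perms {(i, j). j < s \<and> i < h j}. of_int (sign \<sigma>) * (\<Prod>b\<in>{(i, j). j < s \<and> i < h j}. a b (\<sigma> b))) =
    (\<Prod>j<s. det (mat (h j) (h j) (\<lambda>(i, i'). a (i, j) (i', j))))"
proof (induction s)
  case 0
  have "col_perms {} = {id}" by (auto simp: col_perms_def)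
  then show ?case by simp
next
  case (Suc s)
  have fin: "finite {(i, j). j < s \<and> i < h j}"
    by (rule finite_subset[of _ "\<Union>j<s. {..<h j} \<times> {j}"]) auto
  have eq: "{(i, j). j < Suc s \<and> i < h j} = {(i, j). j < s \<and> i < h j} \<union> {0..<h s} \<times> {s}"
    by (auto simp: less_Suc_eq)
  show ?case unfolding eq
    by (subst col_perms_sum_insert_col[OF fin]) (auto simp: Suc.IH)
qed

section \<open>Complementary minors\<close>

text \<open>The permutation matrix of the reversal. With it, Y is the inverse transpose of X with
  rows in reverse order, so the rows k, ..., n - 1 of the inverse transpose become the top n - k
  rows of Y.\<close>

definition anti_mat :: "nat \<Rightarrow> 'l::comm_ring_1 mat" where
  "anti_mat n = mat n n (\<lambda>(i, j). if i + j + 1 = n then 1 else 0)"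

definition dual_mats :: "nat \<Rightarrow> 'l::comm_ring_1 mat \<Rightarrow> 'l mat \<Rightarrow> bool" where
  "dual_mats n X Y \<longleftrightarrow> X \<in> carrier_mat n n \<and> Y \<in> carrier_mat n n \<and> X * transpose_mat Y = anti_mat n"

text \<open>Columns are selected by a function rather than a set: \<open>a\<close> will be a column
  of a tableau, whose order and repetitions both matter.\<close>

definition minor :: "nat \<Rightarrow> 'l::comm_ring_1 mat \<Rightarrow> (nat \<Rightarrow> nat) \<Rightarrow> 'l" where
  "minor k X a = det (mat k k (\<lambda>(i, i'). X $$ (i, a i')))"

lemma anti_mat_carrier [simp]: "anti_mat n \<in> carrier_mat n n"
  by (simp add: anti_mat_def)

lemma anti_mat_transpose: "transpose_mat (anti_mat n) = anti_mat n"
  by (rule eq_matI) (auto simp: anti_mat_def add.commute)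

text \<open>Transpose the defining equation; the antidiagonal matrix is symmetric. This is what
  makes the whole correspondence reversible.\<close>

lemma dual_mats_sym: "dual_mats n X Y \<Longrightarrow> dual_mats n Y X"
proof -
  assume d: "dual_mats n X Y"
  then have "transpose_mat (X * transpose_mat Y) = Y * transpose_mat X"
    by (subst transpose_mult[of _ n n _ n]) (auto simp: dual_mats_def)
  then show ?thesis using d anti_mat_transpose[of n] by (metis dual_mats_def)
qed

lemma anti_mat_square: "anti_mat n * anti_mat n = (1\<^sub>m n :: 'l::comm_ring_1 mat)"
proof (rule eq_matI)
  fix i j assume ij: "i < dim_row (1\<^sub>m n :: 'l mat)" "j < dim_col (1\<^sub>m n :: 'l mat)"
  have "(anti_mat n * anti_mat n :: 'l mat) $$ (i, j) =
      (\<Sum>l=0..<n. (if i + l + 1 = n then 1 else 0) * (if l + j + 1 = n then 1 else 0))"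
    using ij by (simp add: anti_mat_def scalar_prod_def)
  also have "\<dots> = (\<Sum>l=0..<n. if l = n - 1 - i then (if i = j then 1 else 0) else 0)"
    using ij by (intro sum.cong) auto
  also have "\<dots> = (1\<^sub>m n :: 'l mat) $$ (i, j)" using ij by (simp add: sum.delta)
  finally show "(anti_mat n * anti_mat n :: 'l mat) $$ (i, j) = (1\<^sub>m n :: 'l mat) $$ (i, j)" .
qed (auto simp: anti_mat_def)

text \<open>The antidiagonal matrix is an involution, so its determinant squares to 1. Both
  determinants are therefore invertible, with no case distinction on the sign.\<close>

lemma dual_mats_det:
  assumes "dual_mats n X Y"
  shows "(det X * det Y) ^ 2 = 1"
proof -
  have "det X * det Y = det (anti_mat n)"
    using assms det_mult[of X n "transpose_mat Y"] det_transpose[of Y n] by (auto simp: dual_mats_def)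
  moreover have "det (anti_mat n) * det (anti_mat n) = 1"
    using det_mult[OF anti_mat_carrier anti_mat_carrier, of n, symmetric] by (simp add: anti_mat_square)
  ultimately show ?thesis by (simp add: power2_eq_square)
qed

lemma dual_mats_exists:
  fixes X :: "'l::field mat"
  assumes X: "X \<in> carrier_mat n n" and "det X \<noteq> 0"
  shows "\<exists>Y. dual_mats n X Y"
proof -
  obtain Z where Z: "Z \<in> carrier_mat n n" "X * Z = 1\<^sub>m n"
    using det_non_zero_imp_unit[OF assms, of undefined] by (auto simp: Units_def ring_mat_def)
  have "X * (Z * anti_mat n) = anti_mat n"
    using X Z by (subst assoc_mult_mat[symmetric, of _ n n _ n _ n]) (auto simp: left_mult_one_mat[OF anti_mat_carrier])
  then have "dual_mats n X (transpose_mat (Z * anti_mat n))"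
    using X Z by (auto simp: dual_mats_def)
  then show ?thesis by blast
qed

text \<open>The inner factor \<open>R * transpose_mat S\<close> cancels. Equivariance comes from
  here: acting on one side by a matrix and on the other by its inverse transpose preserves
  duality.\<close>

lemma dual_mats_mult:
  assumes d: "dual_mats n X Y" and R: "R \<in> carrier_mat n n" "S \<in> carrier_mat n n" "R * transpose_mat S = 1\<^sub>m n"
  shows "dual_mats n (X * R) (Y * S)"
proof -
  have XY: "X \<in> carrier_mat n n" "Y \<in> carrier_mat n n" "X * transpose_mat Y = anti_mat n"
    using d by (auto simp: dual_mats_def)
  have "X * R * transpose_mat (Y * S) = X * (R * transpose_mat S) * transpose_mat Y"
    using XY R(1,2) by (simp add: transpose_mult[of _ n n _ n] assoc_mult_mat[of _ n n _ n _ n])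
  then show ?thesis using XY R by (simp add: dual_mats_def)
qed

lemma reverse_permutes: "(\<lambda>i. if i < m then m - 1 - i else i) permutes {0..<m::nat}"
  by (rule bij_imp_permutes) (auto intro!: bij_betw_byWitness[where f' = "\<lambda>i. if i < m then m - 1 - i else i"])

text \<open>Jacobi's identity for complementary minors. The columns of X are permuted so that the
  selected ones come first; then \<open>X\<pi> * M\<close> is block triangular with blocks the
  wanted minor and an identity, while \<open>M\<close> is block triangular with blocks an identity
  and \<open>D\<close>. Comparing determinants gives the claim up to signs.\<close>

lemma minor_dual_permutes:
  fixes X Y :: "'l::field mat"
  assumes d: "dual_mats n X Y" and p: "\<pi> permutes {0..<n}" and k: "k \<le> n"
  shows "minor k X \<pi> = of_int (sign \<pi> * sign (\<lambda>i. if i < n - k then n - k - 1 - i else i)) * det X *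
    minor (n - k) Y (\<lambda>i. \<pi> (k + i))"
proof -
  let ?m = "n - k" and ?r = "\<lambda>i. if i < n - k then n - k - 1 - i else i"
  note XY = d[unfolded dual_mats_def]
  note carrierX = XY[THEN conjunct1] and carrierY = XY[THEN conjunct2, THEN conjunct1]
  have n: "n = k + ?m" using k by simp
  have pn: "\<pi> i < n" if "i < n" for i using permutes_in_image[OF p, of i] that by simp
  define X\<pi> where "X\<pi> = mat n n (\<lambda>(i, j). X $$ (i, \<pi> j))"
  \<comment> \<open>From column \<open>k\<close> on, \<open>M\<close> has the columns of the inverse
    of \<open>X\<pi>\<close>, read off from Y by duality. The first \<open>k\<close> columns are
    unit vectors and merely copy columns of \<open>X\<pi>\<close> into the product.\<close>
  define M where "M = mat n n (\<lambda>(i, j). if j < k then (if i = j then 1 else 0) else Y $$ (n - 1 - j, \<pi> i))"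
  define D where "D = mat ?m ?m (\<lambda>(i, j). Y $$ (n - 1 - (k + j), \<pi> (k + i)))"
  have c: "X\<pi> \<in> carrier_mat n n" "M \<in> carrier_mat n n" "D \<in> carrier_mat ?m ?m"
    by (auto simp: X\<pi>_def M_def D_def)
  have "transpose_mat X\<pi> = mat n n (\<lambda>(i, j). transpose_mat X $$ (\<pi> i, j))"
    by (rule eq_matI) (use carrierX pn in \<open>auto simp: X\<pi>_def\<close>)
  then have detX: "det X\<pi> = of_int (sign \<pi>) * det X"
    using det_transpose[OF c(1)] det_permute_rows[of "transpose_mat X" n \<pi>] p carrierX det_transpose[OF carrierX] by simp
  have "M = four_block_mat (1\<^sub>m k) (mat k ?m (\<lambda>(i, j). M $$ (i, k + j))) (0\<^sub>m ?m k) D"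
    by (rule eq_matI) (use k in \<open>auto simp: M_def D_def\<close>)
  then have detM: "det M = det D"
    using det_four_block_mat_lower_left_zero[of "1\<^sub>m k" k "mat k ?m (\<lambda>(i, j). M $$ (i, k + j))" ?m "0\<^sub>m ?m k" D] c
    by simp
  have prod_right: "(X\<pi> * M) $$ (i, j) = (if i = j then 1 else 0)" if "i < n" "k \<le> j" "j < n" for i j
  proof -
    have "(X\<pi> * M) $$ (i, j) = (\<Sum>l=0..<n. X $$ (i, \<pi> l) * Y $$ (n - 1 - j, \<pi> l))"
      using that by (simp add: X\<pi>_def M_def scalar_prod_def)
    \<comment> \<open>Both factors carry the same permutation of the summation index, so it drops
      out.\<close>
    also have "\<dots> = (\<Sum>l=0..<n. X $$ (i, l) * Y $$ (n - 1 - j, l))"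
      using sum.permute[OF p, of "\<lambda>l. X $$ (i, l) * Y $$ (n - 1 - j, l)"] by (simp add: o_def)
    also have "\<dots> = (X * transpose_mat Y) $$ (i, n - 1 - j)"
      using that carrierX carrierY by (simp add: scalar_prod_def)
    also have "\<dots> = (if i = j then 1 else 0)"
      unfolding XY[THEN conjunct2, THEN conjunct2] using that by (auto simp: anti_mat_def)
    finally show ?thesis .
  qed
  have prod_left: "(X\<pi> * M) $$ (i, j) = X $$ (i, \<pi> j)" if "i < n" "j < k" for i j
  proof -
    have "(X\<pi> * M) $$ (i, j) = (\<Sum>l=0..<n. X $$ (i, \<pi> l) * (if l = j then 1 else 0))"
      using that k by (simp add: X\<pi>_def M_def scalar_prod_def)
    also have "\<dots> = (\<Sum>l=0..<n. if l = j then X $$ (i, \<pi> j) else 0)" by (rule sum.cong) auto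
    finally show ?thesis using that k by (simp add: sum.delta)
  qed
  have "X\<pi> * M = four_block_mat (mat k k (\<lambda>(i, j). X $$ (i, \<pi> j))) (0\<^sub>m k ?m)
      (mat ?m k (\<lambda>(i, j). X $$ (k + i, \<pi> j))) (1\<^sub>m ?m)"
    by (rule eq_matI) (use k c prod_left prod_right in \<open>auto simp del: index_mult_mat(1)\<close>)
  then have "det (X\<pi> * M) = minor k X \<pi>"
    using det_four_block_mat_upper_right_zero[of "mat k k (\<lambda>(i, j). X $$ (i, \<pi> j))" k "0\<^sub>m k ?m" ?m
        "mat ?m k (\<lambda>(i, j). X $$ (k + i, \<pi> j))" "1\<^sub>m ?m"]
    by (simp add: minor_def)
  then have 1: "minor k X \<pi> = of_int (sign \<pi>) * det X * det D"
    using det_mult[OF c(1,2)] detX detM by simp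
  \<comment> \<open>The transpose of \<open>D\<close> lists the top rows of Y from bottom to top;
    restoring their order costs the sign of the reversal.\<close>
  let ?N = "mat ?m ?m (\<lambda>(i, i'). Y $$ (i, \<pi> (k + i')))"
  have "transpose_mat D = mat ?m ?m (\<lambda>(i, j). ?N $$ (?r i, j))"
    by (rule eq_matI) (auto simp: D_def)
  then have "det D = of_int (sign ?r) * minor ?m Y (\<lambda>i. \<pi> (k + i))"
    using det_transpose[OF c(3)] det_permute_rows[OF _ reverse_permutes, of ?N ?m] by (simp add: minor_def)
  then show ?thesis using 1 by (simp add: mult_ac)
qed

lemma extend_to_permutation:
  fixes n :: nat
  assumes a: "inj_on a {0..<k}" "a ` {0..<k} \<subseteq> {0..<n}" and k: "k \<le> n"
  obtains \<pi> where "\<pi> permutes {0..<n}" "\<And>i. i < k \<Longrightarrow> \<pi> i = a i"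
proof -
  have "card {k..<n} = card ({0..<n} - a ` {0..<k})"
    using a k by (simp add: card_Diff_subset card_image)
  then obtain f where f: "bij_betw f {k..<n} ({0..<n} - a ` {0..<k})"
    using finite_same_card_bij[of "{k..<n}" "{0..<n} - a ` {0..<k}"] by auto
  let ?p = "\<lambda>i. if i \<in> {0..<k} then a i else if i \<in> {k..<n} then f i else i"
  have "bij_betw ?p ({0..<k} \<union> {k..<n}) (a ` {0..<k} \<union> ({0..<n} - a ` {0..<k}))"
  proof (rule bij_betw_combine)
    show "bij_betw ?p {0..<k} (a ` {0..<k})"
      using a(1) by (subst bij_betw_cong[of _ _ a]) (auto simp: bij_betw_def)
    show "bij_betw ?p {k..<n} ({0..<n} - a ` {0..<k})"
      using f by (subst bij_betw_cong[of _ _ f]) auto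
  qed auto
  moreover have "{0..<k} \<union> {k..<n} = {0..<n}" "a ` {0..<k} \<union> ({0..<n} - a ` {0..<k}) = {0..<n}" using a k by auto
  ultimately have "bij_betw ?p {0..<n} {0..<n}" by simp
  then have "?p permutes {0..<n}" by (rule bij_imp_permutes) (use k in auto)
  then show thesis by (rule that) auto
qed

text \<open>The selector \<open>b\<close> and the sign are obtained from \<open>a\<close> alone,
  before X and Y are given. This order of quantifiers allows a single element of the other Schur
  functor to serve for all dual pairs.\<close>

lemma minor_dual:
  assumes a: "inj_on a {0..<k}" "a ` {0..<k} \<subseteq> {0..<n}" and k: "k \<le> n"
  obtains b and \<epsilon> :: int where "b ` {0..<n - k} \<subseteq> {0..<n}" "\<epsilon> = 1 \<or> \<epsilon> = - 1"
    "\<And>X Y :: 'l::field mat. dual_mats n X Y \<Longrightarrow> minor k X a = of_int \<epsilon> * det X * minor (n - k) Y b"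
proof -
  obtain \<pi> where p: "\<pi> permutes {0..<n}" "\<And>i. i < k \<Longrightarrow> \<pi> i = a i"
    using extend_to_permutation[OF a k] by metis
  let ?r = "\<lambda>i. if i < n - k then n - k - 1 - i else i"
  show thesis
  proof (rule that)
    show "(\<lambda>i. \<pi> (k + i)) ` {0..<n - k} \<subseteq> {0..<n}"
    proof clarsimp
      fix i assume "i < n - k"
      then show "\<pi> (k + i) < n" using permutes_in_image[OF p(1), of "k + i"] by simp
    qed
    show "sign \<pi> * sign ?r = 1 \<or> sign \<pi> * sign ?r = - 1"
      by (cases \<pi> rule: sign_cases; cases ?r rule: sign_cases) simp_all
    fix X Y :: "'l mat" assume d: "dual_mats n X Y"
    have "minor k X a = minor k X \<pi>"
      unfolding minor_def by (intro arg_cong[where f = det] eq_matI) (auto simp: p(2))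
    then show "minor k X a = of_int (sign \<pi> * sign ?r) * det X * minor (n - k) Y (\<lambda>i. \<pi> (k + i))"
      using minor_dual_permutes[OF d p(1) k] by simp
  qed
qed

lemma minor_not_inj:
  assumes "\<not> inj_on a {0..<k}"
  shows "minor k X a = 0"
proof -
  obtain i j where ij: "i < k" "j < k" "i \<noteq> j" "a i = a j" using assms by (auto simp: inj_on_def)
  show ?thesis unfolding minor_def
    by (rule det_identical_columns[of _ k i j]) (use ij in \<open>auto simp: col_def\<close>)
qed

section \<open>Evaluation at a matrix\<close>

lemma digits_unique:
  fixes e e' :: "nat \<Rightarrow> nat"
  assumes "\<And>i. i < N \<Longrightarrow> e i < M" "\<And>i. i < N \<Longrightarrow> e' i < M"
    and "(\<Sum>i<N. e i * M ^ i) = (\<Sum>i<N. e' i * M ^ i)" and "i < N"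
  shows "e i = e' i"
  using assms
proof (induction N arbitrary: e e' i)
  case (Suc N)
  have *: "(\<Sum>i<Suc N. f i * M ^ i) = f 0 + M * (\<Sum>i<N. f (Suc i) * M ^ i)" for f :: "nat \<Rightarrow> nat"
    by (simp only: sum.lessThan_Suc_shift) (simp add: sum_distrib_left mult_ac)
  have eq: "e 0 + M * (\<Sum>i<N. e (Suc i) * M ^ i) = e' 0 + M * (\<Sum>i<N. e' (Suc i) * M ^ i)"
    using Suc.prems(3) unfolding * .
  have lt: "e 0 < M" "e' 0 < M" using Suc.prems(1,2) by auto
  have e0: "e 0 = e' 0"
    using arg_cong[OF eq, of "\<lambda>x. x mod M"] lt by simp
  then have "(\<Sum>i<N. e (Suc i) * M ^ i) = (\<Sum>i<N. e' (Suc i) * M ^ i)" using eq lt by simp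
  then have "e (Suc i) = e' (Suc i)" if "i < N" for i
    by (intro Suc.IH[of "\<lambda>i. e (Suc i)" "\<lambda>i. e' (Suc i)" i]) (use Suc.prems(1,2) that in simp_all)
  then show ?case using e0 Suc.prems(4) by (cases i) auto
qed simp

text \<open>Grouping equal exponents turns each sum into a base \<open>M\<close> expansion whose
  digits are the multiplicities. These are below \<open>M\<close> because the sets are, so
  uniqueness of digits applies.\<close>

lemma weight_unique:
  fixes f :: "'a \<Rightarrow> nat" and f' :: "'b \<Rightarrow> nat"
  assumes A: "finite A" "card A < M" "\<And>a. a \<in> A \<Longrightarrow> f a < N"
    and B: "finite B" "card B < M" "\<And>a. a \<in> B \<Longrightarrow> f' a < N"
    and eq: "(\<Sum>a\<in>A. M ^ f a) = (\<Sum>a\<in>B. M ^ f' a)"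
  shows "card {a\<in>A. f a = q} = card {a\<in>B. f' a = q}"
proof (cases "q < N")
  case True
  have *: "(\<Sum>a\<in>A. M ^ f a) = (\<Sum>q<N. card {a\<in>A. f a = q} * M ^ q)"
    if "finite A" "\<And>a. a \<in> A \<Longrightarrow> f a < N" for A :: "'c set" and f
  proof -
    have "(\<Sum>q<N. card {a\<in>A. f a = q} * M ^ q) = (\<Sum>q<N. \<Sum>a\<in>{a\<in>A. f a = q}. M ^ f a)"
      by (rule sum.cong) auto
    also have "\<dots> = (\<Sum>a\<in>A. M ^ f a)"
      by (rule sum.group) (use that in auto)
    finally show ?thesis by simp
  qed
  have le: "card {a\<in>A. f a = q} < M" "card {a\<in>B. f' a = q} < M" for q
    using A(1,2) B(1,2) card_mono[of A "{a\<in>A. f a = q}"] card_mono[of B "{a\<in>B. f' a = q}"] by auto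
  show ?thesis
    by (rule digits_unique[of N _ M _ q, OF le(1) le(2) _ True])
      (use eq *[OF A(1,3)] *[OF B(1,3)] in simp)
next
  case False
  then have "{a\<in>A. f a = q} = {}" "{a\<in>B. f' a = q} = {}" using A(3) B(3) by fastforce+
  then show ?thesis by (simp only: card.empty)
qed

lemma count_map_upt: "count (mset (map f [0..<k])) x = card {j. j < k \<and> f j = x}"
proof (induction k)
  case (Suc k)
  have "{j. j < Suc k \<and> f j = x} = (if f k = x then insert k {j. j < k \<and> f j = x} else {j. j < k \<and> f j = x})"
    by (auto simp: less_Suc_eq)
  then show ?case using Suc.IH by simp
qed simp

section \<open>Coordinates, evaluation and separation of elements\<close>

definition row_form :: "('k::field \<Rightarrow> 'l::comm_ring_1) \<Rightarrow> nat \<Rightarrow> (nat \<Rightarrow> 'v \<Rightarrow> 'k) \<Rightarrow> 'l mat \<Rightarrow> nat \<Rightarrow> 'v \<Rightarrow> 'l" where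
  "row_form \<iota> n c X i x = (\<Sum>j<n. X $$ (i, j) * \<iota> (c j x))"

abbreviation const_fract :: "'k::field \<Rightarrow> 'k poly fract" where
  "const_fract c \<equiv> to_fract [:c:]"

lemma const_fract_hom: "comm_ring_hom (const_fract :: 'k::field \<Rightarrow> 'k poly fract)"
proof
  show "const_fract (1 :: 'k) = 1" by (metis to_fract_1 one_pCons)
qed (auto simp flip: to_fract_add to_fract_mult)

text \<open>A representation with a finite basis \<open>m\<close> and its coordinate forms
  \<open>c\<close>. Independence of \<open>m\<close> is expressed by the duality with
  \<open>c\<close>, which is the form in which it enters computations.\<close>

locale coord_rep = rep_space G V for G :: "('g, 'c) monoid_scheme" and V :: "('k::field, 'v, 'g) rep" +
  fixes n :: nat and m :: "nat \<Rightarrow> 'v" and c :: "nat \<Rightarrow> 'v \<Rightarrow> 'k"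
  assumes m_carrier: "\<And>j. j < n \<Longrightarrow> m j \<in> carrier V"
    and c_lin: "\<And>j. j < n \<Longrightarrow> lin_form (\<lambda>x. x) V (c j)"
    and c_m: "\<And>i j. i < n \<Longrightarrow> j < n \<Longrightarrow> c j (m i) = (if i = j then 1 else 0)"
    and m_span: "lspan V (m ` {..<n}) = carrier V"
begin

lemma m_image: "m ` {..<n} \<subseteq> carrier V"
  using m_carrier by auto

lemma row_form_lin:
  assumes "comm_ring_hom \<iota>"
  shows "lin_form \<iota> V (row_form \<iota> n c X i)"
proof -
  interpret \<iota>: comm_ring_hom \<iota> by fact
  have "lin_form \<iota> V (\<lambda>x. \<iota> (c j x))" if "j < n" for j
    using lin_formD[OF c_lin[OF that]] by (simp add: lin_form_def \<iota>.hom_add \<iota>.hom_mult)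
  then show ?thesis unfolding row_form_def[abs_def] by (intro lin_form_sum) auto
qed

lemma row_form_m:
  assumes \<iota>: "comm_ring_hom \<iota>" and "k < n"
  shows "row_form \<iota> n c X i (m k) = X $$ (i, k)"
proof -
  interpret \<iota>: comm_ring_hom \<iota> by fact
  have "row_form \<iota> n c X i (m k) = (\<Sum>j<n. if j = k then X $$ (i, k) else 0)"
    unfolding row_form_def by (rule sum.cong) (use assms in \<open>auto simp: c_m\<close>)
  then show ?thesis using assms by simp
qed

lemma eval_lin:
  assumes \<iota>: "comm_ring_hom \<iota>"
  shows "lin_form \<iota> (sym_multi lam V) (eval_form \<iota> lam (row_form \<iota> n c X))"
proof -
  interpret V: Module.module class_ring V by (rule rep_module)
  show ?thesis by (rule eval_form_rows(1)[of lam "\<lambda>_. \<zero>\<^bsub>V\<^esub>", OF _ \<iota> row_form_lin[OF \<iota>]]) simp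
qed

lemma eval_row_prod:
  assumes \<iota>: "comm_ring_hom \<iota>" and t: "\<And>b. b \<in> diagram lam \<Longrightarrow> t b < n"
  shows "eval_form \<iota> lam (row_form \<iota> n c X) (row_prod lam V (\<lambda>b. m (t b))) = (\<Prod>b\<in>diagram lam. X $$ (fst b, t b))"
proof -
  have "eval_form \<iota> lam (row_form \<iota> n c X) (row_prod lam V (\<lambda>b. m (t b))) = (\<Prod>b\<in>diagram lam. row_form \<iota> n c X (fst b) (m (t b)))"
    by (rule eval_form_rows(2)[OF _ \<iota> row_form_lin[OF \<iota>]]) (use t m_carrier in auto)
  also have "\<dots> = (\<Prod>b\<in>diagram lam. X $$ (fst b, t b))"
    by (rule prod.cong) (use t in \<open>auto simp: row_form_m[OF \<iota>]\<close>)
  finally show ?thesis .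
qed

text \<open>The signed sum over column permutations factors over the columns by
  \<open>col_perms_sum\<close>. The rows of a column are the top rows of X, because columns of a
  diagram start in row 0.\<close>

lemma eval_col_alt:
  assumes \<iota>: "comm_ring_hom \<iota>" and lam: "diagram lam = {(i, j). j < s \<and> i < h j}"
    and t: "\<And>b. b \<in> diagram lam \<Longrightarrow> t b < n"
  shows "eval_form \<iota> lam (row_form \<iota> n c X) (col_alt lam V (\<lambda>b. m (t b))) = (\<Prod>j<s. minor (h j) X (\<lambda>i. t (i, j)))"
proof -
  have CPP: "CPP lam = col_perms (diagram lam)" by (simp add: CPP_def col_perms_def)
  have "eval_form \<iota> lam (row_form \<iota> n c X) (col_alt lam V (\<lambda>b. m (t b))) =
    (\<Sum>\<sigma>\<in>CPP lam. of_int (sign \<sigma>) * (\<Prod>b\<in>diagram lam. row_form \<iota> n c X (fst b) (m (t (\<sigma> b)))))"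
    by (rule eval_form_col_alt[OF \<iota> row_form_lin[OF \<iota>]]) (use t m_carrier in auto)
  also have "\<dots> = (\<Prod>j<s. det (mat (h j) (h j) (\<lambda>(i, i'). row_form \<iota> n c X (fst (i, j)) (m (t (i', j))))))"
    unfolding CPP lam by (rule col_perms_sum[of "\<lambda>b b'. row_form \<iota> n c X (fst b) (m (t b'))" s h])
  also have "\<dots> = (\<Prod>j<s. minor (h j) X (\<lambda>i. t (i, j)))"
    unfolding minor_def using t
    by (intro prod.cong refl arg_cong[where f = det] eq_matI) (auto simp: row_form_m[OF \<iota>] lam)
  finally show ?thesis .
qed

text \<open>The digit at position \<open>n * i + k\<close> counts the boxes of row \<open>i\<close>
  with entry \<open>k\<close>. So the weight determines the multiset of entries in each row, and
  symmetric products depend on nothing else.\<close>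

lemma row_prod_eq_of_weight:
  assumes len: "length lam \<le> n" and M: "card (diagram lam) < M"
    and t: "\<And>b. b \<in> diagram lam \<Longrightarrow> t b < n" and t': "\<And>b. b \<in> diagram lam \<Longrightarrow> t' b < n"
    and w: "(\<Sum>b\<in>diagram lam. M ^ (n * fst b + t b)) = (\<Sum>b\<in>diagram lam. M ^ (n * fst b + t' b))"
  shows "row_prod lam V (\<lambda>b. m (t b)) = row_prod lam V (\<lambda>b. m (t' b))"
proof -
  have bound: "n * fst b + t b < n * n" if "b \<in> diagram lam" "t b < n" for b and t :: "nat \<times> nat \<Rightarrow> nat"
  proof -
    have "Suc (fst b) \<le> n" using that len by (auto simp: diagram_def)
    then have "n * Suc (fst b) \<le> n * n" by (rule mult_le_mono2)
    then show ?thesis using that(2) by simp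
  qed
  have cards: "card {b\<in>diagram lam. n * fst b + t b = q} = card {b\<in>diagram lam. n * fst b + t' b = q}" for q
    by (rule weight_unique[of _ M _ "n * n"]) (use finite_diagram M bound t t' w in auto)
  have row: "card {j. j < lam ! i \<and> u (i, j) = k} = card {b\<in>diagram lam. n * fst b + u b = n * i + k}"
    if "i < length lam" "k < n" and u: "\<And>b. b \<in> diagram lam \<Longrightarrow> u b < n" for i k and u :: "nat \<times> nat \<Rightarrow> nat"
  proof -
    have "{b\<in>diagram lam. n * fst b + u b = n * i + k} = Pair i ` {j. j < lam ! i \<and> u (i, j) = k}"
    proof (intro equalityI subsetI)
      fix b assume b: "b \<in> {b\<in>diagram lam. n * fst b + u b = n * i + k}"
      then have "u b < n" using u by auto
      have eq: "n * fst b + u b = n * i + k" using b by simp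
      have "fst b = i" using arg_cong[OF eq, of "\<lambda>x. x div n"] \<open>u b < n\<close> that(2) by simp
      moreover have "u b = k" using arg_cong[OF eq, of "\<lambda>x. x mod n"] \<open>u b < n\<close> that(2) by simp
      ultimately show "b \<in> Pair i ` {j. j < lam ! i \<and> u (i, j) = k}"
        using b by (cases b) (auto simp: diagram_def)
    qed (use that(1) in \<open>auto simp: diagram_def\<close>)
    then show ?thesis by (simp add: card_image inj_on_def)
  qed
  have count: "count (mset (map (\<lambda>j. u (i, j)) [0..<lam ! i])) k = card {j. j < lam ! i \<and> u (i, j) = k}" for u :: "nat \<times> nat \<Rightarrow> nat" and i k
    by (rule count_map_upt)
  have "mset (map (\<lambda>j. t (i, j)) [0..<lam ! i]) = mset (map (\<lambda>j. t' (i, j)) [0..<lam ! i])" if i: "i < length lam" for i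
  proof (rule multiset_eqI)
    fix k
    show "count (mset (map (\<lambda>j. t (i, j)) [0..<lam ! i])) k = count (mset (map (\<lambda>j. t' (i, j)) [0..<lam ! i])) k"
    proof (cases "k < n")
      case True
      have "card {j. j < lam ! i \<and> t (i, j) = k} = card {b\<in>diagram lam. n * fst b + t b = n * i + k}"
        by (rule row[OF i True]) (rule t)
      moreover have "card {j. j < lam ! i \<and> t' (i, j) = k} = card {b\<in>diagram lam. n * fst b + t' b = n * i + k}"
        by (rule row[OF i True]) (rule t')
      ultimately show ?thesis unfolding count cards by simp
    next
      case False
      then have "{j. j < lam ! i \<and> t (i, j) = k} = {}" "{j. j < lam ! i \<and> t' (i, j) = k} = {}"
        using t[of "(i, _)"] t'[of "(i, _)"] i by (fastforce simp: diagram_def)+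
      then show ?thesis unfolding count by (simp only: card.empty)
    qed
  qed
  then have "image_mset m (mset (map (\<lambda>j. t (i, j)) [0..<lam ! i])) = image_mset m (mset (map (\<lambda>j. t' (i, j)) [0..<lam ! i]))"
    if "i < length lam" for i using that by simp
  then have "mset (map (\<lambda>j. m (t (i, j))) [0..<lam ! i]) = mset (map (\<lambda>j. m (t' (i, j))) [0..<lam ! i])" if "i < length lam" for i
    using that by (simp add: image_mset.compositionality o_def)
  moreover have "set (map (\<lambda>j. m (t (i, j))) [0..<lam ! i]) \<subseteq> carrier V" if "i < length lam" for i
    using t m_carrier that by (auto simp: diagram_def)
  ultimately show ?thesis unfolding row_prod_def
    by (intro arg_cong[where f = "pure_tensor _"] map_cong refl sym_prod_mset) auto
qed

text \<open>Kronecker substitution: putting \<open>T ^ (M ^ (n * i + j))\<close> for the \<open>(i, j)\<close> entry sends distinct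
  monomials of small degree to distinct powers of \<open>T\<close>, so a single matrix separates all elements.\<close>

lemma eval_separates:
  assumes len: "length lam \<le> n"
  shows "\<exists>X :: 'k poly fract mat. X \<in> carrier_mat n n \<and> det X \<noteq> 0 \<and>
    (\<forall>z\<in>carrier (sym_multi lam V). eval_form const_fract lam (row_form const_fract n c X) z = 0 \<longrightarrow> z = \<zero>\<^bsub>sym_multi lam V\<^esub>)"
proof -
  \<comment> \<open>The base exceeds both the number of boxes and \<open>n\<close>, so that
    multiplicities are digits for the monomials of elements and also for the Leibniz terms of det
    X.\<close>
  define M where "M = card (diagram lam) + n + 2"
  define T where "T = {t. \<forall>b\<in>diagram lam. t b < n}"
  define w where "w t = (\<Sum>b\<in>diagram lam. M ^ (n * fst b + t b))" for t
  define X :: "'k poly fract mat" where "X = mat n n (\<lambda>(i, j). to_fract (monom 1 (M ^ (n * i + j))))"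
  let ?ev = "eval_form const_fract lam (row_form const_fract n c X)" and ?M = "sym_multi lam V"
  interpret Mod: Module.module class_ring ?M by (rule multi_module)
  note hom = const_fract_hom
  note lin = eval_lin[OF hom, of lam X]
  have prod_monom: "(\<Prod>a\<in>A. to_fract (monom (1::'k) (f a))) = to_fract (monom 1 (\<Sum>a\<in>A. f a))" if "finite A" for A and f :: "'x \<Rightarrow> nat"
    using that by (induction A) (auto simp: mult_monom simp flip: to_fract_mult)
  have ev: "?ev (row_prod lam V (\<lambda>b. m (t b))) = to_fract (monom 1 (w t))" if "t \<in> T" for t
  proof -
    have "?ev (row_prod lam V (\<lambda>b. m (t b))) = (\<Prod>b\<in>diagram lam. X $$ (fst b, t b))"
      using that by (intro eval_row_prod[OF hom]) (auto simp: T_def)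
    also have "\<dots> = (\<Prod>b\<in>diagram lam. to_fract (monom 1 (M ^ (n * fst b + t b))))"
      by (rule prod.cong) (use that len in \<open>auto simp: X_def T_def diagram_def\<close>)
    finally show ?thesis unfolding w_def by (simp add: prod_monom finite_diagram)
  qed
  \<comment> \<open>The row product of weight \<open>d\<close>. The choice of tableau is immaterial
    by \<open>row_prod_eq_of_weight\<close>; degrees that do not occur as weights get zero.\<close>
  define \<rho> where "\<rho> d = (if \<exists>t\<in>T. w t = d then row_prod lam V (\<lambda>b. m ((SOME t. t \<in> T \<and> w t = d) b)) else \<zero>\<^bsub>?M\<^esub>)" for d
  have rp: "row_prod lam V (\<lambda>b. m (t b)) \<in> carrier ?M" if "t \<in> T" for t
    by (rule row_prod_carrier) (use that m_carrier in \<open>auto simp: T_def\<close>)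
  have \<rho>w: "\<rho> (w t) = row_prod lam V (\<lambda>b. m (t b))" if t: "t \<in> T" for t
  proof -
    define t' where "t' = (SOME t'. t' \<in> T \<and> w t' = w t)"
    have t': "t' \<in> T \<and> w t' = w t"
      unfolding t'_def by (rule someI[of _ t]) (simp add: t)
    have "\<rho> (w t) = row_prod lam V (\<lambda>b. m (t' b))" using t unfolding \<rho>_def t'_def by auto
    also have "\<dots> = row_prod lam V (\<lambda>b. m (t b))"
      by (rule row_prod_eq_of_weight[OF len, of M]) (use t t' in \<open>auto simp: T_def w_def M_def\<close>)
    finally show ?thesis .
  qed
  have \<rho>c: "\<rho> d \<in> carrier ?M" for d
    by (cases "\<exists>t\<in>T. w t = d") (auto simp: \<rho>w rp, auto simp: \<rho>_def)
  \<comment> \<open>A common bound for all weights, which keeps the sums over degrees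
    finite.\<close>
  define N where "N = card (diagram lam) * M ^ (n * n)"
  have wN: "w t \<le> N" if "t \<in> T" for t
  proof -
    have "M ^ (n * fst b + t b) \<le> M ^ (n * n)" if b: "b \<in> diagram lam" for b
    proof (rule power_increasing)
      have "Suc (fst b) \<le> n" using b len by (auto simp: diagram_def)
      then have "n * Suc (fst b) \<le> n * n" by (rule mult_le_mono2)
      then show "n * fst b + t b \<le> n * n" using \<open>t \<in> T\<close> b by (force simp: T_def)
    qed (simp add: M_def)
    then have "w t \<le> (\<Sum>b\<in>diagram lam. M ^ (n * n))" unfolding w_def by (rule sum_mono)
    then show ?thesis by (simp add: N_def)
  qed
  have S: "row_prod lam V ` {u. \<forall>b\<in>diagram lam. u b \<in> m ` {..<n}} \<subseteq> carrier ?M"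
    using m_image row_prod_carrier by blast
  have comb: "(\<lambda>d. coeff p d \<odot>\<^bsub>?M\<^esub> \<rho> d) \<in> {..N} \<rightarrow> carrier ?M" for p :: "'k poly"
    using \<rho>c class_moduleD(1)[OF multi_module] by auto
  \<comment> \<open>An element is rebuilt from the coefficients of its value. This is linear in
    \<open>z\<close>, so it need only be checked on row products, and it makes the evaluation
    injective without a proof that distinct monomials are independent.\<close>
  have expand: "\<exists>p. ?ev z = to_fract p \<and> z = (\<Oplus>\<^bsub>?M\<^esub>d\<in>{..N}. coeff p d \<odot>\<^bsub>?M\<^esub> \<rho> d)"
    if z: "z \<in> carrier ?M" for z
  proof (rule span_induct[OF multi_module S z[folded row_prod_span[OF m_image m_span]]])
    have "(\<Oplus>\<^bsub>?M\<^esub>d\<in>{..N}. coeff 0 d \<odot>\<^bsub>?M\<^esub> \<rho> d) = (\<Oplus>\<^bsub>?M\<^esub>d\<in>{..N}. \<zero>\<^bsub>?M\<^esub>)"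
      by (rule Mod.finsum_cong') (auto simp: class_moduleD(6)[OF multi_module \<rho>c])
    then show "\<exists>p. ?ev \<zero>\<^bsub>?M\<^esub> = to_fract p \<and> \<zero>\<^bsub>?M\<^esub> = (\<Oplus>\<^bsub>?M\<^esub>d\<in>{..N}. coeff p d \<odot>\<^bsub>?M\<^esub> \<rho> d)"
      by (intro exI[of _ 0]) (simp add: lin_form_zero[OF multi_module lin])
  next
    fix x y assume xy: "x \<in> carrier ?M" "y \<in> carrier ?M"
      "\<exists>p. ?ev x = to_fract p \<and> x = (\<Oplus>\<^bsub>?M\<^esub>d\<in>{..N}. coeff p d \<odot>\<^bsub>?M\<^esub> \<rho> d)"
      "\<exists>p. ?ev y = to_fract p \<and> y = (\<Oplus>\<^bsub>?M\<^esub>d\<in>{..N}. coeff p d \<odot>\<^bsub>?M\<^esub> \<rho> d)"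
    then obtain p q where pq: "?ev x = to_fract p" "x = (\<Oplus>\<^bsub>?M\<^esub>d\<in>{..N}. coeff p d \<odot>\<^bsub>?M\<^esub> \<rho> d)"
      "?ev y = to_fract q" "y = (\<Oplus>\<^bsub>?M\<^esub>d\<in>{..N}. coeff q d \<odot>\<^bsub>?M\<^esub> \<rho> d)" by blast
    have "(\<Oplus>\<^bsub>?M\<^esub>d\<in>{..N}. coeff (p + q) d \<odot>\<^bsub>?M\<^esub> \<rho> d) =
      (\<Oplus>\<^bsub>?M\<^esub>d\<in>{..N}. coeff p d \<odot>\<^bsub>?M\<^esub> \<rho> d \<oplus>\<^bsub>?M\<^esub> coeff q d \<odot>\<^bsub>?M\<^esub> \<rho> d)"
      using \<rho>c by (intro Mod.finsum_cong') (auto simp: class_moduleD(1,2)[OF multi_module])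
    also have "\<dots> = x \<oplus>\<^bsub>?M\<^esub> y" unfolding pq(2,4) by (rule Mod.finsum_addf[OF comb comb])
    finally show "\<exists>p. ?ev (x \<oplus>\<^bsub>?M\<^esub> y) = to_fract p \<and> x \<oplus>\<^bsub>?M\<^esub> y = (\<Oplus>\<^bsub>?M\<^esub>d\<in>{..N}. coeff p d \<odot>\<^bsub>?M\<^esub> \<rho> d)"
      using lin_formD(1)[OF lin xy(1,2)] pq(1,3) by (intro exI[of _ "p + q"]) simp
  next
    fix a x assume x: "x \<in> carrier ?M"
      "\<exists>p. ?ev x = to_fract p \<and> x = (\<Oplus>\<^bsub>?M\<^esub>d\<in>{..N}. coeff p d \<odot>\<^bsub>?M\<^esub> \<rho> d)"
    then obtain p where p: "?ev x = to_fract p" "x = (\<Oplus>\<^bsub>?M\<^esub>d\<in>{..N}. coeff p d \<odot>\<^bsub>?M\<^esub> \<rho> d)" by blast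
    have "a \<odot>\<^bsub>?M\<^esub> x = (\<Oplus>\<^bsub>?M\<^esub>d\<in>{..N}. a \<odot>\<^bsub>?M\<^esub> (coeff p d \<odot>\<^bsub>?M\<^esub> \<rho> d))"
      unfolding p(2) by (rule Mod.finsum_smult[OF _ comb]) simp
    also have "\<dots> = (\<Oplus>\<^bsub>?M\<^esub>d\<in>{..N}. coeff (Polynomial.smult a p) d \<odot>\<^bsub>?M\<^esub> \<rho> d)"
      using \<rho>c by (intro Mod.finsum_cong') (auto simp: class_moduleD(1,4)[OF multi_module])
    finally show "\<exists>p. ?ev (a \<odot>\<^bsub>?M\<^esub> x) = to_fract p \<and> a \<odot>\<^bsub>?M\<^esub> x = (\<Oplus>\<^bsub>?M\<^esub>d\<in>{..N}. coeff p d \<odot>\<^bsub>?M\<^esub> \<rho> d)"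
      using lin_formD(2)[OF lin x(1), of a] p(1) by (intro exI[of _ "Polynomial.smult a p"]) (simp flip: to_fract_mult)
  next
    fix x assume "x \<in> row_prod lam V ` {u. \<forall>b\<in>diagram lam. u b \<in> m ` {..<n}}"
    then obtain u where u: "x = row_prod lam V u" "\<forall>b\<in>diagram lam. \<exists>j<n. u b = m j" by blast
    then obtain t where t: "\<And>b. b \<in> diagram lam \<Longrightarrow> t b < n \<and> u b = m (t b)" by metis
    then have tT: "t \<in> T" by (auto simp: T_def)
    have x: "x = row_prod lam V (\<lambda>b. m (t b))" unfolding u(1) by (rule row_prod_cong) (use t in auto)
    have "(\<Oplus>\<^bsub>?M\<^esub>d\<in>{..N}. coeff (monom 1 (w t)) d \<odot>\<^bsub>?M\<^esub> \<rho> d) = (\<Oplus>\<^bsub>?M\<^esub>d\<in>{..N}. if w t = d then \<rho> d else \<zero>\<^bsub>?M\<^esub>)"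
      using \<rho>c by (intro Mod.finsum_cong') (auto simp: class_moduleD(5,6)[OF multi_module])
    also have "\<dots> = \<rho> (w t)"
      by (rule Mod.add.finprod_singleton) (use wN[OF tT] \<rho>c in auto)
    finally show "\<exists>p. ?ev x = to_fract p \<and> x = (\<Oplus>\<^bsub>?M\<^esub>d\<in>{..N}. coeff p d \<odot>\<^bsub>?M\<^esub> \<rho> d)"
      using ev[OF tT] \<rho>w[OF tT] x by (intro exI[of _ "monom 1 (w t)"]) simp
  qed
  have inj: "z = \<zero>\<^bsub>?M\<^esub>" if z: "z \<in> carrier ?M" "?ev z = 0" for z
  proof -
    obtain p where p: "?ev z = to_fract p" "z = (\<Oplus>\<^bsub>?M\<^esub>d\<in>{..N}. coeff p d \<odot>\<^bsub>?M\<^esub> \<rho> d)"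
      using expand[OF z(1)] by blast
    have "p = 0" using p(1) z(2) by simp
    have "(\<Oplus>\<^bsub>?M\<^esub>d\<in>{..N}. coeff p d \<odot>\<^bsub>?M\<^esub> \<rho> d) = (\<Oplus>\<^bsub>?M\<^esub>d\<in>{..N}. \<zero>\<^bsub>?M\<^esub>)"
      by (rule Mod.finsum_cong') (auto simp: class_moduleD(6)[OF multi_module \<rho>c] \<open>p = 0\<close>)
    then show ?thesis using p(2) by simp
  qed
  have "det X = to_fract (\<Sum>p\<in>{p. p permutes {0..<n}}. monom (of_int (sign p)) (\<Sum>i=0..<n. M ^ (n * i + p i)))" (is "_ = to_fract ?P")
  proof -
    have to_fract_sum: "to_fract (\<Sum>a\<in>A. f a) = (\<Sum>a\<in>A. to_fract (f a))" for A and f :: "'x \<Rightarrow> 'k poly"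
      by (induction A rule: infinite_finite_induct) auto
    have sg: "of_int (sign p) * to_fract (monom (1::'k) d) = to_fract (monom (of_int (sign p)) d)" for p :: "nat \<Rightarrow> nat" and d
      by (cases p rule: sign_cases) (auto simp flip: to_fract_uminus minus_monom)
    have "det X = (\<Sum>p\<in>{p. p permutes {0..<n}}. of_int (sign p) * (\<Prod>i=0..<n. X $$ (i, p i)))"
      by (rule det_def') (simp add: X_def)
    also have "\<dots> = (\<Sum>p\<in>{p. p permutes {0..<n}}. of_int (sign p) * (\<Prod>i=0..<n. to_fract (monom 1 (M ^ (n * i + p i)))))"
      by (intro sum.cong prod.cong arg_cong2[where f = "(*)"] refl) (auto simp: X_def dest: permutes_in_image)
    finally show ?thesis unfolding to_fract_sum prod_monom[OF finite_atLeastLessThan] sg .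
  qed
  \<comment> \<open>The diagonal term of the Leibniz expansion has a weight shared by no other
    permutation, so its coefficient is 1 in every characteristic.\<close>
  moreover have "?P \<noteq> 0"
  proof
    assume z: "?P = 0"
    let ?W = "\<lambda>p. \<Sum>i=0..<n. M ^ (n * i + p i)"
    \<comment> \<open>Equal weights mean equal sets of positions \<open>n * a + p a\<close>. Each
      diagonal position \<open>n * i + i\<close> must then occur for \<open>p\<close>, and division
      by \<open>n\<close> gives \<open>a = i\<close> and \<open>p i = i\<close>.\<close>
    have "p = id" if p: "p permutes {0..<n}" and W: "?W p = ?W id" for p
    proof (rule ext)
      have bound: "n * i + q i < n * n" if "q permutes {0..<n}" "i \<in> {0..<n}" for q i
      proof -
        have "q i < n" using permutes_in_image[OF that(1), of i] that(2) by simp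
        moreover have "n * Suc i \<le> n * n" using that(2) by (intro mult_le_mono2) auto
        ultimately show ?thesis by simp
      qed
      fix i
      show "p i = id i"
      proof (cases "i < n")
        case True
        have "card {a\<in>{0..<n}. n * a + p a = n * i + i} = card {a\<in>{0..<n}. n * a + id a = n * i + i}"
          by (rule weight_unique[of _ M _ "n * n"])
            (use bound[OF p] bound[OF permutes_id] W in \<open>auto simp: M_def\<close>)
        moreover have "i \<in> {a\<in>{0..<n}. n * a + id a = n * i + i}" using True by auto
        then have "card {a\<in>{0..<n}. n * a + id a = n * i + i} > 0" by (auto simp: card_gt_0_iff)
        ultimately have "{a\<in>{0..<n}. n * a + p a = n * i + i} \<noteq> {}" by (metis card.empty less_irrefl)
        then obtain a where a: "a < n" "n * a + p a = n * i + i" by auto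
        have pa: "p a < n" using permutes_in_image[OF p, of a] a(1) by simp
        have "a = i" using arg_cong[OF a(2), of "\<lambda>x. x div n"] pa True by simp
        then show ?thesis using a(2) by simp
      next
        case False
        then show ?thesis using permutes_not_in[OF p, of i] by simp
      qed
    qed
    then have "{p. p permutes {0..<n} \<and> ?W p = ?W id} = {id}" by (auto intro: permutes_id)
    moreover have "coeff ?P (?W id) = (\<Sum>p\<in>{p. p permutes {0..<n}}. if ?W p = ?W id then of_int (sign p) else 0)"
      by (simp add: coeff_sum)
    moreover have "\<dots> = (\<Sum>p\<in>{p. p permutes {0..<n} \<and> ?W p = ?W id}. of_int (sign p))"
      by (subst sum.inter_filter[symmetric]) (auto simp: finite_permutations)
    ultimately have "coeff ?P (?W id) = 1" by simp
    then show False unfolding z by simp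
  qed
  ultimately have "det X \<noteq> 0" by (simp only: to_fract_eq_0_iff not_False_eq_True)
  then show ?thesis using inj by (intro exI[of _ X]) (auto simp: X_def)
qed

end

definition eval_at ::
  "nat \<Rightarrow> (nat \<Rightarrow> 'v \<Rightarrow> 'k::field) \<Rightarrow> nat list \<Rightarrow> 'k poly fract mat \<Rightarrow> (('v list \<Rightarrow>\<^sub>0 'k) set set list \<Rightarrow>\<^sub>0 'k) set \<Rightarrow> 'k poly fract" where
  "eval_at n c lam X = eval_form const_fract lam (row_form const_fract n c X)"

text \<open>The carrier of the Schur functor in basis-free form; \<open>schur_carrier\<close>
  identifies it with the carrier obtained from any spanning family.\<close>

definition schur_span :: "nat list \<Rightarrow> ('k::field, 'v, 'g) rep \<Rightarrow> (('v list \<Rightarrow>\<^sub>0 'k) set set list \<Rightarrow>\<^sub>0 'k) set set" where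
  "schur_span lam V = lspan (sym_multi lam V) (col_alt lam V ` {u. \<forall>b\<in>diagram lam. u b \<in> carrier V})"

context coord_rep
begin

lemma eval_at_lin: "lin_form const_fract (sym_multi lam V) (eval_at n c lam X)"
  unfolding eval_at_def by (rule eval_lin[OF const_fract_hom])

lemma col_alt_image: "col_alt lam V ` {u. \<forall>b\<in>diagram lam. u b \<in> carrier V} \<subseteq> carrier (sym_multi lam V)"
  using col_alt_carrier by blast

lemma schur_span_submodule: "LinearCombinations.submodule class_ring (schur_span lam V) (sym_multi lam V)"
  unfolding schur_span_def by (rule span_submodule[OF multi_module col_alt_image])

lemma schur_span_subset: "schur_span lam V \<subseteq> carrier (sym_multi lam V)"
  by (rule submoduleD(1)[OF schur_span_submodule])

lemma schur_span_basis:
  "schur_span lam V = lspan (sym_multi lam V) (polytabloid lam V m ` tableaux lam {..<n})"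
  using schur_carrier[OF m_image m_span, of lam] unfolding schur_span_def schur_def by simp

definition action_mat :: "'g \<Rightarrow> 'k mat" where
  "action_mat g = mat n n (\<lambda>(j, k). c j (act V g (m k)))"

lemma action_mat_mult:
  assumes g: "g \<in> carrier G" and g': "g' \<in> carrier G"
  shows "action_mat (g \<otimes>\<^bsub>G\<^esub> g') = action_mat g * action_mat g'"
proof (rule eq_matI)
  note r = representationD[OF rep]
  fix j k assume "j < dim_row (action_mat g * action_mat g')" "k < dim_col (action_mat g * action_mat g')"
  then have jk: "j < n" "k < n" by (auto simp: action_mat_def)
  have "c j (act V g x) = (\<Sum>i<n. c j (act V g (m i)) * c i x)" if x: "x \<in> carrier V" for x
  proof (rule lin_form_eq_on_span[OF rep_module m_image])
    show "lin_form (\<lambda>x. x) V (\<lambda>x. c j (act V g x))"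
      using lin_formD[OF c_lin[OF jk(1)]] r g by (simp add: lin_form_def)
    show "lin_form (\<lambda>x. x) V (\<lambda>x. \<Sum>i<n. c j (act V g (m i)) * c i x)"
      by (rule lin_form_sum) (use c_lin in auto)
    fix s assume "s \<in> m ` {..<n}"
    then obtain k where k: "s = m k" "k < n" by auto
    have "(\<Sum>i<n. c j (act V g (m i)) * c i s) = (\<Sum>i<n. if i = k then c j (act V g (m k)) else 0)"
      by (rule sum.cong) (use k in \<open>auto simp: c_m\<close>)
    then show "c j (act V g s) = (\<Sum>i<n. c j (act V g (m i)) * c i s)" using k by simp
  qed (use x m_span in auto)
  then have "c j (act V g (act V g' (m k))) = (\<Sum>i<n. c j (act V g (m i)) * c i (act V g' (m k)))"
    using r(4)[OF g' m_carrier[OF jk(2)]] by blast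
  then show "action_mat (g \<otimes>\<^bsub>G\<^esub> g') $$ (j, k) = (action_mat g * action_mat g') $$ (j, k)"
    using jk r(8)[OF g g' m_carrier] by (simp add: action_mat_def scalar_prod_def atLeast0LessThan)
qed (simp_all add: action_mat_def)

lemma action_mat_one: "action_mat \<one>\<^bsub>G\<^esub> = 1\<^sub>m n"
  by (rule eq_matI) (auto simp: action_mat_def representationD(7)[OF rep] m_carrier c_m)

text \<open>Row \<open>i\<close> of X, composed as a linear form with the action of
  \<open>g\<close>, is row \<open>i\<close> of X times the action matrix. The bound on the length of
  \<open>lam\<close> ensures that every row of the diagram has a row of X.\<close>

lemma eval_at_act:
  assumes g: "g \<in> carrier G" and X: "X \<in> carrier_mat n n" and len: "length lam \<le> n"
    and z: "z \<in> carrier (sym_multi lam V)"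
  shows "eval_at n c lam X (act (sym_multi lam V) g z) =
    eval_at n c lam (X * map_mat const_fract (action_mat g)) z"
proof -
  let ?R = "map_mat const_fract (action_mat g)"
  note hom = const_fract_hom
  interpret \<iota>: comm_ring_hom "const_fract :: 'k \<Rightarrow> _" by (rule hom)
  note r = representationD[OF rep]
  have "row_form const_fract n c X i (act V g x) = row_form const_fract n c (X * ?R) i x"
    if i: "i < length lam" and x: "x \<in> carrier V" for i x
  proof (rule lin_form_eq_on_span[OF rep_module m_image])
    show "lin_form const_fract V (\<lambda>x. row_form const_fract n c X i (act V g x))"
      using lin_formD[OF row_form_lin[OF hom]] r g by (simp add: lin_form_def)
    fix s assume "s \<in> m ` {..<n}"
    then obtain k where k: "s = m k" "k < n" by auto
    have "row_form const_fract n c (X * ?R) i s = (X * ?R) $$ (i, k)"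
      unfolding k(1) by (rule row_form_m[OF hom k(2)])
    also have "\<dots> = (\<Sum>j<n. X $$ (i, j) * const_fract (c j (act V g (m k))))"
      using X i len k(2) by (simp add: scalar_prod_def atLeast0LessThan action_mat_def)
    finally show "row_form const_fract n c X i (act V g s) = row_form const_fract n c (X * ?R) i s"
      by (simp add: row_form_def k(1))
  qed (use row_form_lin[OF hom] x m_span in auto)
  then show ?thesis unfolding eval_at_def
    by (intro eval_form_act[OF hom row_form_lin[OF hom] row_form_lin[OF hom] g _ z]) auto
qed

end

section \<open>Complementary partitions and dual representations\<close>

text \<open>Both shapes are described by exactly \<open>s\<close> columns, some possibly empty,
  which is why the power of det X is the same for all elements. The actions on V and W are not yet
  related, so the two sides can be interchanged freely.\<close>

locale dual_coord_reps = V: coord_rep G V n m c + W: coord_rep G W n o' d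
  for G :: "('g, 'c) monoid_scheme" and V :: "('k::field, 'v, 'g) rep" and W :: "('k, 'w, 'g) rep"
    and n m c o' d +
  fixes lam mu :: "nat list" and s :: nat and h :: "nat \<Rightarrow> nat"
  assumes lam: "diagram lam = {(i, j). j < s \<and> i < h j}"
    and mu: "diagram mu = {(i, j). j < s \<and> i < n - h (s - 1 - j)}"
    and h_le: "\<And>j. j < s \<Longrightarrow> h j \<le> n"
    and len_lam: "length lam \<le> n" and len_mu: "length mu \<le> n"
begin

text \<open>The value is a product of minors, one for each column. A repeated entry in a column
  makes it zero, and zero corresponds to zero; otherwise each minor is traded for its complementary
  one at the price of a sign and a factor det X.\<close>

lemma transfer_polytabloid:
  assumes t: "t \<in> tableaux lam {..<n}"
  shows "\<exists>z'\<in>schur_span mu W. \<forall>X Y. dual_mats n X Y \<longrightarrow>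
    eval_at n c lam X (polytabloid lam V m t) = det X ^ s * eval_at n d mu Y z'"
proof -
  note hom = const_fract_hom
  interpret \<iota>: comm_ring_hom "const_fract :: 'k \<Rightarrow> _" by (rule hom)
  have tn: "t b < n" if "b \<in> diagram lam" for b using t that by (auto simp: tableaux_def)
  have ev: "eval_at n c lam X (polytabloid lam V m t) = (\<Prod>j<s. minor (h j) X (\<lambda>i. t (i, j)))" for X
    unfolding eval_at_def polytabloid_eq by (rule V.eval_col_alt[OF hom lam tn])
  show ?thesis
  proof (cases "\<forall>j<s. inj_on (\<lambda>i. t (i, j)) {0..<h j}")
    case False
    then obtain j where "j < s" "\<not> inj_on (\<lambda>i. t (i, j)) {0..<h j}" by auto
    then have "(\<Prod>j<s. minor (h j) X (\<lambda>i. t (i, j))) = 0" for X :: "'k poly fract mat"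
      using minor_not_inj[of "\<lambda>i. t (i, j)" "h j" X] by (intro prod_zero) auto
    then show ?thesis
      using submoduleD(2)[OF W.schur_span_submodule] lin_form_zero[OF W.multi_module W.eval_at_lin]
      by (intro bexI[of _ "\<zero>\<^bsub>sym_multi mu W\<^esub>"]) (simp_all add: ev)
  next
    case True
    have "\<exists>b \<epsilon>. b ` {0..<n - h j} \<subseteq> {0..<n} \<and>
      (\<forall>X Y :: 'k poly fract mat. dual_mats n X Y \<longrightarrow> minor (h j) X (\<lambda>i. t (i, j)) = of_int \<epsilon> * det X * minor (n - h j) Y b)"
      if j: "j < s" for j
    proof -
      have "(\<lambda>i. t (i, j)) ` {0..<h j} \<subseteq> {0..<n}" using tn j lam by auto
      from minor_dual[OF True[rule_format, OF j] this h_le[OF j], where 'l = "'k poly fract"] show ?thesis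
        by metis
    qed
    then obtain b \<epsilon> where b: "\<And>j. j < s \<Longrightarrow> b j ` {0..<n - h j} \<subseteq> {0..<n}"
      and \<epsilon>: "\<And>j (X :: 'k poly fract mat) Y. j < s \<Longrightarrow> dual_mats n X Y \<Longrightarrow>
        minor (h j) X (\<lambda>i. t (i, j)) = of_int (\<epsilon> j) * det X * minor (n - h j) Y (b j)"
      by metis
    \<comment> \<open>The complement is turned by 180 degrees, so column \<open>j\<close> of the new
      tableau is filled from column \<open>s - 1 - j\<close> of the old one.\<close>
    define t' where "t' = (\<lambda>(i, j). b (s - 1 - j) i)"
    have t'n: "t' x < n" if x: "x \<in> diagram mu" for x
    proof -
      obtain i j where ij: "x = (i, j)" "j < s" "i < n - h (s - 1 - j)" using x mu by auto
      have "b (s - 1 - j) i \<in> b (s - 1 - j) ` {0..<n - h (s - 1 - j)}" using ij by auto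
      moreover have "s - 1 - j < s" using ij(2) by simp
      ultimately have "b (s - 1 - j) i \<in> {0..<n}" using b by blast
      then show ?thesis by (simp add: t'_def ij(1))
    qed
    let ?e = "\<Prod>j<s. \<epsilon> j" and ?z = "col_alt mu W (\<lambda>x. o' (t' x))"
    have zc: "?z \<in> carrier (sym_multi mu W)"
      by (rule W.col_alt_carrier) (use t'n W.m_carrier in auto)
    have z: "?z \<in> schur_span mu W"
      unfolding schur_span_def by (rule span_mem[OF W.multi_module W.col_alt_image]) (use t'n W.m_carrier in auto)
    have "eval_at n c lam X (polytabloid lam V m t) = det X ^ s * eval_at n d mu Y (of_int ?e \<odot>\<^bsub>sym_multi mu W\<^esub> ?z)"
      if dual: "dual_mats n X Y" for X Y
    proof -
      have evz: "eval_at n d mu Y ?z = (\<Prod>j<s. minor (n - h (s - 1 - j)) Y (\<lambda>i. t' (i, j)))"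
        unfolding eval_at_def by (rule W.eval_col_alt[OF hom mu t'n])
      also have "\<dots> = (\<Prod>j<s. minor (n - h (s - 1 - j)) Y (b (s - 1 - j)))"
        by (simp add: t'_def)
      also have "\<dots> = (\<Prod>j<s. minor (n - h j) Y (b j))"
        by (rule prod.reindex_bij_witness[of _ "\<lambda>j. s - 1 - j" "\<lambda>j. s - 1 - j"]) auto
      finally have evz: "eval_at n d mu Y ?z = (\<Prod>j<s. minor (n - h j) Y (b j))" .
      have "const_fract (of_nat k :: 'k) = of_nat k" for k
        by (induction k) (simp_all only: of_nat_Suc of_nat_0 \<iota>.hom_zero \<iota>.hom_one \<iota>.hom_add)
      then have oi: "const_fract (of_int k :: 'k) = of_int k" for k
        by (cases k rule: int_cases2) (simp_all only: of_int_of_nat_eq of_int_minus \<iota>.hom_uminus)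
      have "eval_at n c lam X (polytabloid lam V m t) = (\<Prod>j<s. of_int (\<epsilon> j) * det X * minor (n - h j) Y (b j))"
        unfolding ev by (rule prod.cong) (use \<epsilon> dual in auto)
      also have "\<dots> = det X ^ s * (of_int ?e * (\<Prod>j<s. minor (n - h j) Y (b j)))"
        by (simp add: prod.distrib mult_ac)
      also have "\<dots> = det X ^ s * eval_at n d mu Y (of_int ?e \<odot>\<^bsub>sym_multi mu W\<^esub> ?z)"
        unfolding lin_formD(2)[OF W.eval_at_lin zc] evz oi ..
      finally show ?thesis .
    qed
    then show ?thesis using submoduleD(4)[OF W.schur_span_submodule z] by blast
  qed
qed

lemma transfer:
  assumes z: "z \<in> schur_span lam V"
  shows "\<exists>z'\<in>schur_span mu W. \<forall>X Y. dual_mats n X Y \<longrightarrow>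
    eval_at n c lam X z = det X ^ s * eval_at n d mu Y z'"
proof -
  note sub = submoduleD[OF W.schur_span_submodule[of mu]]
  have R: "polytabloid lam V m ` tableaux lam {..<n} \<subseteq> carrier (sym_multi lam V)"
  proof clarify
    fix t assume "t \<in> tableaux lam {..<n}"
    then have "t b < n" if "b \<in> diagram lam" for b using that by (auto simp: tableaux_def)
    then show "polytabloid lam V m t \<in> carrier (sym_multi lam V)"
      unfolding polytabloid_eq by (intro V.col_alt_carrier V.m_carrier)
  qed
  note z' = z[unfolded V.schur_span_basis]
  show ?thesis
  proof (rule span_induct[OF V.multi_module R z'])
    show "\<exists>z'\<in>schur_span mu W. \<forall>X Y. dual_mats n X Y \<longrightarrow>
      eval_at n c lam X \<zero>\<^bsub>sym_multi lam V\<^esub> = det X ^ s * eval_at n d mu Y z'"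
      using sub(2) lin_form_zero[OF W.multi_module W.eval_at_lin] lin_form_zero[OF V.multi_module V.eval_at_lin]
      by (intro bexI[of _ "\<zero>\<^bsub>sym_multi mu W\<^esub>"]) simp_all
  next
    fix x y assume x: "x \<in> carrier (sym_multi lam V)" and y: "y \<in> carrier (sym_multi lam V)"
      and "\<exists>z'\<in>schur_span mu W. \<forall>X Y. dual_mats n X Y \<longrightarrow> eval_at n c lam X x = det X ^ s * eval_at n d mu Y z'"
      and "\<exists>z'\<in>schur_span mu W. \<forall>X Y. dual_mats n X Y \<longrightarrow> eval_at n c lam X y = det X ^ s * eval_at n d mu Y z'"
    then obtain x' y' where xy: "x' \<in> schur_span mu W" "y' \<in> schur_span mu W"
      "\<And>X Y. dual_mats n X Y \<Longrightarrow> eval_at n c lam X x = det X ^ s * eval_at n d mu Y x'"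
      "\<And>X Y. dual_mats n X Y \<Longrightarrow> eval_at n c lam X y = det X ^ s * eval_at n d mu Y y'"
      by blast
    then show "\<exists>z'\<in>schur_span mu W. \<forall>X Y. dual_mats n X Y \<longrightarrow>
      eval_at n c lam X (x \<oplus>\<^bsub>sym_multi lam V\<^esub> y) = det X ^ s * eval_at n d mu Y z'"
      using sub(1,3) x y
      by (intro bexI[of _ "x' \<oplus>\<^bsub>sym_multi mu W\<^esub> y'"])
        (auto simp: lin_formD(1)[OF V.eval_at_lin] lin_formD(1)[OF W.eval_at_lin] distrib_left subset_iff)
  next
    fix a x assume x: "x \<in> carrier (sym_multi lam V)"
      and "\<exists>z'\<in>schur_span mu W. \<forall>X Y. dual_mats n X Y \<longrightarrow> eval_at n c lam X x = det X ^ s * eval_at n d mu Y z'"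
    then obtain x' where xy: "x' \<in> schur_span mu W"
      "\<And>X Y. dual_mats n X Y \<Longrightarrow> eval_at n c lam X x = det X ^ s * eval_at n d mu Y x'"
      by blast
    then show "\<exists>z'\<in>schur_span mu W. \<forall>X Y. dual_mats n X Y \<longrightarrow>
      eval_at n c lam X (a \<odot>\<^bsub>sym_multi lam V\<^esub> x) = det X ^ s * eval_at n d mu Y z'"
      using sub(1,4) x
      by (intro bexI[of _ "a \<odot>\<^bsub>sym_multi mu W\<^esub> x'"])
        (auto simp: lin_formD(2)[OF V.eval_at_lin] lin_formD(2)[OF W.eval_at_lin] mult_ac subset_iff)
  qed (use transfer_polytabloid in blast)
qed

end

text \<open>Comparing values only at matrices with a dual loses nothing, because the separating
  matrix has nonzero determinant and hence a dual.\<close>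

lemma (in coord_rep) eval_at_eqI:
  assumes len: "length lam \<le> n" and z: "z \<in> carrier (sym_multi lam V)" "z' \<in> carrier (sym_multi lam V)"
    and eq: "\<And>X Y. dual_mats n X Y \<Longrightarrow> eval_at n c lam X z = eval_at n c lam X z'"
  shows "z = z'"
proof -
  interpret M: Module.module class_ring "sym_multi lam V" by (rule multi_module)
  obtain X :: "'k poly fract mat" where X: "X \<in> carrier_mat n n" "det X \<noteq> 0"
    "\<And>z. z \<in> carrier (sym_multi lam V) \<Longrightarrow> eval_at n c lam X z = 0 \<Longrightarrow> z = \<zero>\<^bsub>sym_multi lam V\<^esub>"
    using eval_separates[OF len] unfolding eval_at_def by blast
  obtain Y where "dual_mats n X Y" using dual_mats_exists[OF X(1,2)] by blast
  then have "eval_at n c lam X (z \<ominus>\<^bsub>sym_multi lam V\<^esub> z') = 0"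
    using lin_form_minus[OF multi_module eval_at_lin z] eq by simp
  then have "z \<ominus>\<^bsub>sym_multi lam V\<^esub> z' = \<zero>\<^bsub>sym_multi lam V\<^esub>"
    using X(3) z by simp
  then show ?thesis using z by simp
qed

text \<open>The image of \<open>z\<close> is defined as the only element with the prescribed values,
  which exists by \<open>transfer\<close>. It is unique because det X is nonzero and evaluation
  separates elements. Every property of the map then follows by checking the defining equation for a
  candidate.\<close>

theorem schur_complement_isomorphic:
  fixes V :: "('k::field, 'v, 'g) rep" and W :: "('k, 'w, 'g) rep"
  assumes "dual_coord_reps G V W n m c o' d lam mu s h"
    and dual: "\<And>g. g \<in> carrier G \<Longrightarrow>
      coord_rep.action_mat V n m c g * transpose_mat (coord_rep.action_mat W n o' d g) = 1\<^sub>m n"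
    and det: "\<And>g. g \<in> carrier G \<Longrightarrow> det (coord_rep.action_mat V n m c g) = 1"
    and v: "v ` B \<subseteq> carrier V" "lspan V (v ` B) = carrier V"
    and w: "w ` C \<subseteq> carrier W" "lspan W (w ` C) = carrier W"
  shows "rep_isomorphic G (schur lam V B v) (schur mu W C w)"
proof -
  interpret dual_coord_reps G V W n m c o' d lam mu s h by fact
  \<comment> \<open>Complementing twice restores the column lengths, since
    \<open>h j \<le> n\<close>; so the transfer is also available from W to V.\<close>
  interpret swap: dual_coord_reps G W V n o' d m c mu lam s "\<lambda>j. n - h (s - 1 - j)"
  proof
    show "diagram lam = {(i, j). j < s \<and> i < n - (n - h (s - 1 - (s - 1 - j)))}"
      using lam h_le by auto
  qed (use mu len_lam len_mu in auto)
  let ?S = "schur_span lam V" and ?T = "schur_span mu W"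
  let ?P = "\<lambda>z z'. z' \<in> ?T \<and> (\<forall>X Y. dual_mats n X Y \<longrightarrow> eval_at n c lam X z = det X ^ s * eval_at n d mu Y z')"
  have nz: "det X \<noteq> 0" "det Y \<noteq> 0" if "dual_mats n X Y" for X Y :: "'k poly fract mat"
    using dual_mats_det[OF that] by auto
  have unique: "z' = z''" if "?P z z'" "?P z z''" for z z' z''
  proof (rule W.eval_at_eqI[OF len_mu])
    show "z' \<in> carrier (sym_multi mu W)" "z'' \<in> carrier (sym_multi mu W)" using that W.schur_span_subset by auto
    fix Y X :: "'k poly fract mat" assume "dual_mats n Y X"
    then have d: "dual_mats n X Y" by (rule dual_mats_sym)
    then have "det X ^ s * eval_at n d mu Y z' = det X ^ s * eval_at n d mu Y z''" using that by metis
    then show "eval_at n d mu Y z' = eval_at n d mu Y z''" using nz(1)[OF d] by simp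
  qed
  define \<phi> where "\<phi> z = (THE z'. ?P z z')" for z
  have \<phi>: "?P z (\<phi> z)" if z: "z \<in> ?S" for z
  proof -
    obtain z' where p: "?P z z'" using transfer[OF z] by blast
    show ?thesis unfolding \<phi>_def by (rule theI[where P = "?P z", OF p unique[OF _ p]])
  qed
  have \<phi>_eq: "\<phi> z = z'" if "?P z z'" for z z'
    unfolding \<phi>_def by (rule the_equality[where P = "?P z", OF that unique[OF _ that]])
  have SV: "schur lam V B v = (sym_multi lam V)\<lparr>carrier := ?S\<rparr>"
    using V.schur_carrier[OF v, of lam] by (simp add: schur_def schur_span_def)
  have SW: "schur mu W C w = (sym_multi mu W)\<lparr>carrier := ?T\<rparr>"
    using W.schur_carrier[OF w, of mu] by (simp add: schur_def schur_span_def)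
  note rV = V.schur_rep[OF v, of lam] and rW = W.schur_rep[OF w, of mu]
  note subS = submoduleD[OF V.schur_span_submodule[of lam]] and subT = submoduleD[OF W.schur_span_submodule[of mu]]
  have "\<phi> (x \<oplus>\<^bsub>sym_multi lam V\<^esub> y) = \<phi> x \<oplus>\<^bsub>sym_multi mu W\<^esub> \<phi> y" if "x \<in> ?S" "y \<in> ?S" for x y
  proof (rule \<phi>_eq)
    have "x \<in> carrier (sym_multi lam V)" "y \<in> carrier (sym_multi lam V)"
      "\<phi> x \<in> carrier (sym_multi mu W)" "\<phi> y \<in> carrier (sym_multi mu W)"
      using that \<phi> subS(1) subT(1) by blast+
    then show "?P (x \<oplus>\<^bsub>sym_multi lam V\<^esub> y) (\<phi> x \<oplus>\<^bsub>sym_multi mu W\<^esub> \<phi> y)"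
      using \<phi>[OF that(1)] \<phi>[OF that(2)] subT(3)
      by (simp add: lin_formD(1)[OF V.eval_at_lin] lin_formD(1)[OF W.eval_at_lin] distrib_left)
  qed
  moreover have "\<phi> (a \<odot>\<^bsub>sym_multi lam V\<^esub> x) = a \<odot>\<^bsub>sym_multi mu W\<^esub> \<phi> x" if "x \<in> ?S" for a x
  proof (rule \<phi>_eq)
    have "x \<in> carrier (sym_multi lam V)" "\<phi> x \<in> carrier (sym_multi mu W)"
      using that \<phi> subS(1) subT(1) by blast+
    then show "?P (a \<odot>\<^bsub>sym_multi lam V\<^esub> x) (a \<odot>\<^bsub>sym_multi mu W\<^esub> \<phi> x)"
      using \<phi>[OF that] subT(4)
      by (simp add: lin_formD(2)[OF V.eval_at_lin] lin_formD(2)[OF W.eval_at_lin] mult.left_commute)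
  qed
  moreover have "\<phi> x \<in> ?T" if "x \<in> ?S" for x using \<phi>[OF that] by blast
  ultimately have lin: "linear_map class_ring (schur lam V B v) (schur mu W C w) \<phi>"
    using representationD(2,3)[OF rV] representationD(2,3)[OF rW]
    unfolding linear_map_def mod_hom_def mod_hom_axioms_def LinearCombinations.module_hom_def SV SW by auto
  \<comment> \<open>The image of \<open>x\<close> determines the values of \<open>x\<close> at all
    matrices with a dual, hence \<open>x\<close> itself.\<close>
  have "inj_on \<phi> ?S"
  proof (rule inj_onI)
    fix x y assume xy: "x \<in> ?S" "y \<in> ?S" "\<phi> x = \<phi> y"
    show "x = y"
      by (rule V.eval_at_eqI[OF len_lam]) (use xy \<phi>[OF xy(1)] \<phi>[OF xy(2)] subS(1) in auto)
  qed
  moreover have "z' \<in> \<phi> ` ?S" if z': "z' \<in> ?T" for z'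
  proof -
    obtain z where z: "z \<in> ?S" "\<And>X Y. dual_mats n Y X \<Longrightarrow> eval_at n d mu Y z' = det Y ^ s * eval_at n c lam X z"
      using swap.transfer[OF z'] by blast
    \<comment> \<open>The transfer back produces the factor det Y ^ s, whereas a preimage needs 1 /
      det X ^ s. Their quotient is (det X * det Y) ^ s, a constant of the ground field, by which the
      element is rescaled.\<close>
    define \<delta> :: 'k where "\<delta> = det (anti_mat n) ^ s"
    have detXY: "det X * det Y = const_fract (det (anti_mat n))" if "dual_mats n X Y" for X Y :: "'k poly fract mat"
    proof -
      interpret \<iota>: comm_ring_hom "const_fract :: 'k \<Rightarrow> _" by (rule const_fract_hom)
      have "map_mat const_fract (anti_mat n :: 'k mat) = anti_mat n"
        by (rule eq_matI) (auto simp: anti_mat_def)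
      then have "const_fract (det (anti_mat n :: 'k mat)) = det (anti_mat n)"
        using \<iota>.hom_det[of "anti_mat n"] by simp
      moreover have "det X * det Y = det (anti_mat n)"
        using that det_mult[of X n "transpose_mat Y"] det_transpose[of Y n] by (auto simp: dual_mats_def)
      ultimately show ?thesis by simp
    qed
    have "\<phi> (\<delta> \<odot>\<^bsub>sym_multi lam V\<^esub> z) = z'"
    proof (rule \<phi>_eq, intro conjI allI impI z')
      fix X Y :: "'k poly fract mat" assume XY: "dual_mats n X Y"
      interpret \<iota>: comm_ring_hom "const_fract :: 'k \<Rightarrow> _" by (rule const_fract_hom)
      have "eval_at n c lam X (\<delta> \<odot>\<^bsub>sym_multi lam V\<^esub> z) = const_fract \<delta> * eval_at n c lam X z"
        using z(1) subS(1) by (intro lin_formD(2)[OF V.eval_at_lin]) auto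
      also have "\<dots> = (det X * det Y) ^ s * eval_at n c lam X z"
        unfolding detXY[OF XY] \<delta>_def by (simp add: \<iota>.hom_power)
      also have "\<dots> = det X ^ s * eval_at n d mu Y z'"
        unfolding z(2)[OF dual_mats_sym[OF XY]] by (simp add: power_mult_distrib)
      finally show "eval_at n c lam X (\<delta> \<odot>\<^bsub>sym_multi lam V\<^esub> z) = det X ^ s * eval_at n d mu Y z'" .
    qed
    then show ?thesis using subS(4)[OF z(1)] by blast
  qed
  ultimately have bij: "bij_betw \<phi> (carrier (schur lam V B v)) (carrier (schur mu W C w))"
    unfolding SV SW using \<phi> by (auto simp: bij_betw_def)
  have "\<phi> (act (schur lam V B v) g x) = act (schur mu W C w) g (\<phi> x)"
    if g: "g \<in> carrier G" and x: "x \<in> carrier (schur lam V B v)" for g x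
  proof -
    interpret \<iota>: comm_ring_hom "const_fract :: 'k \<Rightarrow> _" by (rule const_fract_hom)
    have xS: "x \<in> ?S" using x by (simp add: SV)
    have \<phi>T: "\<phi> x \<in> ?T" using \<phi>[OF xS] by blast
    have gx: "act (sym_multi lam V) g x \<in> ?S" using representationD(4)[OF rV g x] by (simp add: SV)
    have g\<phi>: "act (sym_multi mu W) g (\<phi> x) \<in> ?T" using representationD(4)[OF rW g, of "\<phi> x"] \<phi>T by (simp add: SW)
    let ?R = "V.action_mat g" and ?S' = "W.action_mat g"
    let ?R' = "map_mat const_fract ?R" and ?S'' = "map_mat const_fract ?S'"
    have "map_mat const_fract (?R * transpose_mat ?S') = ?R' * map_mat const_fract (transpose_mat ?S')"
      by (rule \<iota>.mat_hom_mult[of _ n n _ n]) (auto simp: V.action_mat_def W.action_mat_def)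
    moreover have "map_mat const_fract (transpose_mat ?S') = transpose_mat ?S''"
      by (rule eq_matI) auto
    moreover have "map_mat const_fract (1\<^sub>m n :: 'k mat) = 1\<^sub>m n"
      by (rule \<iota>.mat_hom_one)
    ultimately have RS: "?R' * transpose_mat ?S'' = 1\<^sub>m n" using dual[OF g] by simp
    have detR: "det ?R' = 1" using \<iota>.hom_det[of ?R] det[OF g] by simp
    have "\<phi> (act (sym_multi lam V) g x) = act (sym_multi mu W) g (\<phi> x)"
    proof (rule \<phi>_eq, intro conjI allI impI g\<phi>)
      fix X Y :: "'k poly fract mat" assume XY: "dual_mats n X Y"
      then have cX: "X \<in> carrier_mat n n" "Y \<in> carrier_mat n n" by (auto simp: dual_mats_def)
      \<comment> \<open>Moving the group element from the argument to the matrices replaces X and Y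
        by another dual pair, at which the defining equation of \<open>\<phi> x\<close> applies.
        Determinant 1 of the action then restores the factor det X ^ s.\<close>
      have d: "dual_mats n (X * ?R') (Y * ?S'')" by (rule dual_mats_mult[OF XY _ _ RS]) (auto simp: V.action_mat_def W.action_mat_def)
      have "eval_at n c lam X (act (sym_multi lam V) g x) = eval_at n c lam (X * ?R') x"
        by (rule V.eval_at_act[OF g cX(1) len_lam]) (use xS subS(1) in auto)
      also have "\<dots> = det (X * ?R') ^ s * eval_at n d mu (Y * ?S'') (\<phi> x)" using \<phi>[OF xS] d by blast
      also have "det (X * ?R') = det X" using det_mult[OF cX(1), of ?R'] detR by (simp add: V.action_mat_def)
      also have "eval_at n d mu (Y * ?S'') (\<phi> x) = eval_at n d mu Y (act (sym_multi mu W) g (\<phi> x))"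
        by (rule W.eval_at_act[OF g cX(2) len_mu, symmetric]) (use \<phi>T subT(1) in auto)
      finally show "eval_at n c lam X (act (sym_multi lam V) g x) = det X ^ s * eval_at n d mu Y (act (sym_multi mu W) g (\<phi> x))" .
    qed
    then show ?thesis by (simp add: SV SW)
  qed
  then show ?thesis unfolding rep_isomorphic_def using rV rW lin bij by blast
qed

section \<open>Column lengths of a partition and of its complement\<close>

lemma sorted_filter_nonzero:
  "sorted_wrt (\<ge>) L \<Longrightarrow> filter (\<lambda>p. p \<noteq> 0) L = takeWhile (\<lambda>p. p \<noteq> (0::nat)) L"
  by (induction L) (auto simp: filter_empty_conv)

text \<open>The zeros of a weakly decreasing list stand at its end and contribute no boxes, so
  deleting them neither shifts rows nor changes the diagram.\<close>

lemma diagram_takeWhile: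
  assumes "sorted_wrt (\<ge>) L"
  shows "diagram (takeWhile (\<lambda>p. p \<noteq> 0) L) = {(i, j). i < length L \<and> j < L ! i}"
proof -
  let ?k = "length (takeWhile (\<lambda>p. p \<noteq> 0) L)"
  have k: "?k \<le> length L" by (rule length_takeWhile_le)
  have zero: "L ! i = 0" if "?k \<le> i" "i < length L" for i
  proof -
    have "L ! ?k = 0" using nth_length_takeWhile[of "\<lambda>p. p \<noteq> 0" L] that by simp
    moreover have "L ! i \<le> L ! ?k" using that sorted_wrt_nth_less[OF assms, of ?k i] by (cases "?k = i") auto
    ultimately show ?thesis by simp
  qed
  have "i < ?k" if "i < length L" "j < L ! i" for i j
  proof (rule ccontr)
    assume "\<not> i < ?k"
    then have "L ! i = 0" using that(1) by (intro zero) auto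
    then show False using that(2) by simp
  qed
  then show ?thesis using k by (auto simp: diagram_def takeWhile_nth)
qed

context
  fixes lam :: "nat list" and n s :: nat
  assumes lam: "is_partition lam" and len: "length lam \<le> n" and first: "nth_default 0 lam 0 \<le> s"
begin

text \<open>The parts of the conjugate partition. The set is finite although \<open>i\<close> is
  unrestricted, because parts beyond the list count as 0.\<close>

definition col_len :: "nat \<Rightarrow> nat" where
  "col_len j = card {i. j < nth_default 0 lam i}"

lemma part_mono: "i \<le> i' \<Longrightarrow> nth_default 0 lam i' \<le> nth_default 0 lam i"
proof (cases "i' < length lam")
  case True
  assume "i \<le> i'"
  with True lam show ?thesis
    by (cases "i = i'") (auto simp: nth_default_def is_partition_def sorted_wrt_iff_nth_less)
qed (simp add: nth_default_def)

text \<open>Parts decrease, so the rows of length greater than \<open>j\<close> form an initial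
  segment of the row indices, and its size is \<open>col_len j\<close>.\<close>

lemma less_col_len: "i < col_len j \<longleftrightarrow> j < nth_default 0 lam i"
proof -
  let ?S = "{i. j < nth_default 0 lam i}"
  have fin: "?S \<subseteq> {..<n}" using len by (auto simp: nth_default_def split: if_splits)
  then have finite: "finite ?S" by (rule finite_subset) simp
  show ?thesis
  proof
    assume j: "j < nth_default 0 lam i"
    have "{..i} \<subseteq> ?S" using j part_mono by (auto intro: less_le_trans)
    then have "card {..i} \<le> col_len j" unfolding col_len_def by (rule card_mono[OF finite])
    then show "i < col_len j" by simp
  next
    assume i: "i < col_len j"
    show "j < nth_default 0 lam i"
    proof (rule ccontr)
      assume "\<not> j < nth_default 0 lam i"
      have "?S \<subseteq> {..<i}"
      proof
        fix x assume "x \<in> ?S"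
        then have "\<not> i \<le> x" using part_mono[of i x] \<open>\<not> j < nth_default 0 lam i\<close> by auto
        then show "x \<in> {..<i}" by simp
      qed
      then have "col_len j \<le> i" unfolding col_len_def using card_mono[of "{..<i}" ?S] by simp
      then show False using i by simp
    qed
  qed
qed

lemma col_len_le: "col_len j \<le> n"
  using less_col_len[of n j] len by (simp add: nth_default_def)

lemma part_le: "nth_default 0 lam i \<le> s"
  using part_mono[of 0 i] first by simp

lemma diagram_columns: "diagram lam = {(i, j). j < s \<and> i < col_len j}"
proof -
  have "(i < length lam \<and> j < lam ! i) \<longleftrightarrow> j < nth_default 0 lam i" for i j
    by (simp add: nth_default_def)
  then show ?thesis using part_le by (auto simp: diagram_def less_col_len intro: less_le_trans)
qed

text \<open>A box (i, j) of the rectangle belongs to the complement exactly if its image (n - 1 - i,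
  s - 1 - j) under the half turn lies outside the original diagram; \<open>less_col_len\<close>
  turns this into a statement about columns.\<close>

lemma diagram_rect_complement:
  "diagram (rect_complement n s lam) = {(i, j). j < s \<and> i < n - col_len (s - 1 - j)}"
  and length_rect_complement: "length (rect_complement n s lam) \<le> n"
proof -
  let ?L = "rev (map (\<lambda>i. s - nth_default 0 lam i) [0..<n])"
  have L: "?L ! i = s - nth_default 0 lam (n - 1 - i)" if "i < n" for i
    using that by (simp add: rev_nth)
  have sorted: "sorted_wrt (\<ge>) ?L"
    unfolding sorted_wrt_iff_nth_less
  proof (intro allI impI)
    fix i j assume "i < j" "j < length ?L"
    then show "?L ! j \<le> ?L ! i" by (subst (1 2) L) (auto intro!: diff_le_mono2 part_mono)
  qed
  have "(i < n \<and> j < ?L ! i) \<longleftrightarrow> (j < s \<and> i < n - col_len (s - 1 - j))" for i j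
  proof (cases "i < n")
    case True
    have "j < ?L ! i \<longleftrightarrow> j < s \<and> \<not> s - 1 - j < nth_default 0 lam (n - 1 - i)"
      unfolding L[OF True] by auto
    also have "\<dots> \<longleftrightarrow> j < s \<and> \<not> n - 1 - i < col_len (s - 1 - j)" by (simp add: less_col_len)
    also have "\<dots> \<longleftrightarrow> j < s \<and> i < n - col_len (s - 1 - j)" using True col_len_le[of "s - 1 - j"] by auto
    finally show ?thesis using True by simp
  qed auto
  then show "diagram (rect_complement n s lam) = {(i, j). j < s \<and> i < n - col_len (s - 1 - j)}"
    unfolding rect_complement_def sorted_filter_nonzero[OF sorted] diagram_takeWhile[OF sorted]
    by (simp del: rev_map)
  show "length (rect_complement n s lam) \<le> n"
    unfolding rect_complement_def by (rule order_trans[OF length_filter_le]) simp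
qed

end

section \<open>Symmetric powers of the natural representation\<close>

lemma natural_rep_simps [simp]:
  "carrier (natural_rep ty n) = carrier_vec n" "zero (natural_rep ty n) = 0\<^sub>v n"
  "add (natural_rep ty n) = (+)" "module.smult (natural_rep ty n) = (\<cdot>\<^sub>v)"
  "act (natural_rep ty n) = (*\<^sub>v)"
  by (auto simp: natural_rep_def module.defs rep.defs module_vec_def)

lemma SL_simps [simp]:
  "carrier (SL ty n) = {A \<in> carrier_mat n n. det A = 1}"
  "mult (SL ty n) = (*)" "one (SL ty n) = 1\<^sub>m n"
  by (auto simp: SL_def)

lemma SL_group: "group (SL TYPE('k::field) n)"
proof (rule groupI)
  fix A :: "'k mat" assume "A \<in> carrier (SL TYPE('k) n)"
  then have A: "A \<in> carrier_mat n n" "det A = 1" by auto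
  obtain B where B: "B \<in> carrier_mat n n" "B * A = 1\<^sub>m n"
    using det_non_zero_imp_unit[OF A(1), of undefined] A(2) by (auto simp: Units_def ring_mat_def)
  have "det B = 1" using det_mult[OF B(1) A(1)] A(2) B(2) by simp
  then show "\<exists>B\<in>carrier (SL TYPE('k) n). B \<otimes>\<^bsub>SL TYPE('k) n\<^esub> A = \<one>\<^bsub>SL TYPE('k) n\<^esub>"
    using B by (intro bexI[of _ B]) auto
qed (auto simp: det_mult)

lemma natural_module: "Module.module class_ring (natural_rep TYPE('k::field) n)"
proof (rule moduleI)
  show "cring (class_ring :: 'k ring)" by (rule class_cring.cring_axioms)
  show "abelian_group (natural_rep TYPE('k) n)"
  proof (rule abelian_groupI)
    fix x assume "x \<in> carrier (natural_rep TYPE('k) n)"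
    then show "\<exists>y\<in>carrier (natural_rep TYPE('k) n). y \<oplus>\<^bsub>natural_rep TYPE('k) n\<^esub> x = \<zero>\<^bsub>natural_rep TYPE('k) n\<^esub>"
      by (intro bexI[of _ "- x"]) (auto intro: uminus_l_inv_vec)
  next
    fix x y z assume "x \<in> carrier (natural_rep TYPE('k) n)" "y \<in> carrier (natural_rep TYPE('k) n)"
      "z \<in> carrier (natural_rep TYPE('k) n)"
    then show "x \<oplus>\<^bsub>natural_rep TYPE('k) n\<^esub> y \<oplus>\<^bsub>natural_rep TYPE('k) n\<^esub> z =
        x \<oplus>\<^bsub>natural_rep TYPE('k) n\<^esub> (y \<oplus>\<^bsub>natural_rep TYPE('k) n\<^esub> z)"
      by (simp add: assoc_add_vec[of x n y z])
  next
    fix x y assume "x \<in> carrier (natural_rep TYPE('k) n)" "y \<in> carrier (natural_rep TYPE('k) n)"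
    then show "x \<oplus>\<^bsub>natural_rep TYPE('k) n\<^esub> y = y \<oplus>\<^bsub>natural_rep TYPE('k) n\<^esub> x"
      by (simp add: comm_add_vec[of x n y])
  qed simp_all
qed (simp_all add: add_smult_distrib_vec smult_add_distrib_vec[of _ n] smult_smult_assoc)

lemma natural_representation: "representation (SL TYPE('k::field) n) (natural_rep TYPE('k) n)"
  by (rule representationI[OF SL_group natural_module])
    (simp_all add: mult_mat_vec_carrier[of _ n n] mult_add_distrib_mat_vec[of _ n n] mult_mat_vec[of _ n n] assoc_mult_mat_vec[of _ n n _ n])

lemma additive_finsum:
  assumes M: "Module.module class_ring M" and N: "Module.module class_ring N"
    and f: "\<And>x. x \<in> carrier M \<Longrightarrow> f x \<in> carrier N"
      "\<And>x y. x \<in> carrier M \<Longrightarrow> y \<in> carrier M \<Longrightarrow> f (x \<oplus>\<^bsub>M\<^esub> y) = f x \<oplus>\<^bsub>N\<^esub> f y"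
    and A: "finite A" "\<And>a. a \<in> A \<Longrightarrow> z a \<in> carrier M"
  shows "f (\<Oplus>\<^bsub>M\<^esub>a\<in>A. z a) = (\<Oplus>\<^bsub>N\<^esub>a\<in>A. f (z a))"
proof -
  interpret M: Module.module class_ring M by (rule M)
  interpret N: Module.module class_ring N by (rule N)
  have "f \<zero>\<^bsub>M\<^esub> \<oplus>\<^bsub>N\<^esub> f \<zero>\<^bsub>M\<^esub> = f \<zero>\<^bsub>M\<^esub>" using f(2)[OF M.zero_closed M.zero_closed] by simp
  then have zero: "f \<zero>\<^bsub>M\<^esub> = \<zero>\<^bsub>N\<^esub>" using f(1)[OF M.zero_closed] N.add.l_cancel_one by metis
  show ?thesis using A
  proof (induction A)
    case (insert a A)
    then have "(\<Oplus>\<^bsub>M\<^esub>a\<in>A. z a) \<in> carrier M" by (intro M.finsum_closed) auto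
    with insert show ?case
      by (simp add: M.finsum_insert N.finsum_insert f Pi_def)
  qed (simp add: zero)
qed

text \<open>Expanding the product means choosing the linear term at the places in \<open>A\<close>
  and the constant term elsewhere. This links coefficients of binary forms with sums over subsets of
  places.\<close>

lemma coeff_prod_binary:
  fixes l k :: nat
  shows "coeff (\<Prod>i<l. [:a i, b i:]) k =
    (\<Sum>A | A \<subseteq> {..<l} \<and> card A = k. \<Prod>i<l. if i \<in> A then b i else (a i :: 'a::comm_ring_1))"
proof -
  have split: "(\<Prod>i<l. if i \<in> A then b i else a i) = (\<Prod>i\<in>A. b i) * (\<Prod>i\<in>{..<l} - A. a i)"
    if "A \<subseteq> {..<l}" for A
  proof -
    have "(\<Prod>i<l. if i \<in> A then b i else a i) = (\<Prod>i\<in>A. if i \<in> A then b i else a i) * (\<Prod>i\<in>{..<l} - A. if i \<in> A then b i else a i)"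
      using prod.subset_diff[OF that finite_lessThan, of "\<lambda>i. if i \<in> A then b i else a i"] by (simp add: mult.commute)
    then show ?thesis by simp
  qed
  have "(\<Prod>i<l. [:a i, b i:]) = (\<Prod>i<l. monom (b i) 1 + [:a i:])"
    by (simp add: monom_altdef)
  also have "\<dots> = (\<Sum>A\<in>Pow {..<l}. (\<Prod>i\<in>A. monom (b i) 1) * (\<Prod>i\<in>{..<l} - A. [:a i:]))"
    by (rule prod_add) simp
  also have "\<dots> = (\<Sum>A\<in>Pow {..<l}. monom (\<Prod>i<l. if i \<in> A then b i else a i) (card A))"
  proof (rule sum.cong[OF refl])
    fix A assume A: "A \<in> Pow {..<l}"
    have 1: "(\<Prod>i\<in>B. monom (b i) (Suc 0)) = monom (\<Prod>i\<in>B. b i) (card B)" if "finite B" for B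
      using that by (induction B) (auto simp: mult_monom)
    have 2: "(\<Prod>i\<in>B. [:a i:]) = monom (\<Prod>i\<in>B. a i) 0" if "finite B" for B
      using that by (induction B) (auto simp: mult_monom monom_0)
    have "finite A" using A by (meson PowD finite_lessThan finite_subset)
    then show "(\<Prod>i\<in>A. monom (b i) 1) * (\<Prod>i\<in>{..<l} - A. [:a i:]) = monom (\<Prod>i<l. if i \<in> A then b i else a i) (card A)"
      using A by (subst split) (auto simp: 1 2 mult_monom)
  qed
  finally have "coeff (\<Prod>i<l. [:a i, b i:]) k = (\<Sum>A\<in>Pow {..<l}. if card A = k then (\<Prod>i<l. if i \<in> A then b i else a i) else 0)"
    by (simp add: coeff_sum)
  also have "\<dots> = (\<Sum>A\<in>{A \<in> Pow {..<l}. card A = k}. \<Prod>i<l. if i \<in> A then b i else a i)"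
    by (rule sum.inter_filter[symmetric]) simp
  finally show ?thesis by (simp add: Pow_def)
qed

section \<open>Binary forms, orbit sums and the determinant pairing\<close>

abbreviation (input) nat2 :: "('k::field, 'k vec, 'k mat) rep" where
  "nat2 \<equiv> natural_rep TYPE('k) 2"

abbreviation (input) e0 :: "'k::field vec" where "e0 \<equiv> unit_vec 2 0"
abbreviation (input) e1 :: "'k::field vec" where "e1 \<equiv> unit_vec 2 1"

definition wedge :: "'k::field vec \<Rightarrow> 'k vec \<Rightarrow> 'k" where
  "wedge x y = x $ 0 * y $ 1 - x $ 1 * y $ 0"

definition monomial_word :: "nat \<Rightarrow> nat \<Rightarrow> 'k::field vec list" where
  "monomial_word l k = replicate (l - k) e0 @ replicate k e1"

text \<open>Dehomogenisation: \<open>e0\<close> becomes 1 and \<open>e1\<close> the variable, so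
  that coefficients of a polynomial of degree at most l serve as coordinates on the upper symmetric
  power.\<close>

definition binary_form :: "('k::field vec list \<Rightarrow>\<^sub>0 'k) set set \<Rightarrow> 'k poly" where
  "binary_form = sym_form (\<lambda>c. [:c:]) (\<lambda>xs. \<Prod>j<length xs. [:xs ! j $ 0, xs ! j $ 1:])"

definition pairing :: "nat \<Rightarrow> 'k::field vec list \<Rightarrow> ('k vec list \<Rightarrow>\<^sub>0 'k) set \<Rightarrow> 'k" where
  "pairing l xs = tensor_form (\<lambda>c. c) (\<lambda>ys. \<Prod>i<l. wedge (xs ! i) (ys ! i))"

text \<open>The words in \<open>e\<^sub>1\<close> and \<open>- e\<^sub>0\<close>, the basis dual to \<open>e\<^sub>0\<close>, \<open>e\<^sub>1\<close> with respect to the determinant form.\<close>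

definition dual_word :: "nat \<Rightarrow> nat set \<Rightarrow> 'k::field vec list" where
  "dual_word l A = map (\<lambda>i. if i \<in> A then - e0 else e1) [0..<l]"

text \<open>The orbit of a word under place permutations, each rearrangement being counted once.
  Summing over all permutations instead would introduce factorials, which may vanish in the
  field.\<close>

definition orbit_sum :: "nat \<Rightarrow> nat \<Rightarrow> ('k::field vec list \<Rightarrow>\<^sub>0 'k) set" where
  "orbit_sum l k = (\<Oplus>\<^bsub>tensor_power l nat2\<^esub> A\<in>{A. A \<subseteq> {..<l} \<and> card A = k}. pure_tensor (replicate l nat2) (dual_word l A))"

interpretation nat2: rep_space "SL TYPE('k::field) 2" "natural_rep TYPE('k) 2"
  by unfold_locales (rule natural_representation)

lemma const_poly_hom: "comm_ring_hom (\<lambda>c :: 'k::field. [:c:])"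
  by unfold_locales (auto simp: one_pCons)

lemma ident_hom: "comm_ring_hom (\<lambda>c :: 'k::field. c)"
  by unfold_locales auto

lemma nat2_expand: "x \<in> carrier_vec 2 \<Longrightarrow> x = x $ 0 \<cdot>\<^sub>v e0 + x $ 1 \<cdot>\<^sub>v e1"
  by (rule eq_vecI) (auto simp: less_2_cases_iff)

lemma nat2_span:
  assumes ab: "a \<in> carrier_vec 2" "b \<in> carrier_vec 2"
    and ex: "\<And>x. x \<in> carrier_vec 2 \<Longrightarrow> \<exists>p q. x = p \<cdot>\<^sub>v a + q \<cdot>\<^sub>v (b :: 'k::field vec)"
  shows "lspan nat2 {a, b} = carrier nat2"
proof -
  have S: "{a, b} \<subseteq> carrier (nat2 :: ('k, _, _) rep)" using ab by simp
  note sub = submoduleD[OF span_submodule[OF natural_module S]]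
  have mem: "a \<in> lspan nat2 {a, b}" "b \<in> lspan nat2 {a, b}"
    using span_mem[OF natural_module S] by auto
  have "x \<in> lspan nat2 {a, b}" if x: "x \<in> carrier_vec 2" for x
  proof -
    obtain p q where "x = p \<cdot>\<^sub>v a + q \<cdot>\<^sub>v b" using ex[OF x] by blast
    then show ?thesis using sub(3)[OF sub(4)[OF mem(1), of p] sub(4)[OF mem(2), of q]] by simp
  qed
  then show ?thesis using sub(1) by auto
qed

lemma binary_form_lin: "lin_form (\<lambda>c. [:c:]) (sym_upper l nat2) (binary_form :: _ \<Rightarrow> 'k::field poly)"
  and binary_form_prod: "set xs \<subseteq> carrier_vec 2 \<Longrightarrow>
    binary_form (sym_prod nat2 xs) = (\<Prod>j<length xs. [:xs ! j $ 0, xs ! j $ 1 :: 'k:])"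
proof -
  have f: "lin_form (\<lambda>c. [:c:]) nat2 (\<lambda>x. [:x $ 0, x $ 1 :: 'k:])"
    by (auto simp: lin_form_def)
  show "lin_form (\<lambda>c. [:c:]) (sym_upper l nat2) (binary_form :: _ \<Rightarrow> 'k poly)"
    unfolding binary_form_def by (rule nat2.sym_form_power(1)[OF const_poly_hom f])
  show "binary_form (sym_prod nat2 xs) = (\<Prod>j<length xs. [:xs ! j $ 0, xs ! j $ 1 :: 'k:])" if "set xs \<subseteq> carrier_vec 2"
    unfolding binary_form_def by (rule nat2.sym_form_power(2)[OF const_poly_hom f]) (use that in simp)
qed

lemma coeff_binary_form_lin: "lin_form (\<lambda>c. c) (sym_upper l nat2) (\<lambda>x. coeff (binary_form x :: 'k::field poly) j)"
  using binary_form_lin[of l, where 'k = 'k] by (auto simp: lin_form_def)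

lemma prod_nth_list: "(\<Prod>j<length xs. f (xs ! j)) = prod_list (map f (xs :: 'a list)) " for f :: "'a \<Rightarrow> 'b::comm_monoid_mult"
  by (simp add: prod.list_conv_set_nth atLeast0LessThan)

lemma monomial_word_set: "set (monomial_word l k) \<subseteq> carrier_vec 2"
  by (auto simp: monomial_word_def)

lemma monomial_word_length: "k \<le> l \<Longrightarrow> length (monomial_word l k) = l"
  by (simp add: monomial_word_def)

lemma mult_unit_vec2:
  "A \<in> carrier_mat 2 2 \<Longrightarrow> i < 2 \<Longrightarrow> j < 2 \<Longrightarrow> (A *\<^sub>v unit_vec 2 j) $ i = A $$ (i, j)" for A :: "'k::field mat"
  by (simp add: mult_mat_vec_def)

lemma binary_form_monomial_act:
  fixes A :: "'k::field mat"
  assumes A: "A \<in> carrier_mat 2 2"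
  shows "binary_form (sym_prod nat2 (map ((*\<^sub>v) A) (monomial_word l k))) =
    [:A $$ (0, 0), A $$ (1, 0):] ^ (l - k) * [:A $$ (0, 1), A $$ (1, 1):] ^ k"
proof -
  have "set (map ((*\<^sub>v) A) (monomial_word l k)) \<subseteq> carrier_vec 2"
    using A monomial_word_set by (auto intro!: mult_mat_vec_carrier[of _ 2 2])
  then have "binary_form (sym_prod nat2 (map ((*\<^sub>v) A) (monomial_word l k))) =
      prod_list (map (\<lambda>x. [:x $ 0, x $ 1:]) (map ((*\<^sub>v) A) (monomial_word l k)))"
    by (subst binary_form_prod) (simp_all only: prod_nth_list[symmetric])
  then show ?thesis
    using A by (simp add: monomial_word_def mult_unit_vec2)
qed

lemma binary_form_monomial: "binary_form (sym_prod nat2 (monomial_word l k)) = (monom 1 k :: 'k::field poly)"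
proof -
  have "map ((*\<^sub>v) (1\<^sub>m 2)) (monomial_word l k) = (monomial_word l k :: 'k vec list)"
    using subsetD[OF monomial_word_set] by (intro map_idI one_mult_mat_vec)
  then show ?thesis using binary_form_monomial_act[of "1\<^sub>m 2 :: 'k mat" l k]
    by (simp add: monom_altdef one_pCons[symmetric])
qed

lemma mset_binary_word:
  fixes xs :: "'k::field vec list"
  assumes "length xs = l" "set xs \<subseteq> {e0, e1}" "count (mset xs) e1 = k"
  shows "mset xs = mset (monomial_word l k)" "k \<le> l"
proof -
  have ne: "e0 \<noteq> (e1 :: 'k vec)" by simp
  have "mset xs = replicate_mset (l - count (mset xs) e1) e0 + replicate_mset (count (mset xs) e1) e1 \<and> count (mset xs) e1 \<le> l"
    using assms(1,2)
  proof (induction xs arbitrary: l)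
    case (Cons x xs)
    then obtain l' where "l = Suc l'" by auto
    with Cons ne show ?case by (auto simp: Suc_diff_le)
  qed simp
  then show "mset xs = mset (monomial_word l k)" "k \<le> l"
    unfolding assms(3) by (simp_all add: monomial_word_def)
qed

text \<open>Words in \<open>e0\<close> and \<open>e1\<close> span, and up to the order of letters
  such a word is determined by the number of letters \<open>e1\<close>.\<close>

lemma sym_upper_monomials_span:
  "lspan (sym_upper l nat2) ((\<lambda>k. sym_prod nat2 (monomial_word l k)) ` {..<Suc l}) = carrier (sym_upper l (nat2 :: ('k::field, _, _) rep))"
proof -
  let ?V = "sym_upper l (nat2 :: ('k, _, _) rep)" and ?S = "{e0, e1 :: 'k vec}"
  have S: "?S \<subseteq> carrier nat2" by simp
  have S_span: "lspan nat2 ?S = carrier nat2"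
    by (rule nat2_span) (use nat2_expand in auto)
  have eq: "(\<lambda>k. sym_prod nat2 (monomial_word l k)) ` {..<Suc l} = sym_prod nat2 ` {xs. length xs = l \<and> set xs \<subseteq> ?S}"
  proof (intro equalityI subsetI)
    fix z assume "z \<in> sym_prod nat2 ` {xs. length xs = l \<and> set xs \<subseteq> ?S}"
    then obtain xs where xs: "z = sym_prod nat2 xs" "length xs = l" "set xs \<subseteq> ?S" by auto
    let ?k = "count (mset xs) e1"
    have "mset xs = mset (monomial_word l ?k)" "?k < Suc l" using mset_binary_word[OF xs(2,3) refl] by auto
    moreover have "set xs \<subseteq> carrier nat2" using xs(3) S by blast
    ultimately show "z \<in> (\<lambda>k. sym_prod nat2 (monomial_word l k)) ` {..<Suc l}"
      unfolding xs(1) using nat2.sym_prod_mset by (intro image_eqI[of _ _ ?k]) auto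
  next
    fix z assume "z \<in> (\<lambda>k. sym_prod (nat2 :: ('k, _, _) rep) (monomial_word l k)) ` {..<Suc l}"
    then show "z \<in> sym_prod nat2 ` {xs. length xs = l \<and> set xs \<subseteq> ?S}"
      by (auto simp: monomial_word_def)
  qed
  show ?thesis unfolding eq by (rule nat2.upper_span[OF S S_span])
qed

lemma pairing_lin: "lin_form (\<lambda>c. c) (tensor_power l nat2) (pairing l (xs :: 'k::field vec list))"
  and pairing_pure: "length ys = l \<Longrightarrow> set ys \<subseteq> carrier_vec 2 \<Longrightarrow>
    pairing l xs (pure_tensor (replicate l nat2) ys) = (\<Prod>i<l. wedge (xs ! i) (ys ! i :: 'k vec))"
proof -
  have "multi_form (\<lambda>c. c) (replicate l nat2)
      (\<lambda>ys. \<Prod>i<length (replicate l (nat2 :: ('k, _, _) rep)). wedge (xs ! i) (ys ! i))"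
    by (rule multi_form_prod) (auto simp: lin_form_def wedge_def algebra_simps)
  then have h: "multi_form (\<lambda>c. c) (replicate l nat2) (\<lambda>ys. \<Prod>i<l. wedge (xs ! i) (ys ! i))" by simp
  show "lin_form (\<lambda>c. c) (tensor_power l nat2) (pairing l xs)"
    unfolding pairing_def by (rule nat2.power.tensor_form_lin[OF ident_hom h])
  show "pairing l xs (pure_tensor (replicate l nat2) ys) = (\<Prod>i<l. wedge (xs ! i) (ys ! i))"
    if "length ys = l" "set ys \<subseteq> carrier_vec 2"
    unfolding pairing_def using that
    by (intro nat2.power.tensor_form_pure[OF ident_hom h]) (simp add: in_listset_replicate)
qed

lemma dual_word_length [simp]: "length (dual_word l A) = l"
  by (simp add: dual_word_def)

lemma dual_word_set: "set (dual_word l A) \<subseteq> carrier_vec 2"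
  by (auto simp: dual_word_def)

lemma dual_word_pure: "pure_tensor (replicate l nat2) (dual_word l A :: 'k::field vec list) \<in> carrier (tensor_power l nat2)"
  using dual_word_set by (intro nat2.pure_carrier) auto

lemma wedge_dual:
  "x \<in> carrier_vec 2 \<Longrightarrow> wedge x (if b then - e0 else e1) = (if b then x $ 1 else x $ 0)"
  by (simp add: wedge_def)

lemma pairing_dual_word:
  assumes "length xs = l" "set xs \<subseteq> carrier_vec 2"
  shows "pairing l xs (pure_tensor (replicate l nat2) (dual_word l A)) = (\<Prod>i<l. if i \<in> A then xs ! i $ 1 else xs ! i $ 0 :: 'k::field)"
proof -
  have "xs ! i \<in> carrier_vec 2" if "i < l" for i using assms that by auto
  then show ?thesis
    using dual_word_set by (subst pairing_pure) (auto intro!: prod.cong simp: dual_word_def wedge_dual)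
qed

lemma orbit_sum_carrier: "orbit_sum l k \<in> carrier (tensor_power l (nat2 :: ('k::field, _, _) rep))"
proof -
  interpret T: Module.module class_ring "tensor_power l (nat2 :: ('k, _, _) rep)" by (rule nat2.power.tensor_module)
  show ?thesis unfolding orbit_sum_def by (rule T.finsum_closed) (auto simp: dual_word_pure)
qed

text \<open>Pairing with the dual word of \<open>A\<close> picks coordinate 1 at the places in
  \<open>A\<close> and coordinate 0 elsewhere, and \<open>coeff_prod_binary\<close> adds these
  products up. Thus the orbit sums represent the coordinate forms on the upper symmetric
  power.\<close>

lemma pairing_orbit_sum:
  assumes xs: "length xs = l" "set xs \<subseteq> carrier_vec 2"
  shows "pairing l xs (orbit_sum l k) = coeff (binary_form (sym_prod nat2 xs) :: 'k::field poly) k"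
proof -
  have "pairing l xs (orbit_sum l k) = (\<Sum>A | A \<subseteq> {..<l} \<and> card A = k. \<Prod>i<l. if i \<in> A then xs ! i $ 1 else xs ! i $ 0)"
    unfolding orbit_sum_def
    by (subst lin_form_finsum[OF nat2.power.tensor_module pairing_lin])
      (auto simp: dual_word_pure pairing_dual_word[OF xs])
  also have "\<dots> = coeff (\<Prod>i<l. [:xs ! i $ 0, xs ! i $ 1:]) k"
    by (rule coeff_prod_binary[symmetric])
  finally show ?thesis using xs by (simp add: binary_form_prod)
qed

lemma det_mat2:
  fixes A :: "'k::comm_ring_1 mat"
  assumes A: "A \<in> carrier_mat 2 2"
  shows "det A = A $$ (0, 0) * A $$ (1, 1) - A $$ (0, 1) * A $$ (1, 0)"
proof -
  have one: "det (mat_delete A 0 j) = mat_delete A 0 j $$ (0, 0)" if "j < 2" for j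
    by (rule det_single) (use A in \<open>simp add: mat_delete_def\<close>)
  have "mat_delete A 0 0 $$ (0, 0) = A $$ (1, 1)" "mat_delete A 0 1 $$ (0, 0) = A $$ (1, 0)"
    using A by (auto simp: mat_delete_def)
  then have "cofactor A 0 0 = A $$ (1, 1)" "cofactor A 0 1 = - A $$ (1, 0)"
    using one[of 0] one[of 1] by (simp_all add: cofactor_def)
  moreover have "det A = (\<Sum>j<2. A $$ (0, j) * cofactor A 0 j)"
    by (rule laplace_expansion_row[OF A]) simp
  ultimately show ?thesis by (simp add: numeral_2_eq_2)
qed

lemma wedge_act:
  assumes A: "A \<in> carrier_mat 2 2" "det A = 1" and x: "x \<in> carrier_vec 2" and y: "y \<in> carrier_vec 2"
  shows "wedge (A *\<^sub>v x) (A *\<^sub>v y) = wedge x (y :: 'k::field vec)"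
proof -
  have d: "A $$ (0, 0) * A $$ (1, 1) - A $$ (0, 1) * A $$ (1, 0) = 1"
    using det_mat2[OF A(1)] A(2) by simp
  have v: "(A *\<^sub>v z) $ i = A $$ (i, 0) * z $ 0 + A $$ (i, 1) * z $ 1" if "z \<in> carrier_vec 2" "i < 2" for z i
    using that A(1) by (simp add: mult_mat_vec_def scalar_prod_def numeral_2_eq_2)
  have "wedge (A *\<^sub>v x) (A *\<^sub>v y) = (A $$ (0, 0) * A $$ (1, 1) - A $$ (0, 1) * A $$ (1, 0)) * wedge x y"
    unfolding wedge_def using x y by (simp add: v) (simp add: algebra_simps)
  then show ?thesis unfolding d by simp
qed

lemma nat2_tensor_span:
  "lspan (tensor_power l (nat2 :: ('k::field, _, _) rep)) (pure_tensor (replicate l nat2) ` {ys. length ys = l \<and> set ys \<subseteq> carrier_vec 2}) = carrier (tensor_power l nat2)"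
proof -
  have "{ys. length ys = l \<and> set ys \<subseteq> carrier_vec 2} = listset (map carrier (replicate l (nat2 :: ('k, _, _) rep)))"
    by (auto simp: in_listset_replicate)
  then show ?thesis using nat2.power.tensor_span by simp
qed

lemma pure_image: "pure_tensor (replicate l nat2) ` {ys. length ys = l \<and> set ys \<subseteq> carrier_vec 2} \<subseteq> carrier (tensor_power l (nat2 :: ('k::field, _, _) rep))"
  by (auto intro!: nat2.pure_carrier)

text \<open>Apply \<open>B\<close> to both arguments of each factor: the determinant form is
  invariant, and \<open>B * A = 1\<close> leaves the right argument bare. So the adjoint of a group
  element is its inverse.\<close>

lemma pairing_act:
  assumes xs: "length xs = l" "set xs \<subseteq> carrier_vec 2"
    and A: "A \<in> carrier_mat 2 2" "det A = 1" and B: "B \<in> carrier_mat 2 2" "det B = 1" "B * A = 1\<^sub>m 2"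
    and w: "w \<in> carrier (tensor_power l nat2)"
  shows "pairing l xs (act (tensor_power l nat2) A w) = pairing l (map ((*\<^sub>v) B) xs) (w :: ('k::field vec list \<Rightarrow>\<^sub>0 'k) set)"
proof (rule lin_form_eq_on_span[OF nat2.power.tensor_module pure_image _ pairing_lin _ w[folded nat2_tensor_span]])
  have g: "A \<in> carrier (SL TYPE('k) 2)" using A by simp
  show "lin_form (\<lambda>c. c) (tensor_power l nat2) (\<lambda>w. pairing l xs (act (tensor_power l nat2) A w))"
    using lin_formD[OF pairing_lin[where 'k = 'k]] representationD(4-6)[OF nat2.power_rep g[folded SL_simps(1)]]
    by (simp add: lin_form_def)
  fix z :: "('k vec list \<Rightarrow>\<^sub>0 'k) set" assume "z \<in> pure_tensor (replicate l nat2) ` {ys. length ys = l \<and> set ys \<subseteq> carrier_vec 2}"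
  then obtain ys where ys: "z = pure_tensor (replicate l nat2) ys" "length ys = l" "set ys \<subseteq> carrier_vec 2" by auto
  have Ays: "set (map ((*\<^sub>v) A) ys) \<subseteq> carrier_vec 2" using ys A by (auto intro!: mult_mat_vec_carrier[of _ 2 2])
  have "wedge (xs ! i) (A *\<^sub>v (ys ! i)) = wedge (B *\<^sub>v (xs ! i)) (ys ! i)" if i: "i < l" for i
  proof -
    have c: "xs ! i \<in> carrier_vec 2" "ys ! i \<in> carrier_vec 2" using xs ys i by auto
    have "wedge (xs ! i) (A *\<^sub>v (ys ! i)) = wedge (B *\<^sub>v (xs ! i)) (B *\<^sub>v (A *\<^sub>v (ys ! i)))"
      by (rule wedge_act[symmetric, OF B(1,2) c(1)]) (use A c in \<open>auto intro!: mult_mat_vec_carrier[of _ 2 2]\<close>)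
    also have "B *\<^sub>v (A *\<^sub>v (ys ! i)) = ys ! i"
      using c A B by (simp flip: assoc_mult_mat_vec[of B 2 2 A 2])
    finally show ?thesis .
  qed
  moreover have "act (tensor_power l nat2) A z = pure_tensor (replicate l nat2) (map ((*\<^sub>v) A) ys)"
    using nat2.act_pure[OF g ys(2)] ys by simp
  ultimately show "pairing l xs (act (tensor_power l nat2) A z) = pairing l (map ((*\<^sub>v) B) xs) z"
    using ys Ays xs by (simp add: pairing_pure)
qed

lemma pairing_permute:
  assumes p: "\<sigma> permutes {..<l}" and xs: "length xs = l"
    and w: "w \<in> carrier (tensor_power l nat2)"
  shows "pairing l (permute_list \<sigma> xs) (place_perm l nat2 \<sigma> w) = pairing l xs (w :: ('k::field vec list \<Rightarrow>\<^sub>0 'k) set)"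
proof (rule lin_form_eq_on_span[OF nat2.power.tensor_module pure_image _ pairing_lin _ w[folded nat2_tensor_span]])
  show "lin_form (\<lambda>c. c) (tensor_power l nat2) (\<lambda>w. pairing l (permute_list \<sigma> xs) (place_perm l nat2 \<sigma> w))"
    using lin_formD[OF pairing_lin[where 'k = 'k]] nat2.place_perm_add[OF p, where 'k = 'k] nat2.place_perm_smult[OF p, where 'k = 'k] nat2.place_perm_closed[OF p, where 'k = 'k]
    by (simp add: lin_form_def)
  fix z :: "('k vec list \<Rightarrow>\<^sub>0 'k) set" assume "z \<in> pure_tensor (replicate l nat2) ` {ys. length ys = l \<and> set ys \<subseteq> carrier_vec 2}"
  then obtain ys where ys: "z = pure_tensor (replicate l nat2) ys" "length ys = l" "set ys \<subseteq> carrier_vec 2" by auto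
  have p': "\<sigma> permutes {..<length xs}" "\<sigma> permutes {..<length ys}" using p xs ys by auto
  have z: "place_perm l nat2 \<sigma> z = pure_tensor (replicate l nat2) (permute_list \<sigma> ys)"
    unfolding ys(1) by (rule nat2.place_perm_pure[OF p]) (use ys in auto)
  have "pairing l (permute_list \<sigma> xs) (place_perm l nat2 \<sigma> z) = (\<Prod>i<l. wedge (xs ! \<sigma> i) (ys ! \<sigma> i))"
    unfolding z using ys xs p' by (subst pairing_pure) (auto simp: permute_list_nth intro!: prod.cong)
  also have "\<dots> = (\<Prod>i<l. wedge (xs ! i) (ys ! i))"
    using prod.permute[OF p, of "\<lambda>i. wedge (xs ! i) (ys ! i)"] by (simp add: o_def)
  finally show "pairing l (permute_list \<sigma> xs) (place_perm l nat2 \<sigma> z) = pairing l xs z"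
    using ys by (simp add: pairing_pure)
qed

text \<open>Permuting word and tensor simultaneously preserves the pairing, and an invariant tensor
  is fixed. Hence its coordinates depend only on the number of letters \<open>e1\<close>.\<close>

lemma pairing_lower_mset:
  assumes "mset xs = mset ys" "length ys = l" and w: "w \<in> carrier (sym_lower l nat2)"
  shows "pairing l xs w = pairing l ys (w :: ('k::field vec list \<Rightarrow>\<^sub>0 'k) set)"
proof -
  obtain \<sigma> where s: "\<sigma> permutes {..<length ys}" "permute_list \<sigma> ys = xs"
    using mset_eq_permutation[OF assms(1)] by metis
  then show ?thesis
    using pairing_permute[of \<sigma> l ys w] w assms(2) by (simp add: sym_lower_def)
qed

lemma permute_dual_word:
  assumes p: "\<sigma> permutes {..<l}" and A: "A \<subseteq> {..<l}"
  shows "permute_list \<sigma> (dual_word l A) = dual_word l (inv_into UNIV \<sigma> ` A)"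
proof (rule nth_equalityI)
  fix i assume "i < length (permute_list \<sigma> (dual_word l A))"
  then have i: "i < l" by simp
  have "\<sigma> i \<in> A \<longleftrightarrow> i \<in> inv_into UNIV \<sigma> ` A"
    using permutes_inverses[OF p] by (metis image_iff)
  moreover have "\<sigma> i < l" using permutes_in_image[OF p, of i] i by simp
  ultimately show "permute_list \<sigma> (dual_word l A) ! i = dual_word l (inv_into UNIV \<sigma> ` A) ! i"
    using i p by (simp add: permute_list_nth dual_word_def)
qed simp

text \<open>A place permutation sends the dual word of \<open>A\<close> to the dual word of the
  preimage of \<open>A\<close>, so it permutes the summands indexed by the \<open>k\<close>-element
  subsets.\<close>

lemma orbit_sum_lower: "orbit_sum l k \<in> carrier (sym_lower l (nat2 :: ('k::field, _, _) rep))"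
proof -
  let ?T = "tensor_power l (nat2 :: ('k, _, _) rep)" and ?F = "{A. A \<subseteq> {..<l} \<and> card A = k}"
  let ?w = "\<lambda>A. pure_tensor (replicate l nat2) (dual_word l A :: 'k vec list)"
  interpret T: Module.module class_ring ?T by (rule nat2.power.tensor_module)
  have fin: "finite ?F" by (rule finite_subset[of _ "Pow {..<l}"]) auto
  have "place_perm l nat2 \<sigma> (orbit_sum l k) = (orbit_sum l k :: ('k vec list \<Rightarrow>\<^sub>0 'k) set)" if p: "\<sigma> permutes {..<l}" for \<sigma>
  proof -
    let ?i = "\<lambda>A. inv_into UNIV \<sigma> ` A"
    note ip = permutes_inv[OF p]
    have inj: "inj_on ?i ?F" using permutes_inj[OF ip] by (auto simp: inj_on_def inj_image_eq_iff)
    have img: "?i ` ?F = ?F"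
    proof (rule endo_inj_surj[OF fin _ inj], clarify)
      fix A assume "A \<subseteq> {..<l}" "k = card A"
      then show "?i A \<subseteq> {..<l} \<and> card (?i A) = card A"
        using permutes_image[OF ip] card_image[OF inj_on_subset[OF permutes_inj[OF ip] subset_UNIV]] by (metis image_mono)
    qed
    have "place_perm l nat2 \<sigma> (orbit_sum l k) = (\<Oplus>\<^bsub>?T\<^esub>A\<in>?F. place_perm l nat2 \<sigma> (?w A))"
      unfolding orbit_sum_def
      by (rule additive_finsum[OF nat2.power.tensor_module nat2.power.tensor_module])
        (use nat2.place_perm_closed[OF p] nat2.place_perm_add[OF p] fin dual_word_pure in auto)
    also have "\<dots> = (\<Oplus>\<^bsub>?T\<^esub>A\<in>?F. ?w (?i A))"
    proof (rule T.finsum_cong')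
      fix A assume "A \<in> ?F"
      then show "place_perm l nat2 \<sigma> (?w A) = ?w (?i A)"
        using nat2.place_perm_pure[OF p, of "dual_word l A :: 'k vec list"] dual_word_set[where 'a = 'k] permute_dual_word[OF p, where 'a = 'k] by simp
    qed (auto simp: dual_word_pure)
    also have "\<dots> = (\<Oplus>\<^bsub>?T\<^esub>A\<in>?i ` ?F. ?w A)"
      by (rule T.finsum_reindex[symmetric, OF _ inj]) (auto simp: dual_word_pure)
    also have "\<dots> = orbit_sum l k" unfolding img orbit_sum_def ..
    finally show ?thesis .
  qed
  then show ?thesis using orbit_sum_carrier[of l k, where 'k = 'k] by (simp add: sym_lower_def)
qed

lemma binary_coord_rep:
  "coord_rep (SL TYPE('k::field) 2) (sym_upper l nat2) (Suc l) (\<lambda>k. sym_prod nat2 (monomial_word l k))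
    (\<lambda>j x. coeff (binary_form x :: 'k poly) j)"
proof (unfold_locales)
  show "representation (SL TYPE('k) 2) (sym_upper l nat2)" by (rule nat2.upper_rep)
  show "sym_prod nat2 (monomial_word l j :: 'k vec list) \<in> carrier (sym_upper l nat2)" if "j < Suc l" for j
    using that monomial_word_set by (intro nat2.sym_prod_carrier) (auto simp: monomial_word_length)
  show "lin_form (\<lambda>x. x) (sym_upper l nat2) (\<lambda>x. coeff (binary_form x :: 'k poly) j)" for j
    by (rule coeff_binary_form_lin)
  show "coeff (binary_form (sym_prod nat2 (monomial_word l i)) :: 'k poly) j = (if i = j then 1 else 0)" for i j
    by (simp add: binary_form_monomial)
  show "lspan (sym_upper l nat2) ((\<lambda>k. sym_prod nat2 (monomial_word l k)) ` {..<Suc l}) = carrier (sym_upper l (nat2 :: ('k, _, _) rep))"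
    by (rule sym_upper_monomials_span)
qed

text \<open>The words with \<open>e1\<close> at the places in \<open>A\<close> and \<open>e0\<close>
  elsewhere are dual, under the determinant pairing, to the dual words; so the pairings are the
  coordinates of a tensor in the basis of dual words.\<close>

lemma tensor_dual_word_expand:
  fixes y :: "('k::field vec list \<Rightarrow>\<^sub>0 'k) set"
  assumes y: "y \<in> carrier (tensor_power l nat2)"
  shows "y = (\<Oplus>\<^bsub>tensor_power l nat2\<^esub>A\<in>Pow {..<l}.
    pairing l (map (\<lambda>i. if i \<in> A then e1 else e0) [0..<l]) y \<odot>\<^bsub>tensor_power l nat2\<^esub> pure_tensor (replicate l nat2) (dual_word l A))"
proof -
  let ?T = "tensor_power l (nat2 :: ('k, _, _) rep)"
  let ?w = "\<lambda>A. pure_tensor (replicate l nat2) (dual_word l A :: 'k vec list)"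
  let ?x = "\<lambda>A. map (\<lambda>i. if i \<in> A then e1 else e0 :: 'k vec) [0..<l]"
  interpret T: Module.module class_ring ?T by (rule nat2.power.tensor_module)
  note mod = nat2.power.tensor_module[where 'k = 'k and r = l]
  note lin = lin_formD[OF pairing_lin[where 'k = 'k]]
  let ?S = "{e1, - e0 :: 'k vec}"
  have S: "?S \<subseteq> carrier nat2" by simp
  have S_span: "lspan nat2 ?S = carrier nat2"
  proof (rule nat2_span)
    fix x :: "'k vec" assume "x \<in> carrier_vec 2"
    then show "\<exists>p q. x = p \<cdot>\<^sub>v e1 + q \<cdot>\<^sub>v - e0"
      by (intro exI[of _ "x $ 1"] exI[of _ "- (x $ 0)"] eq_vecI) (auto simp: less_2_cases_iff)
  qed auto
  let ?P = "pure_tensor (replicate l nat2) ` {xs. length xs = l \<and> set xs \<subseteq> ?S}"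
  have P: "?P \<subseteq> carrier ?T" using S by (auto intro!: nat2.pure_carrier)
  have y': "y \<in> lspan ?T ?P" using y nat2.power_span[OF S S_span] by simp
  have tc: "(\<lambda>A. pairing l (?x A) y \<odot>\<^bsub>?T\<^esub> ?w A) \<in> Pow {..<l} \<rightarrow> carrier ?T" for y
    by (auto intro!: class_moduleD(1)[OF mod] dual_word_pure)
  show ?thesis
  proof (rule span_induct[OF mod P y'])
    have "(\<Oplus>\<^bsub>?T\<^esub>A\<in>Pow {..<l}. pairing l (?x A) \<zero>\<^bsub>?T\<^esub> \<odot>\<^bsub>?T\<^esub> ?w A) = (\<Oplus>\<^bsub>?T\<^esub>A\<in>Pow {..<l}. \<zero>\<^bsub>?T\<^esub>)"
      by (rule T.finsum_cong')
        (simp_all add: lin_form_zero[OF mod pairing_lin] class_moduleD(6)[OF mod] dual_word_pure)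
    then show "\<zero>\<^bsub>?T\<^esub> = (\<Oplus>\<^bsub>?T\<^esub>A\<in>Pow {..<l}. pairing l (?x A) \<zero>\<^bsub>?T\<^esub> \<odot>\<^bsub>?T\<^esub> ?w A)" by simp
  next
    fix a b assume a: "a \<in> carrier ?T" "a = (\<Oplus>\<^bsub>?T\<^esub>A\<in>Pow {..<l}. pairing l (?x A) a \<odot>\<^bsub>?T\<^esub> ?w A)"
      and b: "b \<in> carrier ?T" "b = (\<Oplus>\<^bsub>?T\<^esub>A\<in>Pow {..<l}. pairing l (?x A) b \<odot>\<^bsub>?T\<^esub> ?w A)"
    have "a \<oplus>\<^bsub>?T\<^esub> b = (\<Oplus>\<^bsub>?T\<^esub>A\<in>Pow {..<l}. pairing l (?x A) a \<odot>\<^bsub>?T\<^esub> ?w A \<oplus>\<^bsub>?T\<^esub> pairing l (?x A) b \<odot>\<^bsub>?T\<^esub> ?w A)"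
      using T.finsum_addf[OF tc[of a] tc[of b]] a(2) b(2) by simp
    also have "\<dots> = (\<Oplus>\<^bsub>?T\<^esub>A\<in>Pow {..<l}. pairing l (?x A) (a \<oplus>\<^bsub>?T\<^esub> b) \<odot>\<^bsub>?T\<^esub> ?w A)"
      by (rule T.finsum_cong'[OF refl tc]) (simp only: lin(1)[OF a(1) b(1)] class_moduleD(2)[OF mod dual_word_pure])
    finally show "a \<oplus>\<^bsub>?T\<^esub> b = (\<Oplus>\<^bsub>?T\<^esub>A\<in>Pow {..<l}. pairing l (?x A) (a \<oplus>\<^bsub>?T\<^esub> b) \<odot>\<^bsub>?T\<^esub> ?w A)" .
  next
    fix r a assume a: "a \<in> carrier ?T" "a = (\<Oplus>\<^bsub>?T\<^esub>A\<in>Pow {..<l}. pairing l (?x A) a \<odot>\<^bsub>?T\<^esub> ?w A)"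
    have "r \<odot>\<^bsub>?T\<^esub> a = (\<Oplus>\<^bsub>?T\<^esub>A\<in>Pow {..<l}. r \<odot>\<^bsub>?T\<^esub> (pairing l (?x A) a \<odot>\<^bsub>?T\<^esub> ?w A))"
      using T.finsum_smult[OF _ tc[of a], of r] a(2) by simp
    also have "\<dots> = (\<Oplus>\<^bsub>?T\<^esub>A\<in>Pow {..<l}. pairing l (?x A) (r \<odot>\<^bsub>?T\<^esub> a) \<odot>\<^bsub>?T\<^esub> ?w A)"
      by (rule T.finsum_cong'[OF refl tc]) (simp only: lin(2)[OF a(1)] class_moduleD(4)[OF mod dual_word_pure])
    finally show "r \<odot>\<^bsub>?T\<^esub> a = (\<Oplus>\<^bsub>?T\<^esub>A\<in>Pow {..<l}. pairing l (?x A) (r \<odot>\<^bsub>?T\<^esub> a) \<odot>\<^bsub>?T\<^esub> ?w A)" .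
  next
    fix z assume "z \<in> ?P"
    then obtain xs where xs: "z = pure_tensor (replicate l nat2) xs" "length xs = l" "set xs \<subseteq> ?S" by auto
    define B where "B = {i. i < l \<and> xs ! i = - e0}"
    have "xs = dual_word l B"
    proof (rule nth_equalityI)
      fix i assume i: "i < length xs"
      then have "xs ! i \<in> ?S" using xs(3) nth_mem by blast
      then show "xs ! i = dual_word l B ! i" using i xs(2) by (auto simp: dual_word_def B_def)
    qed (simp add: xs)
    then have z: "z = ?w B" using xs(1) by simp
    have "pairing l (?x A) z = (if B = A then 1 else 0)" if A: "A \<in> Pow {..<l}" for A
    proof -
      have "pairing l (?x A) z = (\<Prod>i<l. if i \<in> B then ?x A ! i $ 1 else ?x A ! i $ 0)"
        unfolding z by (rule pairing_dual_word) auto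
      also have "\<dots> = (\<Prod>i<l. if i \<in> B \<longleftrightarrow> i \<in> A then 1 else 0)"
        by (rule prod.cong) auto
      also have "\<dots> = (if B = A then 1 else 0)"
      proof (cases "B = A")
        case False
        then obtain i where "i < l" "(i \<in> B) \<noteq> (i \<in> A)" using A by (auto simp: B_def)
        then show ?thesis using False by (auto intro!: prod_zero)
      qed simp
      finally show ?thesis .
    qed
    then have "(\<Oplus>\<^bsub>?T\<^esub>A\<in>Pow {..<l}. pairing l (?x A) z \<odot>\<^bsub>?T\<^esub> ?w A) = (\<Oplus>\<^bsub>?T\<^esub>A\<in>Pow {..<l}. if B = A then ?w A else \<zero>\<^bsub>?T\<^esub>)"
      by (intro T.finsum_cong') (auto simp: class_moduleD(5,6)[OF mod] dual_word_pure)
    also have "\<dots> = ?w B"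
      by (rule T.add.finprod_singleton) (auto simp: B_def dual_word_pure)
    finally show "z = (\<Oplus>\<^bsub>?T\<^esub>A\<in>Pow {..<l}. pairing l (?x A) z \<odot>\<^bsub>?T\<^esub> ?w A)" using z by simp
  qed
qed

text \<open>The coordinate of an invariant tensor at \<open>A\<close> depends only on the
  cardinality of \<open>A\<close>. Collecting the terms with equal cardinality produces multiples of
  the orbit sums, without any division.\<close>

lemma sym_lower_orbit_span:
  "lspan (sym_lower l nat2) (orbit_sum l ` {..<Suc l}) = carrier (sym_lower l (nat2 :: ('k::field, _, _) rep))"
proof -
  let ?T = "tensor_power l (nat2 :: ('k, _, _) rep)"
  let ?w = "\<lambda>A. pure_tensor (replicate l nat2) (dual_word l A :: 'k vec list)"
  let ?x = "\<lambda>A. map (\<lambda>i. if i \<in> A then e1 else e0 :: 'k vec) [0..<l]"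
  let ?O = "orbit_sum l ` {..<Suc l} :: ('k vec list \<Rightarrow>\<^sub>0 'k) set set"
  interpret T: Module.module class_ring ?T by (rule nat2.power.tensor_module)
  note mod = nat2.power.tensor_module[where 'k = 'k and r = l]
  note W = nat2.lower_submodule[where 'k = 'k and r = l]
  have O: "?O \<subseteq> carrier ?T" using orbit_sum_carrier by auto
  note Q = submoduleD[OF span_submodule[OF mod O]]
  \<comment> \<open>Terms are collected by cardinality; \<open>q\<close> stands for the coordinate
    as a function of the cardinality.\<close>
  have part: "(\<Oplus>\<^bsub>?T\<^esub>A\<in>{A. A \<subseteq> {..<l} \<and> card A < J}. q (card A) \<odot>\<^bsub>?T\<^esub> ?w A) \<in> lspan ?T ?O" if "J \<le> Suc l" for J q
    using that
  proof (induction J)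
    case 0 then show ?case using Q(2) by simp
  next
    case (Suc J)
    have eq: "{A. A \<subseteq> {..<l} \<and> card A < Suc J} = {A. A \<subseteq> {..<l} \<and> card A < J} \<union> {A. A \<subseteq> {..<l} \<and> card A = J}" by auto
    have fin: "finite {A. A \<subseteq> {..<l} \<and> P A}" for P by (rule finite_subset[of _ "Pow {..<l}"]) auto
    have c: "(\<lambda>A. q (card A) \<odot>\<^bsub>?T\<^esub> ?w A) \<in> F \<rightarrow> carrier ?T" for F
      by (auto intro!: class_moduleD(1)[OF mod] dual_word_pure)
    have "(\<Oplus>\<^bsub>?T\<^esub>A\<in>{A. A \<subseteq> {..<l} \<and> card A = J}. q (card A) \<odot>\<^bsub>?T\<^esub> ?w A) =
        (\<Oplus>\<^bsub>?T\<^esub>A\<in>{A. A \<subseteq> {..<l} \<and> card A = J}. q J \<odot>\<^bsub>?T\<^esub> ?w A)"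
      by (rule T.finsum_cong') (auto intro!: class_moduleD(1)[OF mod] dual_word_pure)
    also have "\<dots> = q J \<odot>\<^bsub>?T\<^esub> orbit_sum l J"
      unfolding orbit_sum_def by (rule T.finsum_smult[symmetric]) (auto simp: dual_word_pure)
    finally have "(\<Oplus>\<^bsub>?T\<^esub>A\<in>{A. A \<subseteq> {..<l} \<and> card A = J}. q (card A) \<odot>\<^bsub>?T\<^esub> ?w A) \<in> lspan ?T ?O"
      using Q(4)[OF span_mem[OF mod O]] Suc.prems by auto
    moreover have "(\<Oplus>\<^bsub>?T\<^esub>A\<in>{A. A \<subseteq> {..<l} \<and> card A < Suc J}. q (card A) \<odot>\<^bsub>?T\<^esub> ?w A) =
      (\<Oplus>\<^bsub>?T\<^esub>A\<in>{A. A \<subseteq> {..<l} \<and> card A < J}. q (card A) \<odot>\<^bsub>?T\<^esub> ?w A) \<oplus>\<^bsub>?T\<^esub>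
      (\<Oplus>\<^bsub>?T\<^esub>A\<in>{A. A \<subseteq> {..<l} \<and> card A = J}. q (card A) \<odot>\<^bsub>?T\<^esub> ?w A)"
      unfolding eq by (rule T.finsum_Un_disjoint[OF fin fin _ c c]) auto
    ultimately show ?case using Q(3) Suc by simp
  qed
  have "y \<in> lspan ?T ?O" if y: "y \<in> carrier (sym_lower l nat2)" for y
  proof -
    have yT: "y \<in> carrier ?T" using y by (simp add: sym_lower_def)
    have "pairing l (?x A) y = pairing l (monomial_word l (card A)) y" "card A < Suc l" if A: "A \<in> Pow {..<l}" for A
    proof -
      have "count (mset (?x A)) e1 = card {i. i < l \<and> (if i \<in> A then e1 else e0 :: 'k vec) = e1}" by (rule count_map_upt)
      also have "{i. i < l \<and> (if i \<in> A then e1 else e0 :: 'k vec) = e1} = A" using A by auto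
      finally have k: "count (mset (?x A)) e1 = card A" .
      have m: "mset (?x A) = mset (monomial_word l (card A))" and c: "card A \<le> l"
        by (rule mset_binary_word[OF _ _ k]; auto)+
      show "pairing l (?x A) y = pairing l (monomial_word l (card A)) y"
        by (rule pairing_lower_mset[OF m _ y]) (simp add: monomial_word_length c)
      show "card A < Suc l" using c by simp
    qed
    then have "(\<Oplus>\<^bsub>?T\<^esub>A\<in>Pow {..<l}. pairing l (?x A) y \<odot>\<^bsub>?T\<^esub> ?w A) =
      (\<Oplus>\<^bsub>?T\<^esub>A\<in>{A. A \<subseteq> {..<l} \<and> card A < Suc l}. pairing l (monomial_word l (card A)) y \<odot>\<^bsub>?T\<^esub> ?w A)"
      by (intro T.finsum_cong') (auto intro!: class_moduleD(1)[OF mod] dual_word_pure)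
    then show ?thesis
      using tensor_dual_word_expand[OF yT] part[OF le_refl, of "\<lambda>k. pairing l (monomial_word l k) y"] by simp
  qed
  moreover have OW: "?O \<subseteq> carrier (sym_lower l nat2)" using orbit_sum_lower by auto
  moreover have "lspan ?T ?O \<subseteq> carrier (sym_lower l nat2)"
    using span_least[OF mod _ W] OW by (simp add: sym_lower_def)
  moreover have "lspan (sym_lower l nat2) ?O = lspan ?T ?O"
    using LinearCombinations.module.span_li_not_depend(1)[OF mod _ W] OW by (simp add: sym_lower_def)
  ultimately show ?thesis by blast
qed

lemma dual_binary_coord_rep:
  "coord_rep (SL TYPE('k::field) 2) (sym_lower l nat2) (Suc l) (orbit_sum l :: nat \<Rightarrow> ('k vec list \<Rightarrow>\<^sub>0 'k) set)
    (\<lambda>j. pairing l (monomial_word l j))"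
proof (unfold_locales)
  show "representation (SL TYPE('k) 2) (sym_lower l nat2)" by (rule nat2.lower_rep)
  show "orbit_sum l j \<in> carrier (sym_lower l (nat2 :: ('k, _, _) rep))" for j by (rule orbit_sum_lower)
  show "lin_form (\<lambda>x. x) (sym_lower l nat2) (pairing l (monomial_word l j :: 'k vec list))" for j
    unfolding sym_lower_def by (rule lin_form_sub[OF pairing_lin]) auto
  show "pairing l (monomial_word l j) (orbit_sum l i) = (if i = j then 1 else 0 :: 'k)" if "i < Suc l" "j < Suc l" for i j
    using that by (subst pairing_orbit_sum) (auto simp: monomial_word_length binary_form_monomial monomial_word_set)
  show "lspan (sym_lower l nat2) (orbit_sum l ` {..<Suc l}) = carrier (sym_lower l (nat2 :: ('k, _, _) rep))"
    by (rule sym_lower_orbit_span)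
qed

interpretation binary: coord_rep "SL TYPE('k::field) 2" "sym_upper l (natural_rep TYPE('k) 2)" "Suc l"
    "\<lambda>k. sym_prod (natural_rep TYPE('k) 2) (monomial_word l k)" "\<lambda>j x. coeff (binary_form x) j" for l
  by (rule binary_coord_rep)

interpretation dual_binary: coord_rep "SL TYPE('k::field) 2" "sym_lower l (natural_rep TYPE('k) 2)" "Suc l"
    "orbit_sum l" "\<lambda>j. pairing l (monomial_word l j)" for l
  by (rule dual_binary_coord_rep)

section \<open>Action matrices on the two symmetric powers\<close>

lemma binary_action_mat:
  fixes A :: "'k::field mat"
  assumes A: "A \<in> carrier (SL TYPE('k) 2)"
  shows "binary.action_mat l A = mat (Suc l) (Suc l) (\<lambda>(j, k).
    coeff ([:A $$ (0, 0), A $$ (1, 0):] ^ (l - k) * [:A $$ (0, 1), A $$ (1, 1):] ^ k) j)"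
  unfolding binary.action_mat_def
proof (rule cong_mat[OF refl refl], unfold prod.case)
  fix j k assume "k < Suc l"
  then have k: "length (monomial_word l k :: 'k vec list) = l" by (simp add: monomial_word_length)
  have "act (sym_upper l nat2) A (sym_prod nat2 (monomial_word l k)) = sym_prod nat2 (map ((*\<^sub>v) A) (monomial_word l k))"
    using nat2.sym_prod_act[OF A k] by (simp add: monomial_word_set)
  then show "coeff (binary_form (act (sym_upper l nat2) A (sym_prod nat2 (monomial_word l k)))) j =
    coeff ([:A $$ (0, 0), A $$ (1, 0):] ^ (l - k) * [:A $$ (0, 1), A $$ (1, 1):] ^ k) j"
    using A by (simp add: binary_form_monomial_act)
qed

text \<open>In the pairing \<open>A\<close> moves to the other side as its inverse \<open>B\<close>,
  and pairing with orbit sums reads off coefficients of binary forms. The entry (j, k) on one side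
  is thus the entry (k, j) for \<open>B\<close> on the other.\<close>

lemma dual_binary_action_mat:
  fixes A B :: "'k::field mat"
  assumes A: "A \<in> carrier (SL TYPE('k) 2)" and B: "B \<in> carrier (SL TYPE('k) 2)" and BA: "B * A = 1\<^sub>m 2"
  shows "dual_binary.action_mat l A = transpose_mat (binary.action_mat l B)"
proof (rule eq_matI)
  fix j k assume "j < dim_row (transpose_mat (binary.action_mat l B))" "k < dim_col (transpose_mat (binary.action_mat l B))"
  then have jk: "j < Suc l" "k < Suc l" by (auto simp: binary.action_mat_def)
  have len: "length (monomial_word l j :: 'k vec list) = l" using jk by (simp add: monomial_word_length)
  have set: "set (map ((*\<^sub>v) B) (monomial_word l j)) \<subseteq> carrier_vec 2"
    using B monomial_word_set by (auto intro!: mult_mat_vec_carrier[of _ 2 2])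
  have "act (sym_lower l nat2) A (orbit_sum l k) = act (tensor_power l nat2) A (orbit_sum l k)"
    by (simp add: sym_lower_def)
  then have "pairing l (monomial_word l j) (act (sym_lower l nat2) A (orbit_sum l k)) =
      pairing l (map ((*\<^sub>v) B) (monomial_word l j)) (orbit_sum l k)"
    using pairing_act[OF len monomial_word_set, of A B "orbit_sum l k"] A B BA by (simp add: orbit_sum_carrier)
  also have "\<dots> = coeff (binary_form (sym_prod nat2 (map ((*\<^sub>v) B) (monomial_word l j)))) k"
    using len set by (intro pairing_orbit_sum) auto
  also have "sym_prod nat2 (map ((*\<^sub>v) B) (monomial_word l j)) = act (sym_upper l nat2) B (sym_prod nat2 (monomial_word l j))"
    using nat2.sym_prod_act[OF B len] by (simp add: monomial_word_set)
  finally show "dual_binary.action_mat l A $$ (j, k) = transpose_mat (binary.action_mat l B) $$ (j, k)"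
    using jk by (simp add: binary.action_mat_def dual_binary.action_mat_def)
qed (auto simp: binary.action_mat_def dual_binary.action_mat_def)

section \<open>The determinant of the action\<close>

definition upper_shear :: "'k::field \<Rightarrow> 'k mat" where
  "upper_shear a = mat 2 2 (\<lambda>(i, j). if i = j then 1 else if i < j then a else 0)"

definition lower_shear :: "'k::field \<Rightarrow> 'k mat" where
  "lower_shear a = mat 2 2 (\<lambda>(i, j). if i = j then 1 else if j < i then a else 0)"

lemma upper_shear_simps [simp]:
  "upper_shear a \<in> carrier_mat 2 2" "dim_row (upper_shear a) = 2" "dim_col (upper_shear a) = 2"
  "upper_shear a $$ (0, 0) = 1" "upper_shear a $$ (0, Suc 0) = a"
  "upper_shear a $$ (Suc 0, 0) = 0" "upper_shear a $$ (Suc 0, Suc 0) = 1"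
  by (auto simp: upper_shear_def)

lemma lower_shear_simps [simp]:
  "lower_shear a \<in> carrier_mat 2 2" "dim_row (lower_shear a) = 2" "dim_col (lower_shear a) = 2"
  "lower_shear a $$ (0, 0) = 1" "lower_shear a $$ (0, Suc 0) = 0"
  "lower_shear a $$ (Suc 0, 0) = a" "lower_shear a $$ (Suc 0, Suc 0) = 1"
  by (auto simp: lower_shear_def)

lemma upper_shear_SL: "upper_shear a \<in> carrier (SL TYPE('k::field) 2)"
  by (simp add: det_mat2)

lemma lower_shear_SL: "lower_shear a \<in> carrier (SL TYPE('k::field) 2)"
  by (simp add: det_mat2)

text \<open>The shear fixes \<open>e0\<close> and sends \<open>e1\<close> to
  \<open>a e0 + e1\<close>, so the monomial of degree \<open>k\<close> becomes the
  \<open>k\<close>-th power of \<open>[:a, 1:]\<close>, monic of degree \<open>k\<close>. The matrix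
  is upper unitriangular.\<close>

lemma det_binary_upper_shear: "det (binary.action_mat l (upper_shear (a :: 'k::field))) = 1"
proof -
  let ?R = "binary.action_mat l (upper_shear a)"
  have R: "?R $$ (j, k) = coeff ([:a, 1:] ^ k) j" if "j < Suc l" "k < Suc l" for j k
    using that by (simp add: binary_action_mat[OF upper_shear_SL] one_pCons[symmetric])
  have c: "?R \<in> carrier_mat (Suc l) (Suc l)" by (simp add: binary.action_mat_def)
  have deg: "degree ([:a, 1:] ^ k) = k" for k by (simp add: degree_power_eq)
  have "upper_triangular ?R"
    using c by (auto intro!: upper_triangularI coeff_eq_0 simp: R deg)
  then have "det ?R = prod_list (diag_mat ?R)" by (rule det_upper_triangular[OF _ c])
  also have "diag_mat ?R = map (\<lambda>i. 1) [0..<Suc l]"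
    using c unfolding diag_mat_def
    by (intro map_cong) (auto simp: R lead_coeff_power[of "[:a, 1:]", unfolded deg] simp del: upt_Suc)
  finally show ?thesis by (simp add: map_replicate_const del: upt_Suc)
qed

text \<open>Here \<open>e0\<close> goes to \<open>e0 + a e1\<close> and \<open>e1\<close> is fixed:
  the image of the monomial of degree \<open>k\<close> is divisible by it, with cofactor of constant
  term 1. The matrix is lower unitriangular.\<close>

lemma det_binary_lower_shear: "det (binary.action_mat l (lower_shear (a :: 'k::field))) = 1"
proof -
  let ?R = "binary.action_mat l (lower_shear a)"
  have R: "?R $$ (j, k) = coeff ([:1, a:] ^ (l - k) * monom 1 k) j" if "j < Suc l" "k < Suc l" for j k
    using that by (simp add: binary_action_mat[OF lower_shear_SL] monom_altdef)
  have c: "?R \<in> carrier_mat (Suc l) (Suc l)" by (simp add: binary.action_mat_def)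
  have "det ?R = prod_list (diag_mat ?R)"
    by (rule det_lower_triangular[OF _ c]) (simp add: R mult.commute[of _ "monom 1 _"] coeff_monom_mult)
  also have "diag_mat ?R = map (\<lambda>i. 1) [0..<Suc l]"
    using c unfolding diag_mat_def
    by (intro map_cong) (auto simp: R mult.commute[of _ "monom 1 _"] coeff_monom_mult coeff_0_power simp del: upt_Suc)
  finally show ?thesis by (simp add: map_replicate_const del: upt_Suc)
qed

lemma sum_atLeast0_lessThan_2: "(\<Sum>i = 0..<2. f i) = f 0 + f (Suc 0)"
  by (simp add: numeral_2_eq_2)

text \<open>Gaussian elimination with the lower left entry as pivot. The two upper shears are chosen
  to produce the diagonal entries, and determinant 1 then forces the upper right entry.\<close>

lemma SL2_shear_decomposition:
  fixes A :: "'k::field mat"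
  assumes A: "A \<in> carrier (SL TYPE('k) 2)" and c: "A $$ (1, 0) \<noteq> 0"
  shows "A = upper_shear ((A $$ (0, 0) - 1) / A $$ (1, 0)) * (lower_shear (A $$ (1, 0)) * upper_shear ((A $$ (1, 1) - 1) / A $$ (1, 0)))"
proof (rule eq_matI)
  have d: "A $$ (0, 0) * A $$ (1, 1) - A $$ (0, 1) * A $$ (1, 0) = 1"
    using A det_mat2[of A] by simp
  \<comment> \<open>The determinant relation multiplied by \<open>r ^ 4\<close>, in the shape it
    takes once denominators in the upper right entry have been cleared.\<close>
  have clear_denominators: "r * (r * (r * r)) + q * (r * (r * (r * (r * r)))) = p * (r * (r * (r * (r * t))))"
    if "p * t - q * r = 1" for p q r t :: 'k
  proof -
    have "p * (r * (r * (r * (r * t)))) = p * t * r ^ 4" by (simp add: eval_nat_numeral)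
    also have "p * t = 1 + q * r" using that by (simp add: diff_eq_eq)
    finally show ?thesis by (simp add: algebra_simps eval_nat_numeral)
  qed
  fix i j assume "i < dim_row (upper_shear ((A $$ (0, 0) - 1) / A $$ (1, 0)) * (lower_shear (A $$ (1, 0)) * upper_shear ((A $$ (1, 1) - 1) / A $$ (1, 0))))"
    "j < dim_col (upper_shear ((A $$ (0, 0) - 1) / A $$ (1, 0)) * (lower_shear (A $$ (1, 0)) * upper_shear ((A $$ (1, 1) - 1) / A $$ (1, 0))))"
  then have "i = 0 \<or> i = 1" "j = 0 \<or> j = 1" by auto
  then show "A $$ (i, j) = (upper_shear ((A $$ (0, 0) - 1) / A $$ (1, 0)) * (lower_shear (A $$ (1, 0)) * upper_shear ((A $$ (1, 1) - 1) / A $$ (1, 0)))) $$ (i, j)"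
    using c clear_denominators[OF d] by (elim disjE; simp add: scalar_prod_def sum_atLeast0_lessThan_2 field_simps)
qed (use A in auto)

text \<open>The determinant of the action is multiplicative and equals 1 on shears, and every matrix
  of determinant 1 is a product of shears.\<close>

lemma det_binary_action:
  fixes A :: "'k::field mat"
  assumes A: "A \<in> carrier (SL TYPE('k) 2)"
  shows "det (binary.action_mat l A) = 1"
proof -
  have mult: "det (binary.action_mat l (B * C)) = det (binary.action_mat l B) * det (binary.action_mat l C)"
    if "B \<in> carrier (SL TYPE('k) 2)" "C \<in> carrier (SL TYPE('k) 2)" for B C :: "'k mat"
  proof -
    have "binary.action_mat l (B * C) = binary.action_mat l B * binary.action_mat l C"
      using binary.action_mat_mult[OF that] by simp
    then show ?thesis
      using det_mult[of "binary.action_mat l B" "Suc l" "binary.action_mat l C"] by (simp add: binary.action_mat_def)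
  qed
  interpret G: group "SL TYPE('k) 2" by (rule SL_group)
  have nonzero: "det (binary.action_mat l B) = 1"
    if B: "B \<in> carrier (SL TYPE('k) 2)" "B $$ (1, 0) \<noteq> 0" for B :: "'k mat"
  proof -
    have closed: "lower_shear x * upper_shear y \<in> carrier (SL TYPE('k) 2)" for x y :: 'k
      using G.m_closed[OF lower_shear_SL upper_shear_SL] by simp
    show ?thesis
      by (subst SL2_shear_decomposition[OF B])
        (simp only: mult upper_shear_SL lower_shear_SL closed det_binary_upper_shear det_binary_lower_shear mult_1)
  qed
  show ?thesis
  proof (cases "A $$ (1, 0) = 0")
    \<comment> \<open>If the lower left entry is 0, the upper left one is not. Adding the first row
      to the second, which is multiplication by a shear, creates the pivot.\<close>
    case True
    have A': "A \<in> carrier_mat 2 2" "det A = 1" using A by auto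
    then have "A $$ (0, 0) \<noteq> 0" using det_mat2[OF A'(1)] True by auto
    moreover have "(lower_shear 1 * A) $$ (1, 0) = A $$ (0, 0) + A $$ (1, 0)"
      using A' by (simp add: scalar_prod_def sum_atLeast0_lessThan_2)
    moreover have "lower_shear 1 * A \<in> carrier (SL TYPE('k) 2)"
      using G.m_closed[OF lower_shear_SL A] by simp
    ultimately have "det (binary.action_mat l (lower_shear 1 * A)) = 1" using True by (intro nonzero) auto
    then show ?thesis using mult[OF lower_shear_SL A, of 1] by (simp add: det_binary_lower_shear)
  qed (rule nonzero[OF A])
qed

lemma binary_dual_action:
  fixes A :: "'k::field mat"
  assumes A: "A \<in> carrier (SL TYPE('k) 2)"
  shows "binary.action_mat l A * transpose_mat (dual_binary.action_mat l A) = 1\<^sub>m (Suc l)"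
proof -
  interpret G: group "SL TYPE('k) 2" by (rule SL_group)
  define B where "B = inv\<^bsub>SL TYPE('k) 2\<^esub> A"
  have B: "B \<in> carrier (SL TYPE('k) 2)" "A * B = 1\<^sub>m 2" "B * A = 1\<^sub>m 2"
    using G.inv_closed[OF A] G.r_inv[OF A] G.l_inv[OF A] by (simp_all add: B_def)
  have "dual_binary.action_mat l A = transpose_mat (binary.action_mat l B)"
    by (rule dual_binary_action_mat[OF A B(1,3)])
  then have "binary.action_mat l A * transpose_mat (dual_binary.action_mat l A) = binary.action_mat l (A * B)"
    using binary.action_mat_mult[OF A B(1)] by simp
  then show ?thesis using binary.action_mat_one[of l] by (simp add: B(2))
qed

lemma indexed_basis_span:
  assumes "indexed_basis V B v" and V: "vectorspace class_ring V"
  shows "v ` B \<subseteq> carrier V" "lspan V (v ` B) = carrier V"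
  using assms(1) vectorspace.basis_def[OF V] unfolding indexed_basis_def by auto

theorem corollary1p3:
  fixes l s :: nat and lam :: "nat list" and B C :: "nat set"
    and v w :: "nat \<Rightarrow> _"
  assumes "is_partition lam"
    and "length lam \<le> l + 1"
    and "nth_default 0 lam 0 \<le> s"
    and "indexed_basis (sym_upper l (natural_rep TYPE('k::field) 2)) B v"
    and "indexed_basis (sym_lower l (natural_rep TYPE('k) 2)) C w"
  shows "rep_isomorphic (SL TYPE('k) 2)
           (schur lam (sym_upper l (natural_rep TYPE('k) 2)) B v)
           (schur (rect_complement (l + 1) s lam) (sym_lower l (natural_rep TYPE('k) 2)) C w)"
proof (rule schur_complement_isomorphic)
  \<comment> \<open>Any spanning family gives the same carrier, so the given bases can be traded for
    the mutually dual ones, monomials and orbit sums. The shapes are described by the column lengths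
    of \<open>lam\<close>, padded with empty columns up to \<open>s\<close>.\<close>
  show "dual_coord_reps (SL TYPE('k) 2) (sym_upper l (natural_rep TYPE('k) 2)) (sym_lower l (natural_rep TYPE('k) 2))
      (Suc l) (\<lambda>k. sym_prod (natural_rep TYPE('k) 2) (monomial_word l k)) (\<lambda>j x. coeff (binary_form x) j)
      (orbit_sum l) (\<lambda>j. pairing l (monomial_word l j)) lam (rect_complement (l + 1) s lam) s (col_len lam)"
    by (intro dual_coord_reps.intro binary_coord_rep dual_binary_coord_rep dual_coord_reps_axioms.intro)
      (use diagram_columns[OF assms(1-3)] diagram_rect_complement[OF assms(1-3)]
        length_rect_complement[OF assms(1-3)] col_len_le[OF assms(1-3)] assms(2) in auto)
  note upper = representationD(3)[OF nat2.upper_rep[where 'k = 'k and r = l]]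
    and lower = representationD(3)[OF nat2.lower_rep[where 'k = 'k and r = l]]
  show "v ` B \<subseteq> carrier (sym_upper l (natural_rep TYPE('k) 2))"
    "lspan (sym_upper l (natural_rep TYPE('k) 2)) (v ` B) = carrier (sym_upper l (natural_rep TYPE('k) 2))"
    by (rule indexed_basis_span[OF assms(4) upper])+
  show "w ` C \<subseteq> carrier (sym_lower l (natural_rep TYPE('k) 2))"
    "lspan (sym_lower l (natural_rep TYPE('k) 2)) (w ` C) = carrier (sym_lower l (natural_rep TYPE('k) 2))"
    by (rule indexed_basis_span[OF assms(5) lower])+
qed (rule binary_dual_action det_binary_action; assumption)+

end
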